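(* Let $k$ be an algebraically closed field of characteristic zero. Let $F=F(\mathbf u,x,y,z)\in k[\mathbf u,x,y,z]$ be a family of irreducible rational plane curves of degree $4$ with a fixed set of singular points (the singularity types being fixed). Then the general member $f=F(\alpha)\in k[x,y,z]$ of this family has gradient ideal of linear type.
   Context: Family of plane curves of degree $d$ over the parameters $\mathbf u=u_1,\dots,u_m$: a polynomial $F\in k[\mathbf u][x,y,z]$, homogeneous of degree $d$ in $x,y,z$, with content $1$ with respect to its coefficients in $k[\mathbf u]$, of the form $F=\phi_0(x,y,z)+\sum_{j=1}^m u_j\phi_j(x,y,z)$, where $m\le\binom{d+2}{2}-1$, $\phi_0\ne0$ is a form of degree $d$ and $\phi_1,\dots,\phi_m$ are (up to nonzero scalars) distinct monomials of degree $d$ in $x,y,z$ (the case $m=0$ of a single curve is allowed). For $\alpha\in\mathbb A^m_k$, $F(\alpha)\in k[x,y,z]$ is obtained by substituting $\mathbf u\mapsto\alpha$; the general member is $F(\alpha)$ for $\alpha$ general, i.e. outside some proper closed subset of $\mathbb A^m_k$. Here $d=4$ and the general member is an irreducible rational (geometric genus $0$) quartic in $\mathbb P^2_k$ whose set of singular points and the types of these singularities do not depend on the general $\alpha$. The gradient ideal of $f$ is $I_f=(\partial f/\partial x,\partial f/\partial y,\partial f/\partial z)\subset k[x,y,z]$. An ideal is of linear type if the natural surjection from its symmetric algebra to its Rees algebra is an isomorphism. *)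

theory Defs
  imports
    "HOL-Library.Poly_Mapping"
    "HOL-Library.Numeral_Type"
    "HOL-Library.FuncSet"
    "HOL-Computational_Algebra.Computational_Algebra"
    "HOL-Algebra.Ideal_Product"
    "HOL-Algebra.QuotRing"
    "HOL-Algebra.Algebraic_Closure_Type"
begin

section \<open>Multivariate polynomials\<close>

text \<open>
  Polynomials with variables indexed by the type \<open>'v\<close>.  The ring $k[x,y,z]$ is
  \<open>(3, 'k) mpoly\<close>, the three elements \<open>0, 1, 2\<close> of the type \<open>3\<close> indexing $x, y, z$.
\<close>

type_synonym ('v, 'a) mpoly = "('v \<Rightarrow>\<^sub>0 nat) \<Rightarrow>\<^sub>0 'a"

definition mconst :: "'a::comm_ring_1 \<Rightarrow> ('v, 'a) mpoly" where
  "mconst c = Poly_Mapping.single 0 c"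

definition mvar :: "'v \<Rightarrow> ('v, 'a::comm_ring_1) mpoly" where
  "mvar v = Poly_Mapping.single (Poly_Mapping.single v 1) 1"

definition polys_in :: "'v set \<Rightarrow> ('v, 'a::comm_ring_1) mpoly set" where
  "polys_in V = {p. \<forall>\<mu>\<in>Poly_Mapping.keys p. Poly_Mapping.keys \<mu> \<subseteq> V}"

text \<open>Evaluation at \<open>x\<close>, with the ring homomorphism \<open>h\<close> applied to the coefficients.\<close>

definition mpoly_eval ::
    "('a::comm_ring_1 \<Rightarrow> 'b::comm_ring_1) \<Rightarrow> ('v \<Rightarrow> 'b) \<Rightarrow> ('v, 'a) mpoly \<Rightarrow> 'b" where
  "mpoly_eval h x p = (\<Sum>\<mu>\<in>Poly_Mapping.keys p.
     h (Poly_Mapping.lookup p \<mu>) * (\<Prod>v\<in>Poly_Mapping.keys \<mu>. x v ^ Poly_Mapping.lookup \<mu> v))"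

definition mpderiv :: "'v \<Rightarrow> ('v, 'a::comm_ring_1) mpoly \<Rightarrow> ('v, 'a) mpoly" where
  "mpderiv v p = (\<Sum>\<mu>\<in>Poly_Mapping.keys p.
     Poly_Mapping.single (\<mu> - Poly_Mapping.single v 1) (of_nat (Poly_Mapping.lookup \<mu> v) * Poly_Mapping.lookup p \<mu>))"

definition homogeneous :: "nat \<Rightarrow> ('v::finite, 'a::comm_ring_1) mpoly \<Rightarrow> bool" where
  "homogeneous d p \<longleftrightarrow> (\<forall>\<mu>\<in>Poly_Mapping.keys p. (\<Sum>v\<in>UNIV. Poly_Mapping.lookup \<mu> v) = d)"

section \<open>Affine space and general members\<close>

definition affine_space :: "nat \<Rightarrow> (nat \<Rightarrow> 'k::field) set" where
  "affine_space m = {..<m} \<rightarrow>\<^sub>E UNIV"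

definition zariski_closed :: "nat \<Rightarrow> (nat \<Rightarrow> 'k::field) set \<Rightarrow> bool" where
  "zariski_closed m Z \<longleftrightarrow>
     (\<exists>P. P \<subseteq> polys_in {..<m} \<and> Z = {\<alpha> \<in> affine_space m. \<forall>p\<in>P. mpoly_eval id \<alpha> p = 0})"

definition for_general :: "nat \<Rightarrow> ((nat \<Rightarrow> 'k::field) \<Rightarrow> bool) \<Rightarrow> bool" where
  "for_general m Q \<longleftrightarrow>
     (\<exists>Z. zariski_closed m Z \<and> Z \<subset> affine_space m \<and> (\<forall>\<alpha> \<in> affine_space m - Z. Q \<alpha>))"

section \<open>Families of plane curves\<close>

text \<open>
  The parameters $u_1,\dots,u_m$ are the variables with index \<open>j < m\<close> in \<open>(nat, 'k) mpoly\<close>;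
  an element of $k[\mathbf u][x,y,z]$ has coefficients in that ring.
\<close>

definition base_change :: "(3, 'k::field) mpoly \<Rightarrow> (3, (nat, 'k) mpoly) mpoly" where
  "base_change \<phi> = Poly_Mapping.map mconst \<phi>"

definition content_one :: "nat \<Rightarrow> (3, (nat, 'k::field) mpoly) mpoly \<Rightarrow> bool" where
  "content_one m F \<longleftrightarrow>
     (\<forall>g\<in>polys_in {..<m}. (\<forall>\<mu>\<in>Poly_Mapping.keys F. g dvd Poly_Mapping.lookup F \<mu>) \<longrightarrow> g dvd 1)"

definition plane_curve_family :: "nat \<Rightarrow> nat \<Rightarrow> (3, (nat, 'k::field) mpoly) mpoly \<Rightarrow> bool" where
  "plane_curve_family d m F \<longleftrightarrow>
     m \<le> ((d + 2) choose 2) - 1 \<and> homogeneous d F \<and> content_one m F \<and>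
     (\<exists>\<phi>\<^sub>0 (\<phi> :: nat \<Rightarrow> (3, 'k) mpoly) \<mu> c.
        \<phi>\<^sub>0 \<noteq> 0 \<and> homogeneous d \<phi>\<^sub>0 \<and>
        inj_on \<mu> {..<m} \<and>
        (\<forall>j<m. \<phi> j = Poly_Mapping.single (\<mu> j) (c j) \<and> c j \<noteq> 0 \<and> homogeneous d (\<phi> j)) \<and>
        F = base_change \<phi>\<^sub>0 + (\<Sum>j<m. mconst (mvar j) * base_change (\<phi> j)))"

definition family_member ::
    "(3, (nat, 'k::field) mpoly) mpoly \<Rightarrow> (nat \<Rightarrow> 'k) \<Rightarrow> (3, 'k) mpoly" where
  "family_member F \<alpha> = Poly_Mapping.map (mpoly_eval id \<alpha>) F"

section \<open>Rational plane curves\<close>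

text \<open>
  The function field of the curve $f = 0$, for an irreducible form $f$: fractions $g/h$ of forms
  of equal degree with $f \nmid h$, where $g/h = g'/h'$ iff $f \mid gh' - g'h$.
\<close>

definition ff_pairs :: "(3, 'k::field) mpoly \<Rightarrow> ((3, 'k) mpoly \<times> (3, 'k) mpoly) set" where
  "ff_pairs f = {(g, h). (\<exists>n. homogeneous n g \<and> homogeneous n h) \<and> \<not> f dvd h}"

definition ff_rel ::
    "(3, 'k::field) mpoly \<Rightarrow> ((3, 'k) mpoly \<times> (3, 'k) mpoly) rel" where
  "ff_rel f = {((g, h), (g', h')).
     (g, h) \<in> ff_pairs f \<and> (g', h') \<in> ff_pairs f \<and> f dvd g * h' - g' * h}"

definition function_field :: "(3, 'k::field) mpoly \<Rightarrow> ((3, 'k) mpoly \<times> (3, 'k) mpoly) set ring" where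
  "function_field f =
     \<lparr>carrier = ff_pairs f // ff_rel f,
      monoid.mult = (\<lambda>A B. \<Union>(g, h)\<in>A. \<Union>(g', h')\<in>B. ff_rel f `` {(g * g', h * h')}),
      monoid.one = ff_rel f `` {(1, 1)},
      ring.zero = ff_rel f `` {(0, 1)},
      ring.add = (\<lambda>A B. \<Union>(g, h)\<in>A. \<Union>(g', h')\<in>B. ff_rel f `` {(g * h' + g' * h, h * h')})\<rparr>"

text \<open>
  A rational curve is one birational to the projective line: its function field is isomorphic
  to $k(t)$ over $k$.
\<close>

definition rational_curve :: "(3, 'k::field) mpoly \<Rightarrow> bool" where
  "rational_curve f \<longleftrightarrow>
     (\<exists>\<psi> \<in> ring_iso (function_field f) (ring_of_type_algebra :: 'k poly fract ring).
        \<forall>c. \<psi> (ff_rel f `` {(mconst c, 1)}) = Fract [:c:] 1)"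

section \<open>Singularities\<close>

text \<open>
  Points of the projective plane are given by all their vectors of homogeneous coordinates,
  so that sets of points become sets of nonzero vectors stable under scaling.
\<close>

definition singular_points :: "(3, 'k::field) mpoly \<Rightarrow> (3 \<Rightarrow> 'k) set" where
  "singular_points f = {p. p \<noteq> (\<lambda>_. 0) \<and> mpoly_eval id p f = 0 \<and>
     (\<forall>i. mpoly_eval id p (mpderiv i f) = 0)}"

text \<open>
  The equation of \<open>f\<close> at \<open>p\<close> in the affine chart where coordinate \<open>i\<close> is $1$, translated to
  the origin, as an element of $k[[u,v]]$ (represented as $k[[u]][[v]]$).  Addition on the
  index type \<open>3\<close> is modulo $3$.
\<close>

definition const2 :: "'k::field \<Rightarrow> 'k fps fps" where
  "const2 c = fps_const (fps_const c)"

definition local_equation :: "3 \<Rightarrow> (3, 'k::field) mpoly \<Rightarrow> (3 \<Rightarrow> 'k) \<Rightarrow> 'k fps fps" where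
  "local_equation i f p = mpoly_eval const2
     (\<lambda>j. if j = i then 1
          else if j = i + 1 then const2 (p j / p i) + fps_const fps_X
          else const2 (p j / p i) + fps_X) f"

text \<open>
  The analytic type of a plane curve singularity: power series are contact equivalent if they
  agree up to a unit and a $k$-algebra automorphism of $k[[u,v]]$.  The type of \<open>f\<close> at \<open>p\<close> is
  the contact equivalence class of its local equation.
\<close>

definition contact_equivalent :: "'k::field fps fps \<Rightarrow> 'k fps fps \<Rightarrow> bool" where
  "contact_equivalent a b \<longleftrightarrow>
     (\<exists>\<Phi> \<in> ring_iso ring_of_type_algebra ring_of_type_algebra. \<exists>e.
        (\<forall>c. \<Phi> (const2 c) = const2 c) \<and> e dvd 1 \<and> \<Phi> a = e * b)"

definition singularity_type :: "(3, 'k::field) mpoly \<Rightarrow> (3 \<Rightarrow> 'k) \<Rightarrow> 'k fps fps set" where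
  "singularity_type f p =
     {a. \<exists>i. p i \<noteq> 0 \<and> contact_equivalent a (local_equation i f p)}"

section \<open>Ideals of linear type\<close>

definition gradient_ideal :: "(3, 'k::field) mpoly \<Rightarrow> (3, 'k) mpoly set" where
  "gradient_ideal f = Idl\<^bsub>ring_of_type_algebra\<^esub> {mpderiv 0 f, mpderiv 1 f, mpderiv 2 f}"

definition polynomial_ring :: "'v set \<Rightarrow> ('v, 'a::comm_ring_1) mpoly ring" where
  "polynomial_ring V = ring_of_type_algebra\<lparr>carrier := polys_in V\<rparr>"

text \<open>
  The symmetric algebra of the module \<open>I\<close> is the polynomial ring with one variable for each
  element of \<open>I\<close>, modulo the relations making \<open>mvar\<close> linear on \<open>I\<close>.
\<close>

definition linearity_relations :: "'a::comm_ring_1 set \<Rightarrow> ('a, 'a) mpoly set" where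
  "linearity_relations I =
     {mvar (a + b) - mvar a - mvar b | a b. a \<in> I \<and> b \<in> I} \<union>
     {mvar (r * a) - mconst r * mvar a | r a. a \<in> I}"

definition symmetric_algebra :: "'a::comm_ring_1 set \<Rightarrow> ('a, 'a) mpoly set ring" where
  "symmetric_algebra I =
     polynomial_ring I Quot (Idl\<^bsub>polynomial_ring I\<^esub> (linearity_relations I))"

primrec ideal_power :: "'a::comm_ring_1 set \<Rightarrow> nat \<Rightarrow> 'a set" where
  "ideal_power I 0 = UNIV"
| "ideal_power I (Suc n) = ideal_prod ring_of_type_algebra I (ideal_power I n)"

text \<open>The Rees algebra $\bigoplus_n I^n t^n$ as a subring of the univariate polynomials in $t$.\<close>

definition rees_algebra :: "'a::comm_ring_1 set \<Rightarrow> 'a poly ring" where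
  "rees_algebra I =
     ring_of_type_algebra\<lparr>carrier := {p. \<forall>n. Polynomial.coeff p n \<in> ideal_power I n}\<rparr>"

text \<open>
  The map induced by sending the variable of $a \in I$ to $a t$; this substitution is constant
  on cosets, being zero on the linearity relations.
\<close>

definition sym_to_rees :: "'a::comm_ring_1 set \<Rightarrow> ('a, 'a) mpoly set \<Rightarrow> 'a poly" where
  "sym_to_rees I C =
     the_elem (mpoly_eval (\<lambda>r. [:r:]) (\<lambda>a. Polynomial.monom a 1) ` C)"

definition linear_type :: "'a::comm_ring_1 set \<Rightarrow> bool" where
  "linear_type I \<longleftrightarrow> sym_to_rees I \<in> ring_iso (symmetric_algebra I) (rees_algebra I)"

end

theory Submission
  imports Defs "Berlekamp_Zassenhaus.Unique_Factorization_Poly"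
begin

text \<open>
  An irreducible plane quartic has only double and triple points, and at each of them it is
  locally quasi-homogeneous: in affine coordinates its equation \<open>g\<close> lies in the ideal of its two
  partial derivatives in the local ring.  At a double point this is seen on the smooth curve given
  by one partial derivative, along which differentiation lowers the order of \<open>g\<close> by one; at a
  triple point the fourth power of the maximal ideal lies in the Jacobian ideal.

  Choose coordinates such that the line \<open>Z = 0\<close> is transversal to the curve.  Then the derivatives
  \<open>a\<close>, \<open>b\<close>, \<open>c\<close> of \<open>f\<close> along the coordinates are such that \<open>b\<close>, \<open>a\<close> is a regular sequence and
  \<open>Z\<close> is a non-zero-divisor modulo \<open>(a, b)\<close>; the local statement and a Nullstellensatz
  argument on the chart \<open>Z = 1\<close> give $Z^n c \in (a, b, c^2)$, so that $(a, b) : c^2 = (a, b) : c$.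
  Hence \<open>b\<close>, \<open>a\<close>, \<open>c\<close> is a d-sequence, and ideals generated by d-sequences are of linear type.
\<close>

text \<open>No ring is localised at a point. Let m be the maximal ideal of the point and J the ideal
  of the two partial derivatives of g. Instead of g in J locally, the proof shows g in J + m^n for
  every n; one polynomial T that does not vanish at the point and multiplies a high power of m into
  J then turns this into a global statement. Degree 4 enters through the lines: a point of
  multiplicity 4 would split the quartic into lines, and at a triple point whose tangent cone
  contains a double line, the absence of a line component forces a fourth power of the other
  coordinate to occur. Euler's identity leads from g to c: on Z = 1 it reads 4 g = X a + Y b + c, so
  c and 4 g agree modulo (a, b). Globally only g - r g^2 in (a, b) is to be expected, because a and
  b may also vanish together off the curve, where g is a unit; this quadratic relation is just the
  shape that the condition on (a, b) : c^2 asks for.\<close>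

hide_const (open) Divisibility.irreducible up_ring.monom up_ring.coeff

section \<open>Evaluation of multivariate polynomials\<close>

abbreviation (input) keys where "keys \<equiv> Poly_Mapping.keys"
abbreviation (input) lookup where "lookup \<equiv> Poly_Mapping.lookup"

lemma mpoly_single_induct [case_names single add]:
  assumes "\<And>\<mu> c. P (Poly_Mapping.single \<mu> c)"
    and "\<And>p q. P p \<Longrightarrow> P q \<Longrightarrow> P (p + q)"
  shows "P (p :: 'b \<Rightarrow>\<^sub>0 'a::comm_monoid_add)"
proof (induction p rule: Poly_Mapping.update_induct)
  case const
  show ?case using assms(1)[of undefined 0] by simp
next
  case (update f a b)
  have "Poly_Mapping.update a b f = f + Poly_Mapping.single a b"
    using update by (intro poly_mapping_eqI)
      (auto simp: lookup_add lookup_update lookup_single in_keys_iff when_def)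
  then show ?case using update assms by simp
qed

lemma sum_singles: "p = (\<Sum>\<mu>\<in>keys p. Poly_Mapping.single \<mu> (lookup p \<mu>))"
  by (intro poly_mapping_eqI)
    (auto simp: lookup_sum lookup_single when_def in_keys_iff if_distrib sum.delta'
      intro!: sum.neutral)

definition mon_eval :: "('v \<Rightarrow> 'b::comm_ring_1) \<Rightarrow> ('v \<Rightarrow>\<^sub>0 nat) \<Rightarrow> 'b" where
  "mon_eval x \<mu> = (\<Prod>v\<in>keys \<mu>. x v ^ lookup \<mu> v)"

lemma mon_eval_superset:
  assumes "finite K" "keys \<mu> \<subseteq> K"
  shows "mon_eval x \<mu> = (\<Prod>v\<in>K. x v ^ lookup \<mu> v)"
  unfolding mon_eval_def using assms
  by (intro prod.mono_neutral_left) (auto simp: in_keys_iff)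

lemma mon_eval_0 [simp]: "mon_eval x 0 = 1"
  by (simp add: mon_eval_def)

lemma mon_eval_add: "mon_eval x (\<mu> + \<nu>) = mon_eval x \<mu> * mon_eval x \<nu>"
proof -
  let ?K = "keys \<mu> \<union> keys \<nu>"
  have "keys (\<mu> + \<nu>) \<subseteq> ?K" by (rule keys_add)
  then show ?thesis
    by (simp add: mon_eval_superset[of ?K] lookup_add power_add prod.distrib)
qed

lemma mon_eval_single [simp]: "mon_eval x (Poly_Mapping.single v n) = x v ^ n"
  by (cases "n = 0") (simp_all add: mon_eval_def)

lemma mpoly_eval_superset:
  assumes "h 0 = 0" "finite K" "keys p \<subseteq> K"
  shows "mpoly_eval h x p = (\<Sum>\<mu>\<in>K. h (lookup p \<mu>) * mon_eval x \<mu>)"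
  unfolding mpoly_eval_def mon_eval_def using assms
  by (intro sum.mono_neutral_left) (auto simp: in_keys_iff)

context comm_ring_hom
begin

lemma mpoly_eval_single:
  "mpoly_eval hom x (Poly_Mapping.single \<mu> c) = hom c * mon_eval x \<mu>"
  by (cases "c = 0") (simp_all add: mpoly_eval_def mon_eval_def)

lemma mpoly_eval_add: "mpoly_eval hom x (p + q) = mpoly_eval hom x p + mpoly_eval hom x q"
proof -
  let ?K = "keys p \<union> keys q"
  have "keys (p + q) \<subseteq> ?K" by (rule keys_add)
  then show ?thesis
    by (simp add: mpoly_eval_superset[of _ ?K] lookup_add hom_add distrib_right sum.distrib)
qed

lemma mpoly_eval_mult: "mpoly_eval hom x (p * q) = mpoly_eval hom x p * mpoly_eval hom x q"
proof (induction p rule: mpoly_single_induct)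
  case p: (single \<mu> c)
  show ?case
  proof (induction q rule: mpoly_single_induct)
    case (single \<nu> d)
    show ?case
      by (simp add: mult_single mpoly_eval_single mon_eval_add hom_mult mult_ac)
  qed (simp add: distrib_left mpoly_eval_add)
qed (simp add: distrib_right mpoly_eval_add)

lemma comm_ring_hom_mpoly_eval: "comm_ring_hom (mpoly_eval hom x)"
proof unfold_locales
  show "mpoly_eval hom x 0 = 0"
    by (simp add: mpoly_eval_def)
  have "mpoly_eval hom x (Poly_Mapping.single 0 1) = 1"
    by (subst mpoly_eval_single) simp
  then show "mpoly_eval hom x 1 = 1" by simp
qed (simp_all add: mpoly_eval_add mpoly_eval_mult)

lemma mpoly_eval_mconst [simp]: "mpoly_eval hom x (mconst c) = hom c"
  by (simp add: mconst_def mpoly_eval_single)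

lemma mpoly_eval_mvar [simp]: "mpoly_eval hom x (mvar v) = x v"
  by (simp add: mvar_def mpoly_eval_single)

end

lemma comm_ring_hom_mconst: "comm_ring_hom mconst"
  by unfold_locales (simp_all add: mconst_def single_add mult_single)

interpretation mconst: comm_ring_hom mconst by (rule comm_ring_hom_mconst)

lemma comm_ring_hom_id: "comm_ring_hom (id :: 'a::comm_ring_1 \<Rightarrow> 'a)"
  by unfold_locales simp_all

lemma mvar_power: "mvar v ^ n = Poly_Mapping.single (Poly_Mapping.single v n) 1"
  by (induction n) (simp_all add: mvar_def mult_single single_add[symmetric])

lemma single_eq_mconst_mon_eval:
  "Poly_Mapping.single \<mu> (c::'a::comm_ring_1) = mconst c * mon_eval mvar \<mu>"
proof -
  have "mon_eval mvar \<mu> = Poly_Mapping.single \<mu> (1::'a)" for \<mu> :: "'b \<Rightarrow>\<^sub>0 nat"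
  proof (induction \<mu> rule: mpoly_single_induct)
    case (single v n)
    then show ?case by (simp add: mvar_power)
  next
    case (add p q)
    then show ?case by (simp add: mon_eval_add mult_single)
  qed
  then show ?thesis by (simp add: mconst_def mult_single)
qed

lemma mpoly_eval_mconst_mvar: "mpoly_eval mconst mvar p = p"
proof (induction p rule: mpoly_single_induct)
  case (single \<mu> c)
  show ?case
    by (simp add: mconst.mpoly_eval_single single_eq_mconst_mon_eval[symmetric])
qed (simp add: mconst.mpoly_eval_add)

text \<open>The variables are confined to V because a variable of the symmetric algebra has to be an
  element of the ideal before it can be reduced to the generators.\<close>

lemma monomial_induct [consumes 1, case_names const var]:
  assumes "keys \<mu> \<subseteq> V"
    and const: "P (mconst c)"
    and var: "\<And>v p. v \<in> V \<Longrightarrow> P p \<Longrightarrow> P (mvar v * p)"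
  shows "P (Poly_Mapping.single \<mu> (c::'a::comm_ring_1))"
proof -
  have pow: "P (mvar v ^ n * p)" if "v \<in> V" "P p" for v n p
    using that by (induction n) (simp_all add: mult.assoc var)
  have "P (mconst c * (\<Prod>v\<in>K. mvar v ^ lookup \<mu> v))"
    if "finite K" "K \<subseteq> V" for K
    using that
  proof (induction K rule: finite_induct)
    case (insert v K)
    then have "P (mvar v ^ lookup \<mu> v *
        (mconst c * (\<Prod>v\<in>K. mvar v ^ lookup \<mu> v)))"
      by (intro pow) auto
    then show ?case using insert by (simp add: mult_ac)
  qed (simp add: const)
  from this[of "keys \<mu>"] show ?thesis
    using assms(1) by (simp add: single_eq_mconst_mon_eval mon_eval_def)
qed

lemma mpoly_induct [case_names const var add mult]:
  assumes "\<And>c. P (mconst c)" "\<And>v. P (mvar v)"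
    and "\<And>p q. P p \<Longrightarrow> P q \<Longrightarrow> P (p + q)" "\<And>p q. P p \<Longrightarrow> P q \<Longrightarrow> P (p * q)"
  shows "P (p :: ('v, 'a::comm_ring_1) mpoly)"
proof (induction p rule: mpoly_single_induct)
  case (single \<mu> c)
  have "keys \<mu> \<subseteq> UNIV" by simp
  then show ?case by (induction rule: monomial_induct) (auto intro: assms)
qed (use assms in auto)

text \<open>The universal property of a polynomial ring in one variable; nested, it yields the
  homomorphisms out of \<open>'k poly poly\<close> and \<open>'k poly poly poly\<close>.\<close>

definition poly_lift :: "('a::comm_ring_1 \<Rightarrow> 'b::comm_ring_1) \<Rightarrow> 'b \<Rightarrow> 'a poly \<Rightarrow> 'b" where
  "poly_lift h x p = poly (map_poly h p) x"

context comm_ring_hom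
begin

lemma comm_ring_hom_poly_lift: "comm_ring_hom (poly_lift hom x)"
proof -
  interpret mp: map_poly_comm_ring_hom hom ..
  show ?thesis by unfold_locales (simp_all add: poly_lift_def mp.hom_add mp.hom_mult)
qed

lemma poly_lift_pCons [simp]: "poly_lift hom x (pCons c p) = hom c + x * poly_lift hom x p"
  by (simp add: poly_lift_def map_poly_pCons_hom)

lemma poly_lift_0 [simp]: "poly_lift hom x 0 = 0"
  by (simp add: poly_lift_def)

end

lemma poly_hom_eqI:
  assumes "comm_ring_hom h" "comm_ring_hom h'"
    and "\<And>c. h [:c:] = h' [:c:]" "h [:0, 1:] = h' [:0, 1:]"
  shows "h p = h' (p :: 'a::comm_ring_1 poly)"
proof -
  interpret h: comm_ring_hom h by fact
  interpret h': comm_ring_hom h' by fact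
  show ?thesis
  proof (induction p)
    case (pCons c p)
    have "pCons c p = [:c:] + [:0, 1:] * p" by simp
    then show ?case
      using pCons.IH assms(3,4) by (metis h.hom_add h.hom_mult h'.hom_add h'.hom_mult)
  qed simp
qed

section \<open>A criterion for linear type\<close>

lemma polys_in_0 [simp]: "0 \<in> polys_in V"
  by (simp add: polys_in_def)

lemma polys_in_add: "p \<in> polys_in V \<Longrightarrow> q \<in> polys_in V \<Longrightarrow> p + q \<in> polys_in V"
  using keys_add[of p q] by (fastforce simp: polys_in_def)

lemma polys_in_uminus: "p \<in> polys_in V \<Longrightarrow> - p \<in> polys_in V"
  by (simp add: polys_in_def in_keys_iff)

lemma polys_in_diff: "p \<in> polys_in V \<Longrightarrow> q \<in> polys_in V \<Longrightarrow> p - q \<in> polys_in V"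
  using polys_in_add[of p V "- q"] by (simp add: polys_in_uminus)

lemma polys_in_mult: "p \<in> polys_in V \<Longrightarrow> q \<in> polys_in V \<Longrightarrow> p * q \<in> polys_in V"
proof -
  assume pq: "p \<in> polys_in V" "q \<in> polys_in V"
  show ?thesis unfolding polys_in_def
  proof safe
    fix \<mu> v assume "\<mu> \<in> keys (p * q)" "v \<in> keys \<mu>"
    then obtain \<mu>1 \<mu>2 where *: "\<mu> = \<mu>1 + \<mu>2" "\<mu>1 \<in> keys p" "\<mu>2 \<in> keys q"
      using keys_mult[of p q] by blast
    with \<open>v \<in> keys \<mu>\<close> have "v \<in> keys \<mu>1 \<union> keys \<mu>2"
      using keys_add[of \<mu>1 \<mu>2] by auto
    with * pq show "v \<in> V" by (auto simp: polys_in_def)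
  qed
qed

lemma polys_in_mconst [simp]: "mconst c \<in> polys_in V"
  by (auto simp: polys_in_def mconst_def split: if_splits)

lemma polys_in_1 [simp]: "1 \<in> polys_in V"
  using polys_in_mconst[of 1 V] by simp

lemma polys_in_mvar [simp]: "v \<in> V \<Longrightarrow> mvar v \<in> polys_in V"
  by (auto simp: polys_in_def mvar_def split: if_splits)

section \<open>Rings as records over a type class, and ideals with three generators\<close>

lemma rta_simps [simp]:
  "carrier ring_of_type_algebra = UNIV"
  "x \<otimes>\<^bsub>ring_of_type_algebra\<^esub> y = x * y"
  "x \<oplus>\<^bsub>ring_of_type_algebra\<^esub> y = x + y"
  "\<one>\<^bsub>ring_of_type_algebra\<^esub> = 1"
  "\<zero>\<^bsub>ring_of_type_algebra\<^esub> = 0"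
  by (simp_all add: ring_of_type_algebra_def)

lemma rta_a_inv [simp]: "\<ominus>\<^bsub>ring_of_type_algebra\<^esub> x = - (x::'a::comm_ring_1)"
proof -
  interpret ring "ring_of_type_algebra :: 'a ring" by (rule ring_from_type_algebra)
  have "\<ominus>\<^bsub>ring_of_type_algebra\<^esub> x \<oplus>\<^bsub>ring_of_type_algebra\<^esub> x = \<zero>\<^bsub>ring_of_type_algebra\<^esub>"
    by (rule l_neg) simp
  then show ?thesis by (simp add: add_eq_0_iff2)
qed

lemma ring_polynomial_ring: "ring (polynomial_ring V :: ('v, 'a::comm_ring_1) mpoly ring)"
proof -
  interpret ring "ring_of_type_algebra :: ('v, 'a) mpoly ring" by (rule ring_from_type_algebra)
  have "subring (polys_in V) (ring_of_type_algebra :: ('v, 'a) mpoly ring)"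
    by (rule subringI) (simp_all add: polys_in_uminus polys_in_mult polys_in_add)
  then show ?thesis unfolding polynomial_ring_def by (rule subring_is_ring)
qed

lemma polynomial_ring_simps [simp]:
  "carrier (polynomial_ring V) = polys_in V"
  "x \<otimes>\<^bsub>polynomial_ring V\<^esub> y = x * y"
  "x \<oplus>\<^bsub>polynomial_ring V\<^esub> y = x + y"
  "\<one>\<^bsub>polynomial_ring V\<^esub> = 1"
  "\<zero>\<^bsub>polynomial_ring V\<^esub> = 0"
  by (simp_all add: polynomial_ring_def ring_of_type_algebra_def)

definition ideal3 :: "'a::comm_ring_1 \<Rightarrow> 'a \<Rightarrow> 'a \<Rightarrow> 'a set" where
  "ideal3 a b c = {u * a + v * b + w * c |u v w. True}"

lemma ideal3I: "u * a + v * b + w * c \<in> ideal3 a b c"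
  by (auto simp: ideal3_def)

lemma ideal3_add: "x \<in> ideal3 a b c \<Longrightarrow> y \<in> ideal3 a b c \<Longrightarrow> x + y \<in> ideal3 a b c"
proof -
  assume "x \<in> ideal3 a b c" "y \<in> ideal3 a b c"
  then obtain u v w u' v' w' where "x = u * a + v * b + w * c" "y = u' * a + v' * b + w' * c"
    by (auto simp: ideal3_def)
  then have "x + y = (u + u') * a + (v + v') * b + (w + w') * c" by (simp add: algebra_simps)
  then show ?thesis by (simp only: ideal3I)
qed

lemma ideal3_mult: "x \<in> ideal3 a b c \<Longrightarrow> r * x \<in> ideal3 a b c"
proof -
  assume "x \<in> ideal3 a b c"
  then obtain u v w where "x = u * a + v * b + w * c" by (auto simp: ideal3_def)
  then have "r * x = (r * u) * a + (r * v) * b + (r * w) * c" by (simp add: algebra_simps)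
  then show ?thesis by (simp only: ideal3I)
qed

lemma ideal3_mult_right: "x \<in> ideal3 a b c \<Longrightarrow> x * r \<in> ideal3 a b c"
  using ideal3_mult[of x a b c r] by (simp add: mult.commute)

lemma genideal_triple: "Idl\<^bsub>ring_of_type_algebra\<^esub> {a, b, c} = ideal3 a b (c::'a::comm_ring_1)"
proof -
  interpret ring "ring_of_type_algebra :: 'a ring" by (rule ring_from_type_algebra)
  have ideal: "ideal (Idl\<^bsub>ring_of_type_algebra\<^esub> {a, b, c}) ring_of_type_algebra"
    by (rule genideal_ideal) simp
  interpret I: ideal "Idl\<^bsub>ring_of_type_algebra\<^esub> {a, b, c}" ring_of_type_algebra by (rule ideal)
  have gen: "{a, b, c} \<subseteq> Idl\<^bsub>ring_of_type_algebra\<^esub> {a, b, c}"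
    by (rule genideal_self) simp
  have "ideal (ideal3 a b c) ring_of_type_algebra"
  proof (rule idealI)
    show "subgroup (ideal3 a b c) (add_monoid ring_of_type_algebra)"
    proof (rule add.subgroupI)
      show "ideal3 a b c \<noteq> {}" by (auto simp: ideal3_def)
      show "\<ominus>\<^bsub>ring_of_type_algebra\<^esub> x \<in> ideal3 a b c" if "x \<in> ideal3 a b c" for x
        using ideal3_mult[OF that, of "- 1"] by simp
    qed (simp_all add: ideal3_add)
  qed (simp_all add: ring_axioms ideal3_mult ideal3_mult_right)
  moreover have "{a, b, c} \<subseteq> ideal3 a b c"
    using ideal3I[of 1 a 0 b 0 c] ideal3I[of 0 a 1 b 0 c] ideal3I[of 0 a 0 b 1 c] by simp
  ultimately have "Idl\<^bsub>ring_of_type_algebra\<^esub> {a, b, c} \<subseteq> ideal3 a b c"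
    by (rule genideal_minimal)
  moreover have "u * a + v * b + w * c \<in> Idl\<^bsub>ring_of_type_algebra\<^esub> {a, b, c}" for u v w
    using I.I_l_closed[of a u] I.I_l_closed[of b v] I.I_l_closed[of c w] gen
      I.a_closed[of "u * a" "v * b"] I.a_closed[of "u * a + v * b" "w * c"]
    by simp
  ultimately show ?thesis by (auto simp: ideal3_def)
qed

text \<open>These are the conditions for b, a, c to be a d-sequence in a domain. Those belonging to
  the initial segments of length 0 and 1 follow from \<open>nz\<close> and \<open>regular\<close>;
  the one for the ideal (a, b) is \<open>colon\<close>.\<close>

locale d_sequence =
  fixes a b c :: "'a::idom"
  assumes nz: "b \<noteq> 0"
    and regular: "\<And>u. b dvd a * u \<Longrightarrow> b dvd u"
    and colon: "\<And>u x y. u * c\<^sup>2 = x * a + y * b \<Longrightarrow> \<exists>x y. u * c = x * a + y * b"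
begin

abbreviation "I \<equiv> ideal3 a b c"
abbreviation "A \<equiv> mvar a :: ('a, 'a) mpoly"
abbreviation "B \<equiv> mvar b :: ('a, 'a) mpoly"
abbreviation "C \<equiv> mvar c :: ('a, 'a) mpoly"
abbreviation "L \<equiv> Idl\<^bsub>polynomial_ring I\<^esub> (linearity_relations I)"
text \<open>\<open>val\<close> is \<open>ev\<close> at t = 1. Since \<open>ev\<close> sends a form
  of degree n to a monomial in t (\<open>ev_Q\<close>), the value alone decides whether a form dies
  in the Rees algebra.\<close>

definition val :: "('a, 'a) mpoly \<Rightarrow> 'a" where
  "val = mpoly_eval id id"
definition ev :: "('a, 'a) mpoly \<Rightarrow> 'a poly" where
  "ev = mpoly_eval (\<lambda>r. [:r:]) (\<lambda>w. monom w 1)"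

sublocale val: comm_ring_hom val
  unfolding val_def by (rule comm_ring_hom.comm_ring_hom_mpoly_eval[OF comm_ring_hom_id])

lemma val_simps [simp]: "val (mconst r) = r" "val (mvar w) = w"
  using comm_ring_hom.mpoly_eval_mconst[OF comm_ring_hom_id, of id r]
    comm_ring_hom.mpoly_eval_mvar[OF comm_ring_hom_id, of id w]
  by (simp_all add: val_def)

lemma comm_ring_hom_const: "comm_ring_hom (\<lambda>r::'a. [:r:])"
  by unfold_locales (simp_all add: one_pCons)

sublocale ev: comm_ring_hom ev
  unfolding ev_def by (rule comm_ring_hom.comm_ring_hom_mpoly_eval[OF comm_ring_hom_const])

lemma ev_simps [simp]: "ev (mconst r) = [:r:]" "ev (mvar w) = monom w 1"
  using comm_ring_hom.mpoly_eval_mconst[OF comm_ring_hom_const]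
    comm_ring_hom.mpoly_eval_mvar[OF comm_ring_hom_const]
  by (simp_all add: ev_def)

lemma gens_in_I [simp]: "a \<in> I" "b \<in> I" "c \<in> I"
  using ideal3I[of 1 a 0 b 0 c] ideal3I[of 0 a 1 b 0 c] ideal3I[of 0 a 0 b 1 c] by simp_all

lemma relations_polys_in: "linearity_relations I \<subseteq> polys_in I"
  by (auto simp: linearity_relations_def intro!: polys_in_diff polys_in_mult polys_in_mvar ideal3_add ideal3_mult)

sublocale PR: ring "polynomial_ring I :: ('a, 'a) mpoly ring"
  by (rule ring_polynomial_ring)

sublocale L: ideal L "polynomial_ring I"
  by (rule PR.genideal_ideal) (simp add: relations_polys_in)

lemma L_add: "p \<in> L \<Longrightarrow> q \<in> L \<Longrightarrow> p + q \<in> L"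
  using L.a_closed by simp

lemma L_polys: "p \<in> L \<Longrightarrow> p \<in> polys_in I"
  using L.Icarr by simp

lemma L_mult: "p \<in> L \<Longrightarrow> q \<in> polys_in I \<Longrightarrow> q * p \<in> L"
  using L.I_l_closed by simp

lemma L_uminus: "p \<in> L \<Longrightarrow> - p \<in> L"
  using L_mult[of p "- 1"] by (simp add: polys_in_uminus)

lemma L_diff: "p \<in> L \<Longrightarrow> q \<in> L \<Longrightarrow> p - q \<in> L"
  using L_add[of p "- q"] by (simp add: L_uminus)

lemma L_0 [simp]: "0 \<in> L"
  using L.zero_closed by simp

lemma L_sum: "(\<And>i. i \<in> K \<Longrightarrow> f i \<in> L) \<Longrightarrow> sum f K \<in> L"
  by (induction K rule: infinite_finite_induct) (auto intro: L_add)

lemma relations_L: "linearity_relations I \<subseteq> L"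
  by (rule PR.genideal_self) (simp add: relations_polys_in)

lemma L_additive: "x \<in> I \<Longrightarrow> y \<in> I \<Longrightarrow> mvar (x + y) - mvar x - mvar y \<in> L"
  using relations_L by (force simp: linearity_relations_def)

lemma L_linear: "x \<in> I \<Longrightarrow> mvar (r * x) - mconst r * mvar x \<in> L"
  using relations_L by (force simp: linearity_relations_def)

lemma L_combination:
  "mvar (x * a + y * b + z * c) - (mconst x * A + mconst y * B + mconst z * C) \<in> L"
proof -
  have 1: "mvar (x * a + y * b + z * c) - mvar (x * a + y * b) - mvar (z * c) \<in> L"
    "mvar (x * a + y * b) - mvar (x * a) - mvar (y * b) \<in> L"
    by (intro L_additive ideal3_add ideal3_mult gens_in_I)+
  have "mvar (x * a + y * b + z * c) - (mconst x * A + mconst y * B + mconst z * C) =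
     (mvar (x * a + y * b + z * c) - mvar (x * a + y * b) - mvar (z * c)) +
     (mvar (x * a + y * b) - mvar (x * a) - mvar (y * b)) +
     (mvar (x * a) - mconst x * A) + (mvar (y * b) - mconst y * B) + (mvar (z * c) - mconst z * C)"
    by simp
  also have "\<dots> \<in> L" by (intro L_add 1 L_linear gens_in_I)
  finally show ?thesis .
qed

lemma L_mvar_0: "mvar 0 \<in> L"
proof -
  have "mvar (0 + 0) - mvar 0 - mvar 0 \<in> L"
    by (rule L_additive) (use ideal3_mult[OF gens_in_I(1), of 0] in simp_all)
  then have "- mvar 0 \<in> L" by simp
  from L_uminus[OF this] show ?thesis by simp
qed

text \<open>Both sides of a syzygy represent the variable of 0. Linear type amounts to saying that
  these linear relations generate all others.\<close>

lemma L_syzygy: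
  assumes "x * a + y * b + z * c = 0"
  shows "mconst x * A + mconst y * B + mconst z * C \<in> L"
proof -
  have "mvar 0 - (mconst x * A + mconst y * B + mconst z * C) \<in> L"
    using L_combination[of x y z] assms by simp
  from L_diff[OF L_mvar_0 this] show ?thesis by (simp add: add.assoc)
qed

lemma hom_L:
  assumes "comm_ring_hom h" and "\<And>x. x \<in> linearity_relations I \<Longrightarrow> h x = 0" and "p \<in> L"
  shows "h p = 0"
proof -
  interpret h: comm_ring_hom h by fact
  let ?K = "{p \<in> polys_in I. h p = 0}"
  have "ideal ?K (polynomial_ring I)"
  proof (rule idealI)
    show "subgroup ?K (add_monoid (polynomial_ring I))"
    proof (rule PR.add.subgroupI)
      show "?K \<noteq> {}" using h.hom_zero polys_in_0 by blast
      fix p assume p: "p \<in> ?K"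
      have "\<ominus>\<^bsub>polynomial_ring I\<^esub> p = - p"
        using p by (intro PR.add.inv_equality) (simp_all add: polys_in_uminus)
      with p show "\<ominus>\<^bsub>polynomial_ring I\<^esub> p \<in> ?K" by (simp add: polys_in_uminus h.hom_uminus)
    qed (auto simp: polys_in_add h.hom_add)
  qed (auto simp: polys_in_mult h.hom_mult PR.ring_axioms)
  moreover have "linearity_relations I \<subseteq> ?K"
    using relations_polys_in assms(2) by auto
  ultimately have "L \<subseteq> ?K" by (rule PR.genideal_minimal)
  then show ?thesis using assms(3) by auto
qed

lemma val_L: "p \<in> L \<Longrightarrow> val p = 0"
  by (rule hom_L[OF val.comm_ring_hom_axioms])
    (auto simp: linearity_relations_def val.hom_minus val.hom_mult)

lemma ev_L: "p \<in> L \<Longrightarrow> ev p = 0"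
  by (rule hom_L[OF ev.comm_ring_hom_axioms])
    (auto simp: linearity_relations_def ev.hom_minus ev.hom_mult add_monom[symmetric] smult_monom)

text \<open>Forms of degree n in A, B, C with coefficients in the base ring. The recursion through
  A, B, C avoids exponents altogether and makes every argument an induction on the degree.\<close>

primrec Q :: "nat \<Rightarrow> ('a, 'a) mpoly set" where
  "Q 0 = range mconst"
| "Q (Suc n) = {A * p + B * q + C * r |p q r. p \<in> Q n \<and> q \<in> Q n \<and> r \<in> Q n}"

lemma Q_SucI: "p \<in> Q n \<Longrightarrow> q \<in> Q n \<Longrightarrow> r \<in> Q n \<Longrightarrow> A * p + B * q + C * r \<in> Q (Suc n)"
  by auto

lemma Q_polys: "p \<in> Q n \<Longrightarrow> p \<in> polys_in I"
  by (induction n arbitrary: p) (auto intro!: polys_in_add polys_in_mult)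

lemma Q_0 [simp]: "0 \<in> Q n"
proof (induction n)
  case 0
  have "mconst 0 \<in> range mconst" by blast
  then show ?case by simp
next
  case (Suc n)
  from Q_SucI[OF Suc Suc Suc] show ?case by simp
qed

lemma Q_add: "p \<in> Q n \<Longrightarrow> q \<in> Q n \<Longrightarrow> p + q \<in> Q n"
proof (induction n arbitrary: p q)
  case 0
  then show ?case by (auto simp: mconst.hom_add[symmetric])
next
  case (Suc n)
  then obtain p1 p2 p3 q1 q2 q3 where *: "p = A * p1 + B * p2 + C * p3"
    "q = A * q1 + B * q2 + C * q3" "p1 \<in> Q n" "p2 \<in> Q n" "p3 \<in> Q n" "q1 \<in> Q n" "q2 \<in> Q n" "q3 \<in> Q n"
    by auto
  have "p + q = A * (p1 + q1) + B * (p2 + q2) + C * (p3 + q3)"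
    by (simp add: * algebra_simps)
  also have "\<dots> \<in> Q (Suc n)" using * by (intro Q_SucI Suc.IH)
  finally show ?case .
qed

lemma Q_mconst: "p \<in> Q n \<Longrightarrow> mconst r * p \<in> Q n"
proof (induction n arbitrary: p)
  case 0
  then show ?case by (auto simp: mconst.hom_mult[symmetric])
next
  case (Suc n)
  then obtain p1 p2 p3 where *: "p = A * p1 + B * p2 + C * p3"
    "p1 \<in> Q n" "p2 \<in> Q n" "p3 \<in> Q n" by auto
  have "mconst r * p = A * (mconst r * p1) + B * (mconst r * p2) + C * (mconst r * p3)"
    by (simp add: * algebra_simps)
  also have "\<dots> \<in> Q (Suc n)" using * by (intro Q_SucI Suc.IH)
  finally show ?case .
qed

lemma Q_sum: "(\<And>i. i \<in> K \<Longrightarrow> f i \<in> Q n) \<Longrightarrow> sum f K \<in> Q n"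
  by (induction K rule: infinite_finite_induct) (auto intro: Q_add)

lemma Q_A: "p \<in> Q n \<Longrightarrow> A * p \<in> Q (Suc n)" and Q_C: "p \<in> Q n \<Longrightarrow> C * p \<in> Q (Suc n)"
  using Q_SucI[of p n 0 0] Q_SucI[of 0 n 0 p] by simp_all

lemma Q_C_power: "C ^ n \<in> Q n"
proof (induction n)
  case 0
  have "mconst 1 \<in> Q 0" unfolding Q.simps by blast
  then show ?case by simp
qed (use Q_C in simp)

lemma ev_Q: "p \<in> Q n \<Longrightarrow> ev p = monom (val p) n"
proof (induction n arbitrary: p)
  case 0
  then show ?case by (auto simp: monom_0)
next
  case (Suc n)
  then show ?case
    by (auto simp: ev.hom_add ev.hom_mult val.hom_add val.hom_mult mult_monom add_monom)
qed

text \<open>Every monomial other than the pure power of C contains A or B. The remaining coefficient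
  g is a ring element, on which the colon condition can act.\<close>

lemma Q_Suc_split:
  assumes "G \<in> Q (Suc n)"
  obtains p q g where "p \<in> Q n" "q \<in> Q n" "G = A * p + B * q + mconst g * C ^ Suc n"
proof -
  have "\<exists>p q g. p \<in> Q n \<and> q \<in> Q n \<and> G = A * p + B * q + mconst g * C ^ Suc n"
    using assms
  proof (induction n arbitrary: G)
    case 0
    then show ?case by (auto simp: mult_ac)
  next
    case (Suc n)
    then obtain p q r where pqr: "p \<in> Q (Suc n)" "q \<in> Q (Suc n)" "r \<in> Q (Suc n)"
      "G = A * p + B * q + C * r" unfolding Q.simps(2)[of "Suc n"] by blast
    obtain p' q' g where *: "p' \<in> Q n" "q' \<in> Q n" "r = A * p' + B * q' + mconst g * C ^ Suc n"
      using Suc.IH[OF pqr(3)] by blast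
    have "G = A * (p + C * p') + B * (q + C * q') + mconst g * C ^ Suc (Suc n)"
      by (simp add: pqr * algebra_simps)
    moreover have "p + C * p' \<in> Q (Suc n)" "q + C * q' \<in> Q (Suc n)"
      using pqr * by (auto intro!: Q_add Q_C simp del: Q.simps)
    ultimately show ?case by blast
  qed
  then show ?thesis using that by blast
qed

lemma colon_power:
  assumes "g * c ^ Suc n = x * a + y * b"
  shows "\<exists>x y. g * c = x * a + y * b"
  using assms
proof (induction n arbitrary: x y)
  case 0
  then show ?case by auto
next
  case (Suc n)
  then have "(g * c ^ n) * c\<^sup>2 = x * a + y * b" by (simp add: power2_eq_square mult_ac)
  from colon[OF this] obtain x y where "g * c ^ Suc n = x * a + y * b" by (auto simp: mult_ac)
  then show ?case by (rule Suc.IH)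
qed

text \<open>The induction is over the ideal \<open>(b)\<close> as well as over \<open>0\<close>: removing the top power of
  \<open>C\<close> by a linear syzygy and cancelling \<open>a\<close> modulo \<open>b\<close> both lead to forms whose value lies in \<open>(b)\<close>.\<close>

lemma form_mod_b:
  assumes "G \<in> Q (Suc n)" "b dvd val G"
  shows "\<exists>H\<in>Q n. G - B * H \<in> L"
  using assms
proof (induction n arbitrary: G)
  case (0 G)
  from 0(1) obtain p q g where G: "p \<in> Q 0" "q \<in> Q 0" "G = A * p + B * q + mconst g * C ^ Suc 0"
    by (rule Q_Suc_split)
  obtain p0 where p: "p = mconst p0" using G by auto
  obtain q0 where q: "q = mconst q0" using G by auto
  \<comment> \<open>In degree one, subtracting h * B leaves a linear form of value 0, that is, a
    syzygy.\<close>
  obtain h where h: "val G = b * h" using 0 by auto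
  then have "p0 * a + (q0 - h) * b + g * c = 0"
    by (simp add: G p q val.hom_add val.hom_mult algebra_simps)
  from L_syzygy[OF this] have "G - B * mconst h \<in> L"
    by (simp add: G p q mconst.hom_minus algebra_simps)
  then show ?case by auto
next
  case (Suc n G)
  from Suc.prems(1) obtain p q g where G: "p \<in> Q (Suc n)" "q \<in> Q (Suc n)"
    "G = A * p + B * q + mconst g * C ^ Suc (Suc n)" by (rule Q_Suc_split)
  obtain h where h: "val G = b * h" using Suc.prems by auto
  \<comment> \<open>As the value of G lies in (b), this multiple of g lies in (a, b), and by
    \<open>colon_power\<close> already g * c does. The resulting syzygy \<open>l\<close> trades the
    top power of C for terms containing A or B.\<close>
  have "g * c ^ Suc (Suc n) = (- val p) * a + (h - val q) * b"
    using h by (simp add: G val.hom_add val.hom_mult val.hom_power algebra_simps)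
  then obtain x y where xy: "g * c = x * a + y * b" using colon_power by blast
  define l where "l = mconst g * C - mconst x * A - mconst y * B"
  have l: "l \<in> L" using L_syzygy[of "-x" "-y" g] xy
    by (simp add: l_def mconst.hom_uminus algebra_simps)
  define p' where "p' = p + mconst x * C ^ Suc n"
  define q' where "q' = q + mconst y * C ^ Suc n"
  have p': "p' \<in> Q (Suc n)" and q': "q' \<in> Q (Suc n)"
    unfolding p'_def q'_def by (intro Q_add G Q_mconst Q_C_power)+
  have eq: "G = C ^ Suc n * l + A * p' + B * q'"
    by (simp add: G l_def p'_def q'_def algebra_simps)
  have "b * h = a * val p' + b * val q'"
    using h val_L[OF l] by (simp add: eq val.hom_add val.hom_mult)
  \<comment> \<open>The syzygy has value 0, so modulo b only a * \<open>val p'\<close> is left; by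
    regularity \<open>p'\<close> itself has its value in (b) and the induction hypothesis applies to
    it.\<close>
  then have "a * val p' = b * (h - val q')" by (simp add: algebra_simps)
  then have "b dvd a * val p'" by simp
  then have "b dvd val p'" by (rule regular)
  from Suc.IH[OF p' this] obtain H where H: "H \<in> Q n" "p' - B * H \<in> L" by blast
  have "G - B * (A * H + q') = C ^ Suc n * l + A * (p' - B * H)"
    by (simp add: eq algebra_simps)
  also have "\<dots> \<in> L" using H l Q_polys[OF Q_C_power[of "Suc n"]]
    by (intro L_add L_mult) (simp_all del: power_Suc)
  finally show ?case using H q' by (intro bexI[of _ "A * H + q'"] Q_add Q_A)
qed

text \<open>The value 0 lies in (b), so a factor B splits off modulo the relations; since b is
  nonzero in a domain, the cofactor has value 0 again and smaller degree.\<close>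

lemma form_in_L: "G \<in> Q n \<Longrightarrow> val G = 0 \<Longrightarrow> G \<in> L"
proof (induction n arbitrary: G)
  case 0
  then show ?case by auto
next
  case (Suc n)
  then obtain H where H: "H \<in> Q n" "G - B * H \<in> L" using form_mod_b[of G n] by auto
  from val_L[OF H(2)] Suc.prems have "b * val H = 0" by (simp add: val.hom_minus val.hom_mult)
  then have "H \<in> L" using nz H by (intro Suc.IH) auto
  then have "G - B * H + B * H \<in> L" using H by (intro L_add L_mult) auto
  then show ?case by simp
qed

lemma monomial_mod_L:
  assumes "keys \<mu> \<subseteq> I"
  shows "\<exists>n. \<exists>q\<in>Q n. Poly_Mapping.single \<mu> r - q \<in> L"
  using assms
proof (induction rule: monomial_induct)
  case const
  have "mconst r \<in> Q 0" "mconst r - mconst r \<in> L" by auto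
  then show ?case by blast
next
  case (var w p)
  then obtain n q where q: "q \<in> Q n" "p - q \<in> L" by blast
  obtain x y z where w: "w = x * a + y * b + z * c" using var by (auto simp: ideal3_def)
  define q' where "q' = mconst x * A + mconst y * B + mconst z * C"
  have "mvar w * p - q' * q = mvar w * (p - q) + q * (mvar w - q')"
    by (simp add: algebra_simps)
  also have "\<dots> \<in> L" using q Q_polys[OF q(1)] var L_combination[of x y z]
    by (intro L_add L_mult) (auto simp: w q'_def)
  finally have "mvar w * p - q' * q \<in> L" .
  moreover have "q' * q = A * (mconst x * q) + B * (mconst y * q) + C * (mconst z * q)"
    by (simp add: q'_def algebra_simps)
  then have "q' * q \<in> Q (Suc n)" using q by (simp only: Q_SucI Q_mconst)
  ultimately show ?case by blast
qed

text \<open>Modulo the relations p is a sum of forms. The coefficient of t^m in its image is the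
  value of the part of degree m, so each homogeneous part has value 0 and \<open>form_in_L\<close>
  treats them one by one.\<close>

lemma ev_kernel:
  assumes "p \<in> polys_in I" "ev p = 0"
  shows "p \<in> L"
proof -
  let ?K = "keys p"
  have "\<exists>n q. q \<in> Q n \<and> Poly_Mapping.single \<mu> (lookup p \<mu>) - q \<in> L" if "\<mu> \<in> ?K" for \<mu>
    using monomial_mod_L[of \<mu>] that assms(1) by (auto simp: polys_in_def) blast
  then obtain n q where nq: "\<And>\<mu>. \<mu> \<in> ?K \<Longrightarrow> q \<mu> \<in> Q (n \<mu>)"
    "\<And>\<mu>. \<mu> \<in> ?K \<Longrightarrow> Poly_Mapping.single \<mu> (lookup p \<mu>) - q \<mu> \<in> L"
    by metis
  have diff: "p - sum q ?K \<in> L"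
    using L_sum[of ?K "\<lambda>\<mu>. Poly_Mapping.single \<mu> (lookup p \<mu>) - q \<mu>"] nq(2)
    by (simp add: sum_subtractf sum_singles[symmetric])
  have "(\<Sum>\<mu>\<in>?K. monom (val (q \<mu>)) (n \<mu>)) = ev (sum q ?K)"
    unfolding ev.hom_sum by (intro sum.cong refl ev_Q[symmetric] nq(1))
  also have "\<dots> = 0"
    using ev_L[OF diff] assms(2) by (simp add: ev.hom_minus)
  finally have ev0: "(\<Sum>\<mu>\<in>?K. monom (val (q \<mu>)) (n \<mu>)) = 0" .
  define q' where "q' m = sum q {\<mu> \<in> ?K. n \<mu> = m}" for m
  have "q' m \<in> L" for m
  proof (rule form_in_L)
    show "q' m \<in> Q m" using nq(1) by (auto simp: q'_def intro!: Q_sum)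
    have "0 = poly.coeff (\<Sum>\<mu>\<in>?K. monom (val (q \<mu>)) (n \<mu>)) m"
      by (simp add: ev0)
    also have "\<dots> = (\<Sum>\<mu>\<in>?K. if n \<mu> = m then val (q \<mu>) else 0)"
      by (simp add: coeff_sum)
    also have "\<dots> = val (q' m)"
      by (simp add: q'_def val.hom_sum sum.If_cases Int_def conj_commute)
    finally show "val (q' m) = 0" by simp
  qed
  then have "sum q' (n ` ?K) \<in> L" by (intro L_sum)
  moreover have "sum q' (n ` ?K) = sum q ?K"
    unfolding q'_def by (intro sum.group) auto
  ultimately have "p - sum q ?K + sum q ?K \<in> L" using diff by (intro L_add) auto
  then show ?thesis by simp
qed

section \<open>The image of the symmetric algebra in the polynomials in t\<close>

lemma ideal_power_0 [simp]: "0 \<in> ideal_power I n"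
proof (induction n)
  case (Suc n)
  have "a \<otimes>\<^bsub>ring_of_type_algebra\<^esub> 0 \<in> ideal_prod ring_of_type_algebra I (ideal_power I n)"
    by (rule ideal_prod.prod) (use Suc in simp_all)
  then show ?case by simp
qed simp

lemma ideal_power_add: "x \<in> ideal_power I n \<Longrightarrow> y \<in> ideal_power I n \<Longrightarrow> x + y \<in> ideal_power I n"
  using ideal_prod.sum[of x ring_of_type_algebra I "ideal_power I (n - 1)" y] by (cases n) auto

lemma ideal_power_mult: "x \<in> I \<Longrightarrow> y \<in> ideal_power I n \<Longrightarrow> x * y \<in> ideal_power I (Suc n)"
  using ideal_prod.prod[of x I y "ideal_power I n" ring_of_type_algebra] by simp

lemma ev_in_rees:
  assumes "p \<in> polys_in I"
  shows "poly.coeff (ev p) n \<in> ideal_power I n"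
proof -
  have monomial: "\<exists>m. \<exists>r\<in>ideal_power I m. ev (Poly_Mapping.single \<mu> x) = monom r m"
    if "keys \<mu> \<subseteq> I" for \<mu> x
    using that
  proof (induction rule: monomial_induct)
    case const
    have "x \<in> ideal_power I 0" "ev (mconst x) = monom x 0" by (simp_all add: monom_0)
    then show ?case by blast
  next
    case (var w p)
    then obtain m r where "r \<in> ideal_power I m" "ev p = monom r m" by blast
    then have "w * r \<in> ideal_power I (Suc m)" "ev (mvar w * p) = monom (w * r) (Suc m)"
      using var ideal_power_mult by (auto simp: ev.hom_mult mult_monom simp del: ideal_power.simps)
    then show ?case by blast
  qed
  have "poly.coeff (ev (Poly_Mapping.single \<mu> x)) n \<in> ideal_power I n"
    if "keys \<mu> \<subseteq> I" for \<mu> x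
  proof -
    from monomial[OF that] obtain m r where "r \<in> ideal_power I m"
      "ev (Poly_Mapping.single \<mu> x) = monom r m" by blast
    then show ?thesis by (auto simp: coeff_monom)
  qed
  moreover have "(\<Sum>\<mu>\<in>K. f \<mu>) \<in> ideal_power I n" if "\<And>\<mu>. \<mu> \<in> K \<Longrightarrow> f \<mu> \<in> ideal_power I n"
    for K and f :: "('a \<Rightarrow>\<^sub>0 nat) \<Rightarrow> 'a"
    using that by (induction K rule: infinite_finite_induct) (auto intro: ideal_power_add)
  ultimately show ?thesis using assms
    by (subst sum_singles) (auto simp: ev.hom_sum coeff_sum polys_in_def)
qed

lemma monom_in_range:
  "r \<in> ideal_power I n \<Longrightarrow> \<exists>p\<in>polys_in I. ev p = monom r n"
proof (induction n arbitrary: r)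
  case 0
  show ?case by (intro bexI[of _ "mconst r"]) (simp_all add: monom_0)
next
  case (Suc n)
  from Suc.prems have "r \<in> ideal_prod ring_of_type_algebra I (ideal_power I n)" by simp
  then show ?case
  proof (induction rule: ideal_prod.induct)
    case (prod i j)
    obtain p where "p \<in> polys_in I" "ev p = monom j n" using Suc.IH[OF prod(2)] by blast
    then show ?case using prod
      by (intro bexI[of _ "mvar i * p"]) (auto simp: ev.hom_mult mult_monom intro: polys_in_mult)
  next
    case (sum s t)
    then obtain p q where "p \<in> polys_in I" "ev p = monom s (Suc n)"
      "q \<in> polys_in I" "ev q = monom t (Suc n)" by blast
    then show ?case
      by (intro bexI[of _ "p + q"]) (auto simp: ev.hom_add add_monom intro: polys_in_add)
  qed
qed

lemma ev_image: "ev ` polys_in I = {p. \<forall>n. poly.coeff p n \<in> ideal_power I n}"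
proof safe
  fix y :: "'a poly" assume "\<forall>n. poly.coeff y n \<in> ideal_power I n"
  then have "\<forall>n. \<exists>p. p \<in> polys_in I \<and> ev p = monom (poly.coeff y n) n"
    using monom_in_range by blast
  from choice[OF this] obtain p where
    p: "\<And>n. p n \<in> polys_in I" "\<And>n. ev (p n) = monom (poly.coeff y n) n" by blast
  have "(\<Sum>n\<in>K. p n) \<in> polys_in I" for K
    by (induction K rule: infinite_finite_induct) (auto intro: polys_in_add p(1))
  then have "(\<Sum>n\<le>degree y. p n) \<in> polys_in I" .
  moreover have "ev (\<Sum>n\<le>degree y. p n) = y"
    using poly_as_sum_of_monoms[of y] by (simp add: ev.hom_sum p)
  ultimately show "y \<in> ev ` polys_in I" by (metis imageI)
qed (auto intro: ev_in_rees)

text \<open>The first isomorphism theorem for \<open>ev\<close>, with kernel from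
  \<open>ev_kernel\<close> and image from \<open>ev_image\<close>.\<close>

theorem linear_type_I: "linear_type I"
proof -
  have "ring_hom_ring (polynomial_ring I) (ring_of_type_algebra :: 'a poly ring) ev"
    by (rule ring_hom_ringI)
      (simp_all add: PR.ring_axioms ring_from_type_algebra ev.hom_add ev.hom_mult)
  then interpret rh: ring_hom_ring "polynomial_ring I" "ring_of_type_algebra :: 'a poly ring" ev .
  have "a_kernel (polynomial_ring I) ring_of_type_algebra ev = L"
  proof (rule Set.set_eqI)
    fix p
    have "p \<in> L \<longleftrightarrow> p \<in> polys_in I \<and> ev p = 0"
      using ev_L[of p] L_polys[of p] ev_kernel[of p] by argo
    then show "p \<in> a_kernel (polynomial_ring I) ring_of_type_algebra ev \<longleftrightarrow> p \<in> L"
      by (simp only: a_kernel_def' mem_Collect_eq polynomial_ring_simps rta_simps)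
  qed
  moreover have "sym_to_rees I = (\<lambda>D. the_elem (ev ` D))"
    by (simp only: sym_to_rees_def[abs_def] ev_def)
  moreover have "rees_algebra I =
      ring_of_type_algebra\<lparr>carrier := ev ` carrier (polynomial_ring I)\<rparr>"
    by (simp only: rees_algebra_def ev_image polynomial_ring_simps)
  ultimately show ?thesis
    using rh.FactRing_iso_set_aux by (simp only: linear_type_def symmetric_algebra_def)
qed

end

section \<open>Quasi-homogeneity of double and triple points\<close>

locale derivation =
  fixes D :: "'a::comm_ring_1 \<Rightarrow> 'a"
  assumes add: "D (x + y) = D x + D y"
    and mult: "D (x * y) = D x * y + x * D y"
begin

lemma zero [simp]: "D 0 = 0"
  using add[of 0 0] by simp

lemma one [simp]: "D 1 = 0"
  using mult[of 1 1] by simp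

lemma uminus: "D (- x) = - D x"
  using add[of x "- x"] by (simp add: add_eq_0_iff)

lemma diff: "D (x - y) = D x - D y"
  using add[of x "- y"] by (simp add: uminus)

lemma power: "D (x ^ Suc n) = of_nat (Suc n) * x ^ n * D x"
  by (induction n) (simp_all add: mult algebra_simps)

lemma of_nat [simp]: "D (of_nat n) = 0"
  by (induction n) (simp_all add: add)

lemma numeral [simp]: "D (numeral n) = 0"
  using of_nat[of "numeral n"] by simp

end

lemmas power_algebra = power2_eq_square power3_eq_cube power4_eq_xxxx algebra_simps

text \<open>A stand-in for the local ring of the plane at a rational point. Iterating
  \<open>decompose\<close> gives Taylor expansions of any order, and \<open>proper\<close> makes
  (\<xi>, \<eta>) a proper ideal, so that constant terms are well defined. Being abstract, it can be
  instantiated anew after each change of local coordinates.\<close>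

locale plane_point = \<kappa>: comm_ring_hom \<kappa> + D1: derivation D1 + D2: derivation D2
  for \<kappa> :: "'k::{alg_closed_field, field_char_0} \<Rightarrow> 'a::comm_ring_1" and D1 D2 :: "'a \<Rightarrow> 'a" +
  fixes \<xi> \<eta> :: 'a
  assumes D_const [simp]: "D1 (\<kappa> c) = 0" "D2 (\<kappa> c) = 0"
    and D_coord [simp]: "D1 \<xi> = 1" "D1 \<eta> = 0" "D2 \<xi> = 0" "D2 \<eta> = 1"
    and decompose: "\<exists>c p q. h = \<kappa> c + \<xi> * p + \<eta> * q"
    and proper: "\<kappa> c = \<xi> * p + \<eta> * q \<Longrightarrow> c = 0"
begin

section \<open>Powers of the maximal ideal and membership modulo them\<close>

primrec mpow :: "nat \<Rightarrow> 'a set" where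
  "mpow 0 = UNIV"
| "mpow (Suc n) = {\<xi> * p + \<eta> * q |p q. p \<in> mpow n \<and> q \<in> mpow n}"

lemma mpow_SucI: "p \<in> mpow n \<Longrightarrow> q \<in> mpow n \<Longrightarrow> \<xi> * p + \<eta> * q \<in> mpow (Suc n)"
  by auto

lemma mpow_0 [simp]: "0 \<in> mpow n"
proof (induction n)
  case (Suc n)
  from mpow_SucI[OF Suc Suc] show ?case by simp
qed simp

lemma mpow_add: "x \<in> mpow n \<Longrightarrow> y \<in> mpow n \<Longrightarrow> x + y \<in> mpow n"
proof (induction n arbitrary: x y)
  case (Suc n)
  then obtain p q p' q' where *: "x = \<xi> * p + \<eta> * q" "y = \<xi> * p' + \<eta> * q'"
    "p \<in> mpow n" "q \<in> mpow n" "p' \<in> mpow n" "q' \<in> mpow n" by auto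
  have "x + y = \<xi> * (p + p') + \<eta> * (q + q')" by (simp add: * algebra_simps)
  also have "\<dots> \<in> mpow (Suc n)" using * by (intro mpow_SucI Suc.IH)
  finally show ?case .
qed simp

lemma mpow_scale: "x \<in> mpow n \<Longrightarrow> r * x \<in> mpow n"
proof (induction n arbitrary: x)
  case (Suc n)
  then obtain p q where *: "x = \<xi> * p + \<eta> * q" "p \<in> mpow n" "q \<in> mpow n" by auto
  have "r * x = \<xi> * (r * p) + \<eta> * (r * q)" by (simp add: * algebra_simps)
  also have "\<dots> \<in> mpow (Suc n)" using * by (intro mpow_SucI Suc.IH)
  finally show ?case .
qed simp

lemma mpow_uminus: "x \<in> mpow n \<Longrightarrow> - x \<in> mpow n"
  using mpow_scale[of x n "- 1"] by simp

lemma mpow_diff: "x \<in> mpow n \<Longrightarrow> y \<in> mpow n \<Longrightarrow> x - y \<in> mpow n"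
  using mpow_add[of x n "- y"] by (simp add: mpow_uminus)

lemma mpow_mult: "x \<in> mpow m \<Longrightarrow> y \<in> mpow n \<Longrightarrow> x * y \<in> mpow (m + n)"
proof (induction m arbitrary: x)
  case 0
  then show ?case by (simp add: mpow_scale)
next
  case (Suc m)
  then obtain p q where *: "x = \<xi> * p + \<eta> * q" "p \<in> mpow m" "q \<in> mpow m" by auto
  have "x * y = \<xi> * (p * y) + \<eta> * (q * y)" by (simp add: * algebra_simps)
  also have "\<dots> \<in> mpow (Suc (m + n))" using * Suc by (intro mpow_SucI Suc.IH)
  finally show ?case by simp
qed

lemma mpow_Suc_subset: "x \<in> mpow (Suc n) \<Longrightarrow> x \<in> mpow n"
  by (auto intro: mpow_add mpow_scale)

lemma mpow_antimono: "m \<le> n \<Longrightarrow> x \<in> mpow n \<Longrightarrow> x \<in> mpow m"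
  by (induction rule: dec_induct) (use mpow_Suc_subset in blast)+

lemma coord_mpow [simp]: "\<xi> \<in> mpow 1" "\<eta> \<in> mpow 1"
  using mpow_SucI[of 1 0 0] mpow_SucI[of 0 0 1] by simp_all

lemmas [simp] = coord_mpow[unfolded One_nat_def]

lemma quad_mpow [simp]: "\<xi>\<^sup>2 \<in> mpow 2" "\<xi> * \<eta> \<in> mpow 2" "\<eta>\<^sup>2 \<in> mpow 2"
  using mpow_mult[OF coord_mpow(1) coord_mpow(1)] mpow_mult[OF coord_mpow(1) coord_mpow(2)]
    mpow_mult[OF coord_mpow(2) coord_mpow(2)]
  by (simp_all only: one_add_one power2_eq_square)

lemma mpow_power: "x \<in> mpow 1 \<Longrightarrow> x ^ n \<in> mpow n"
proof (induction n)
  case (Suc n)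
  then show ?case using mpow_mult[of x 1 "x ^ n" n] by simp
qed simp

lemma mpow_xi: "x \<in> mpow n \<Longrightarrow> \<xi> * x \<in> mpow (Suc n)"
  and mpow_eta: "x \<in> mpow n \<Longrightarrow> \<eta> * x \<in> mpow (Suc n)"
  using mpow_SucI[of x n 0] mpow_SucI[of 0 n x] by simp_all

lemma D_mpow:
  assumes "x \<in> mpow (Suc n)"
  shows "D1 x \<in> mpow n" "D2 x \<in> mpow n"
proof -
  have "D1 x \<in> mpow n \<and> D2 x \<in> mpow n"
    using assms
  proof (induction n arbitrary: x)
    case (Suc n)
    then obtain p q where *: "x = \<xi> * p + \<eta> * q" "p \<in> mpow (Suc n)" "q \<in> mpow (Suc n)"
      unfolding mpow.simps(2)[of "Suc n"] by blast
    then show ?case using Suc.IH[OF *(2)] Suc.IH[OF *(3)]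
      by (simp add: D1.add D2.add D1.mult D2.mult mpow_add mpow_xi mpow_eta del: mpow.simps)
  qed simp
  then show "D1 x \<in> mpow n" "D2 x \<in> mpow n" by auto
qed

lemma mpow_1_iff: "x \<in> mpow 1 \<longleftrightarrow> (\<exists>p q. x = \<xi> * p + \<eta> * q)"
  by simp

lemma hom_numeral [simp]: "\<kappa> (numeral w) = numeral w"
  by (induction w) (simp_all only: numeral_One numeral_Bit0 numeral_Bit1 \<kappa>.hom_add \<kappa>.hom_one)

lemma const_mpow: "\<kappa> c \<in> mpow 1 \<Longrightarrow> c = 0"
  using proper by auto

text \<open>The ideal (a, b) + m^n with m = (\<xi>, \<eta>). Membership for all n takes the place of
  membership in (a, b) in the local ring, where the two agree by Krull's intersection
  theorem.\<close>

definition near :: "'a \<Rightarrow> 'a \<Rightarrow> nat \<Rightarrow> 'a set" where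
  "near a b n = {u * a + v * b + e |u v e. e \<in> mpow n}"

lemma nearI: "e \<in> mpow n \<Longrightarrow> u * a + v * b + e \<in> near a b n"
  by (auto simp: near_def)

lemma near_gens: "a \<in> near a b n" "b \<in> near a b n"
  using nearI[of 0 n 1 a 0 b] nearI[of 0 n 0 a 1 b] by simp_all

lemma near_mpow: "e \<in> mpow n \<Longrightarrow> e \<in> near a b n"
  using nearI[of e n 0 a 0 b] by simp

lemma near_0 [simp]: "0 \<in> near a b n"
  by (simp add: near_mpow)

lemma near_add: "x \<in> near a b n \<Longrightarrow> y \<in> near a b n \<Longrightarrow> x + y \<in> near a b n"
proof -
  assume "x \<in> near a b n" "y \<in> near a b n"
  then obtain u v e u' v' e' where *: "x = u * a + v * b + e" "y = u' * a + v' * b + e'"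
    "e \<in> mpow n" "e' \<in> mpow n" by (auto simp: near_def)
  have "x + y = (u + u') * a + (v + v') * b + (e + e')" by (simp add: * algebra_simps)
  also have "\<dots> \<in> near a b n" using * by (intro nearI mpow_add)
  finally show ?thesis .
qed

lemma near_scale: "x \<in> near a b n \<Longrightarrow> r * x \<in> near a b n"
proof -
  assume "x \<in> near a b n"
  then obtain u v e where *: "x = u * a + v * b + e" "e \<in> mpow n" by (auto simp: near_def)
  have "r * x = (r * u) * a + (r * v) * b + r * e" by (simp add: * algebra_simps)
  also have "\<dots> \<in> near a b n" using * by (intro nearI mpow_scale)
  finally show ?thesis .
qed

lemma near_diff: "x \<in> near a b n \<Longrightarrow> y \<in> near a b n \<Longrightarrow> x - y \<in> near a b n"
  using near_add[of x a b n "- y"] near_scale[of y a b n "- 1"] by simp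

text \<open>An element with nonzero constant term is invertible modulo m^n: normalised to 1 - s with
  s in m, it has the partial geometric series as inverse.\<close>

lemma near_unit:
  assumes "c \<noteq> 0" "t \<in> mpow 1" "(\<kappa> c + t) * x \<in> near a b n"
  shows "x \<in> near a b n"
proof -
  define s where "s = - \<kappa> (inverse c) * t"
  have s: "s \<in> mpow 1" unfolding s_def by (intro mpow_scale assms)
  have inv: "\<kappa> (inverse c) * \<kappa> c = 1" using assms by (simp add: \<kappa>.hom_mult[symmetric])
  have "\<kappa> (inverse c) * ((\<kappa> c + t) * x) = (\<kappa> (inverse c) * \<kappa> c) * x + \<kappa> (inverse c) * t * x"
    by (simp only: distrib_left distrib_right mult.assoc)
  also have "\<dots> = (1 - s) * x"
    by (simp add: inv s_def left_diff_distrib distrib_right)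
  finally have 1: "(1 - s) * x \<in> near a b n"
    using near_scale[OF assms(3), of "\<kappa> (inverse c)"] by simp
  have "(\<Sum>i<n. s ^ i) * ((1 - s) * x) = (1 - s ^ n) * x"
    by (simp only: one_diff_power_eq mult_ac)
  then have "x = (\<Sum>i<n. s ^ i) * ((1 - s) * x) + x * s ^ n"
    by (simp add: algebra_simps)
  also have "\<dots> \<in> near a b n"
    by (intro near_add near_scale 1 near_mpow mpow_power s)
  finally show ?thesis .
qed

lemma near_const: "c \<noteq> 0 \<Longrightarrow> \<kappa> c * x \<in> near a b n \<Longrightarrow> x \<in> near a b n"
  using near_unit[of c 0 x a b n] mpow_0[of 1] by simp

text \<open>A form of Nakayama's lemma: if m^k lies in (a, b) + m^(k+1), the inclusion can be fed
  into its own error term, raising the order by one each time.\<close>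

lemma near_lift:
  assumes sub: "\<And>x. x \<in> mpow k \<Longrightarrow> x \<in> near a b (Suc k)"
    and x: "x \<in> mpow k"
  shows "x \<in> near a b n"
proof (cases "n \<le> k")
  case True
  then show ?thesis using near_mpow mpow_antimono x by blast
next
  case False
  then have "k \<le> n" by simp
  then show ?thesis using x
  proof (induction n arbitrary: x rule: dec_induct)
    case base
    then show ?case by (rule near_mpow)
  next
    case (step n)
    \<comment> \<open>The error e of order k + 1 is a combination of coordinates times elements of
      m^k, and a coordinate raises the order of their errors by one.\<close>
    have shift: "z * y \<in> near a b (Suc n)" if "y \<in> mpow k" "z = \<xi> \<or> z = \<eta>" for y z
    proof -
      have "y \<in> near a b n" using step.IH that(1) by blast
      then obtain u v e where e: "y = u * a + v * b + e" "e \<in> mpow n"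
        by (auto simp: near_def)
      have "z * y = (z * u) * a + (z * v) * b + z * e" by (simp add: e algebra_simps)
      also have "\<dots> \<in> near a b (Suc n)" using that e mpow_xi mpow_eta by (intro nearI) blast
      finally show ?thesis .
    qed
    obtain u v e where e: "x = u * a + v * b + e" "e \<in> mpow (Suc k)"
      using sub[OF step.prems] by (auto simp: near_def simp del: mpow.simps)
    then obtain p q where "e = \<xi> * p + \<eta> * q" "p \<in> mpow k" "q \<in> mpow k" by auto
    then have "e \<in> near a b (Suc n)" using shift by (auto intro: near_add)
    then show ?case unfolding e by (intro near_add near_scale near_gens)
  qed
qed

section \<open>Double points\<close>

abbreviation at_xi :: "'k poly \<Rightarrow> 'a" where
  "at_xi \<equiv> poly_lift \<kappa> \<xi>"

sublocale at_xi: comm_ring_hom at_xi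
  by (rule \<kappa>.comm_ring_hom_poly_lift)

lemma D_at_xi: "D1 (at_xi P) = at_xi (pderiv P)" "D2 (at_xi P) = 0"
proof -
  have "D1 (at_xi P) = at_xi (pderiv P) \<and> D2 (at_xi P) = 0"
  proof (induction P)
    case (pCons c P)
    then show ?case
      by (simp add: D1.add D2.add D1.mult D2.mult pderiv_pCons at_xi.hom_add algebra_simps)
  qed simp
  then show "D1 (at_xi P) = at_xi (pderiv P)" "D2 (at_xi P) = 0" by auto
qed

lemma at_xi_const: "at_xi P - \<kappa> (poly.coeff P 0) \<in> mpow 1"
proof (cases P)
  case (pCons c P')
  then show ?thesis using mpow_xi[of "at_xi P'" 0] by simp
qed

text \<open>Modulo \<open>D2 g\<close> every element is a polynomial in \<open>\<xi>\<close>, and \<open>D2 D2 g * D1 - D1 D2 g * D2\<close>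
  is a derivation along the curve \<open>D2 g = 0\<close>; it lowers the order of \<open>g\<close> on this smooth curve by one.\<close>

lemma double_point:
  assumes g: "g \<in> mpow 2" and c: "c \<noteq> 0" "D2 (D2 g) - \<kappa> c \<in> mpow 1"
  shows "g \<in> near (D1 g) (D2 g) n"
proof -
  define a where "a = D1 g"
  define b where "b = D2 g"
  \<comment> \<open>One order more than n, because the error term is going to be differentiated
    once.\<close>
  define N where "N = Suc n"
  have b1: "b \<in> mpow 1" using D_mpow(2)[of g 1] g by (simp add: b_def numeral_2_eq_2)
  then obtain p q where b: "b = \<xi> * p + \<eta> * q" by auto
  \<comment> \<open>The coefficient q of \<eta> in b agrees with \<open>D2 b\<close> modulo m, so it
    has the constant term c. As it is invertible modulo high powers of m, \<eta> can be expressed by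
    \<xi> and b.\<close>
  have "D2 b - q \<in> mpow 1"
    using mpow_SucI[of "D2 p" 0 "D2 q"] by (simp add: b D2.add D2.mult del: mpow.simps(2))
  from mpow_diff[OF c(2)[folded b_def] this]
  have "(D2 b - \<kappa> c) - (D2 b - q) \<in> mpow 1" .
  then have q1: "q - \<kappa> c \<in> mpow 1" by simp
  have eta: "\<eta> \<in> near \<xi> b N"
  proof (rule near_unit[OF c(1) q1])
    have "(\<kappa> c + (q - \<kappa> c)) * \<eta> = (- p) * \<xi> + 1 * b + 0" by (simp add: b algebra_simps)
    also have "\<dots> \<in> near \<xi> b N" by (rule nearI) simp
    finally show "(\<kappa> c + (q - \<kappa> c)) * \<eta> \<in> near \<xi> b N" .
  qed
  have red: "\<exists>c0 h'. h - \<kappa> c0 - \<xi> * h' \<in> near 0 b N" for h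
  proof -
    obtain c0 h1 h2 where h: "h = \<kappa> c0 + \<xi> * h1 + \<eta> * h2" using decompose by blast
    obtain u v e where e: "\<eta> = u * \<xi> + v * b + e" "e \<in> mpow N"
      using eta by (auto simp: near_def)
    have "h - \<kappa> c0 - \<xi> * (h1 + u * h2) = 0 * 0 + (v * h2) * b + h2 * e"
      unfolding h by (subst e(1)) (simp add: algebra_simps)
    also have "\<dots> \<in> near 0 b N" by (intro nearI mpow_scale e)
    finally show ?thesis by blast
  qed
  \<comment> \<open>Iterating \<open>red\<close> expands h in powers of \<xi> with constant
    coefficients; the generator 0 makes these congruences modulo b and m^N alone.\<close>
  have poly: "\<exists>P h'. h - at_xi P - \<xi> ^ k * h' \<in> near 0 b N" for k h
  proof (induction k arbitrary: h)
    case 0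
    have "h - at_xi 0 - \<xi> ^ 0 * h \<in> near 0 b N" by simp
    then show ?case by blast
  next
    case (Suc k)
    obtain c0 h1 where h1: "h - \<kappa> c0 - \<xi> * h1 \<in> near 0 b N" using red by blast
    obtain P h' where P: "h1 - at_xi P - \<xi> ^ k * h' \<in> near 0 b N" using Suc.IH by blast
    have "h - at_xi (pCons c0 P) - \<xi> ^ Suc k * h' =
      (h - \<kappa> c0 - \<xi> * h1) + \<xi> * (h1 - at_xi P - \<xi> ^ k * h')"
      by (simp add: algebra_simps)
    also have "\<dots> \<in> near 0 b N" by (intro near_add near_scale h1 P)
    finally show ?case by blast
  qed
  obtain P h' where "g - at_xi P - \<xi> ^ N * h' \<in> near 0 b N" using poly by blast
  moreover have "\<xi> ^ N * h' \<in> near 0 b N"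
    by (subst mult.commute) (intro near_mpow mpow_scale mpow_power coord_mpow)
  ultimately have "(g - at_xi P - \<xi> ^ N * h') + \<xi> ^ N * h' \<in> near 0 b N"
    by (rule near_add)
  then obtain v e where P: "g - at_xi P = v * b + e" "e \<in> mpow N"
    by (auto simp: near_def)
  have at_xi: "at_xi P \<in> near a b n \<Longrightarrow> g \<in> near a b n"
  proof -
    assume "at_xi P \<in> near a b n"
    moreover have "v * b + e \<in> near a b n"
      using nearI[of e n 0 a v b] P(2) mpow_Suc_subset by (simp add: N_def del: mpow.simps)
    ultimately have "at_xi P + (v * b + e) \<in> near a b n" by (rule near_add)
    then show ?thesis by (simp only: P(1)[symmetric]) simp
  qed
  define s where "s = D2 b"
  define t where "t = D1 b"
  have d1: "a - at_xi (pderiv P) = D1 (v * b + e)"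
    by (simp only: P(1)[symmetric] D1.diff D_at_xi a_def)
  have d2: "D2 (v * b + e) = b"
    by (simp only: P(1)[symmetric] D2.diff D_at_xi diff_zero) (simp only: b_def)
  \<comment> \<open>The derivation s * D1 - t * D2 annihilates b, so in its application to v * b the
    two terms v * s * t cancel and a multiple of b remains.\<close>
  have "s * (a - at_xi (pderiv P)) = s * D1 (v * b + e) - t * D2 (v * b + e) + t * b"
    by (simp add: d1 d2)
  also have "\<dots> = 0 * a + (s * D1 v - t * D2 v + t) * b + (s * D1 e - t * D2 e)"
    by (simp only: D1.add D2.add D1.mult D2.mult s_def[symmetric] t_def[symmetric])
      (simp add: algebra_simps)
  also have "\<dots> \<in> near a b n"
    using D_mpow[of e n] P(2) by (intro nearI mpow_diff mpow_scale) (simp_all add: N_def)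
  finally have "s * (a - at_xi (pderiv P)) \<in> near a b n" .
  moreover have "\<kappa> c + (s - \<kappa> c) = s" by simp
  ultimately have "a - at_xi (pderiv P) \<in> near a b n"
    using near_unit[OF c(1), of "s - \<kappa> c" "a - at_xi (pderiv P)" a b n] c(2)
    by (simp only: s_def b_def)
  from near_diff[OF near_gens(1) this] have deriv: "at_xi (pderiv P) \<in> near a b n" by simp
  show ?thesis
  proof (cases "P = 0")
    case True
    then show ?thesis using at_xi by (simp add: a_def b_def)
  next
    case False
    then obtain k E where P_eq: "P = [:0, 1:] ^ k * E" and "\<not> [:0, 1:] dvd E"
      using order_decomp[OF False, of 0] by auto
    then have E0: "poly.coeff E 0 \<noteq> 0" using poly_eq_0_iff_dvd[of E 0] by (simp add: poly_0_coeff_0)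
    have X: "at_xi ([:0, 1:] ^ j * E') = \<xi> ^ j * at_xi E'" for j E'
      by (simp add: at_xi.hom_mult at_xi.hom_power)
    have "k \<noteq> 0"
    proof
      assume "k = 0"
      have "g \<in> mpow 1" "e \<in> mpow 1"
        using mpow_antimono[of 1 2 g] mpow_antimono[of 1 N e] g P(2) by (simp_all add: N_def)
      then have "g - (v * b + e) \<in> mpow 1" by (intro mpow_diff mpow_add mpow_scale[OF b1])
      from mpow_diff[OF this at_xi_const[of P]] have "\<kappa> (poly.coeff P 0) \<in> mpow 1"
        by (simp only: P(1)[symmetric]) simp
      then show False using const_mpow E0 P_eq \<open>k = 0\<close> by simp
    qed
    then obtain j where j: "k = Suc j" by (cases k) auto
    \<comment> \<open>P is \<xi>^k times E with E(0) nonzero. Its derivative is \<xi>^(k-1) times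
      \<open>E'\<close>, with constant term k E(0), nonzero in characteristic zero. Hence
      \<xi>^(k-1) is in the ideal up to order n, and P with it.\<close>
    define E' where "E' = smult (of_nat k) E + [:0, 1:] * pderiv E"
    have "pderiv P = [:0, 1:] ^ j * E'"
      unfolding P_eq j E'_def
      by (simp only: pderiv_mult pderiv_power_Suc pderiv_pCons) (simp add: algebra_simps smult_add_left)
    then have "\<xi> ^ j * at_xi E' \<in> near a b n" using deriv X by simp
    moreover have "poly.coeff E' 0 \<noteq> 0" using E0 \<open>k \<noteq> 0\<close> by (simp add: E'_def)
    ultimately have "\<xi> ^ j \<in> near a b n"
      using near_unit[of "poly.coeff E' 0" "at_xi E' - \<kappa> (poly.coeff E' 0)" "\<xi> ^ j" a b n]
        at_xi_const[of E'] by (simp add: mult.commute del: mpow.simps)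
    then have "(\<xi> * at_xi E) * \<xi> ^ j \<in> near a b n" by (rule near_scale)
    moreover have "at_xi P = (\<xi> * at_xi E) * \<xi> ^ j"
      using X[of k E] P_eq by (simp add: j mult_ac)
    ultimately show ?thesis using at_xi by (simp add: a_def b_def)
  qed
qed

section \<open>Triple points\<close>

lemma mpow2E:
  assumes "x \<in> mpow 2"
  obtains p q r where "x = p * \<xi>\<^sup>2 + q * (\<xi> * \<eta>) + r * \<eta>\<^sup>2"
proof -
  obtain a b c d where x: "x = \<xi> * (\<xi> * a + \<eta> * b) + \<eta> * (\<xi> * c + \<eta> * d)"
    using assms by (auto simp: numeral_2_eq_2)
  show ?thesis by (rule that[of a "b + c" d]) (simp add: x power_algebra)
qed

lemma mpow3E:
  assumes "x \<in> mpow 3"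
  obtains p q r s where "x = p * \<xi>^3 + q * (\<xi>\<^sup>2 * \<eta>) + r * (\<xi> * \<eta>\<^sup>2) + s * \<eta>^3"
proof -
  obtain y z where x: "x = \<xi> * y + \<eta> * z" "y \<in> mpow 2" "z \<in> mpow 2"
    using assms unfolding numeral_3_eq_3 numeral_2_eq_2 mpow.simps(2)[of "Suc (Suc 0)"] by blast
  obtain p q r where y: "y = p * \<xi>\<^sup>2 + q * (\<xi> * \<eta>) + r * \<eta>\<^sup>2" using x(2) by (rule mpow2E)
  obtain p' q' r' where z: "z = p' * \<xi>\<^sup>2 + q' * (\<xi> * \<eta>) + r' * \<eta>\<^sup>2" using x(3) by (rule mpow2E)
  show ?thesis
    by (rule that[of p "q + p'" "r + q'" r'])
      (simp add: x(1) y z power_algebra)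
qed

lemma mpow4E:
  assumes "x \<in> mpow 4"
  obtains y s where "x = \<xi> * y + s * \<eta>^4" "y \<in> mpow 3"
proof -
  obtain y z where x: "x = \<xi> * y + \<eta> * z" "y \<in> mpow 3" "z \<in> mpow 3"
    using mpow.simps(2)[of 3] assms by auto
  obtain p q r s where z: "z = p * \<xi>^3 + q * (\<xi>\<^sup>2 * \<eta>) + r * (\<xi> * \<eta>\<^sup>2) + s * \<eta>^3"
    using x(3) by (rule mpow3E)
  have "p * \<xi>\<^sup>2 + q * (\<xi> * \<eta>) + r * \<eta>\<^sup>2 \<in> mpow 2"
    by (intro mpow_add mpow_scale quad_mpow)
  from mpow_eta[OF this] have "y + \<eta> * (p * \<xi>\<^sup>2 + q * (\<xi> * \<eta>) + r * \<eta>\<^sup>2) \<in> mpow 3"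
    using x(2) by (intro mpow_add) (simp_all del: mpow.simps)
  moreover have "x = \<xi> * (y + \<eta> * (p * \<xi>\<^sup>2 + q * (\<xi> * \<eta>) + r * \<eta>\<^sup>2)) + s * \<eta>^4"
    by (simp add: x(1) z power_algebra)
  ultimately show ?thesis using that by blast
qed

lemma D_mpow_numeral:
  "x \<in> mpow 4 \<Longrightarrow> D1 x \<in> mpow 3" "x \<in> mpow 4 \<Longrightarrow> D2 x \<in> mpow 3"
  "x \<in> mpow 3 \<Longrightarrow> D1 x \<in> mpow 2" "x \<in> mpow 3 \<Longrightarrow> D2 x \<in> mpow 2"
  using D_mpow[of x 3] D_mpow[of x 2] by simp_all

lemma mpow_coord_numeral:
  "x \<in> mpow 2 \<Longrightarrow> \<xi> * x \<in> mpow 3" "x \<in> mpow 2 \<Longrightarrow> \<eta> * x \<in> mpow 3"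
  "x \<in> mpow 3 \<Longrightarrow> \<xi> * x \<in> mpow 4" "x \<in> mpow 3 \<Longrightarrow> \<eta> * x \<in> mpow 4"
  "x \<in> mpow 4 \<Longrightarrow> \<xi> * x \<in> mpow 5" "x \<in> mpow 4 \<Longrightarrow> \<eta> * x \<in> mpow 5"
  using mpow_xi[of x 2] mpow_eta[of x 2] mpow_xi[of x 3] mpow_eta[of x 3] mpow_xi[of x 4] mpow_eta[of x 4]
  by (simp_all del: mpow.simps)

lemma near_solve:
  assumes "c \<noteq> 0" "\<kappa> c * x = u * a + v * b + e" "e \<in> near a b n"
  shows "x \<in> near a b n"
proof -
  have "u * a + v * b + e \<in> near a b n"
    by (intro near_add near_scale near_gens assms(3))
  then show ?thesis using near_const[OF assms(1)] assms(2) by simp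
qed

text \<open>The tangent cone consists of three distinct lines, two of them the coordinate axes (type
  D4). The coordinates times the two partial derivatives give four cubics whose leading forms span
  all cubic forms, so m^3 is contained in (a, b) + m^4 and can be lifted.\<close>

lemma triple_point_reduced:
  assumes nz: "\<alpha> \<noteq> 0" "\<beta> \<noteq> 0" and r: "r \<in> mpow 4"
    and g: "g = \<kappa> \<alpha> * (\<xi>\<^sup>2 * \<eta>) + \<kappa> \<beta> * (\<xi> * \<eta>\<^sup>2) + r"
  shows "g \<in> near (D1 g) (D2 g) n"
proof -
  define a where "a = D1 g"
  define b where "b = D2 g"
  have a: "a = 2 * \<kappa> \<alpha> * \<xi> * \<eta> + \<kappa> \<beta> * \<eta>\<^sup>2 + D1 r"
    by (simp add: a_def g D1.add D1.mult power_algebra)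
  have b: "b = \<kappa> \<alpha> * \<xi>\<^sup>2 + 2 * \<kappa> \<beta> * \<xi> * \<eta> + D2 r"
    by (simp add: b_def g D2.add D2.mult power_algebra)
  note r' = D_mpow_numeral(1,2)[OF r]
  note simps = a b \<kappa>.hom_mult power_algebra
  have 1: "\<xi>\<^sup>2 * \<eta> \<in> near a b 4"
  \<comment> \<open>In 2 \<xi> a - \<eta> b the multiples of \<xi> \<eta>^2 cancel, which leaves 3
    \<alpha> \<xi>^2 \<eta> up to order 4. Exchanging the roles of the coordinates gives the second
    mixed cubic, and these two clear the mixed terms for the pure cubes.\<close>
  proof (rule near_solve[where c = "3 * \<alpha>" and u = "2 * \<xi>" and v = "- \<eta>"])
    show "\<kappa> (3 * \<alpha>) * (\<xi>\<^sup>2 * \<eta>) = 2 * \<xi> * a + - \<eta> * b + (\<eta> * D2 r - 2 * (\<xi> * D1 r))"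
      by (simp add: simps)
    show "\<eta> * D2 r - 2 * (\<xi> * D1 r) \<in> near a b 4"
      by (intro near_mpow mpow_diff mpow_scale mpow_coord_numeral r')
  qed (use nz in simp)
  have 2: "\<xi> * \<eta>\<^sup>2 \<in> near a b 4"
  proof (rule near_solve[where c = "3 * \<beta>" and u = "- \<xi>" and v = "2 * \<eta>"])
    show "\<kappa> (3 * \<beta>) * (\<xi> * \<eta>\<^sup>2) = - \<xi> * a + 2 * \<eta> * b + (\<xi> * D1 r - 2 * (\<eta> * D2 r))"
      by (simp add: simps)
    show "\<xi> * D1 r - 2 * (\<eta> * D2 r) \<in> near a b 4"
      by (intro near_mpow mpow_diff mpow_scale mpow_coord_numeral r')
  qed (use nz in simp)
  have 3: "\<xi>^3 \<in> near a b 4"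
  proof (rule near_solve[where c = \<alpha> and u = 0 and v = \<xi>])
    show "\<kappa> \<alpha> * \<xi>^3 = 0 * a + \<xi> * b + ((- 2 * \<kappa> \<beta>) * (\<xi>\<^sup>2 * \<eta>) - \<xi> * D2 r)"
      by (simp add: simps)
    show "(- 2 * \<kappa> \<beta>) * (\<xi>\<^sup>2 * \<eta>) - \<xi> * D2 r \<in> near a b 4"
      by (intro near_diff near_scale near_mpow mpow_coord_numeral r' 1)
  qed (use nz in simp)
  have 4: "\<eta>^3 \<in> near a b 4"
  proof (rule near_solve[where c = \<beta> and u = \<eta> and v = 0])
    show "\<kappa> \<beta> * \<eta>^3 = \<eta> * a + 0 * b + ((- 2 * \<kappa> \<alpha>) * (\<xi> * \<eta>\<^sup>2) - \<eta> * D1 r)"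
      by (simp add: simps)
    show "(- 2 * \<kappa> \<alpha>) * (\<xi> * \<eta>\<^sup>2) - \<eta> * D1 r \<in> near a b 4"
      by (intro near_diff near_scale near_mpow mpow_coord_numeral r' 2)
  qed (use nz in simp)
  have "x \<in> near a b n" if "x \<in> mpow 3" for x
  proof (rule near_lift)
    show "x \<in> mpow 3" by (rule that)
    fix y assume "y \<in> mpow 3"
    then obtain p q r s where "y = p * \<xi>^3 + q * (\<xi>\<^sup>2 * \<eta>) + r * (\<xi> * \<eta>\<^sup>2) + s * \<eta>^3"
      by (rule mpow3E)
    moreover have "p * \<xi>^3 + q * (\<xi>\<^sup>2 * \<eta>) + r * (\<xi> * \<eta>\<^sup>2) + s * \<eta>^3 \<in> near a b 4"
      by (intro near_add near_scale 1 2 3 4)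
    ultimately show "y \<in> near a b (Suc 3)" by simp
  qed
  moreover have "\<xi>\<^sup>2 * \<eta> \<in> mpow 3" "\<xi> * \<eta>\<^sup>2 \<in> mpow 3"
    using mpow_coord_numeral(1)[of "\<eta>\<^sup>2"] mpow_coord_numeral(2)[of "\<xi>\<^sup>2"]
    by (simp_all add: mult.commute)
  then have "g \<in> mpow 3"
    using mpow_antimono[of 3 4 r] r unfolding g
    by (intro mpow_add mpow_scale[where r = "\<kappa> \<alpha>"] mpow_scale[where r = "\<kappa> \<beta>"]) simp_all
  ultimately show ?thesis by (simp add: a_def b_def)
qed

text \<open>The tangent cone contains the double line \<xi>^2: type D5 for \<beta> nonzero, E6 for
  \<beta> = 0. Here m^3 is not contained in the Jacobian ideal, so lifting starts at m^4, and the
  cubic part of g is treated separately through its factor \<xi>^2.\<close>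

lemma triple_point_double_factor:
  assumes nz: "\<alpha> \<noteq> 0 \<or> \<beta> \<noteq> 0" "\<gamma> \<noteq> 0" and r: "r \<in> mpow 3"
    and g: "g = \<kappa> \<alpha> * \<xi>^3 + \<kappa> \<beta> * (\<xi>\<^sup>2 * \<eta>) + \<xi> * r + \<kappa> \<gamma> * \<eta>^4"
  shows "g \<in> near (D1 g) (D2 g) n"
proof -
  define a where "a = D1 g"
  define b where "b = D2 g"
  have a: "a = 3 * \<kappa> \<alpha> * \<xi>\<^sup>2 + 2 * \<kappa> \<beta> * \<xi> * \<eta> + (r + \<xi> * D1 r)"
    by (simp add: a_def g D1.add D1.mult power_algebra)
  have b: "b = \<kappa> \<beta> * \<xi>\<^sup>2 + (\<xi> * D2 r + 4 * \<kappa> \<gamma> * \<eta>^3)"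
    by (simp add: b_def g D2.add D2.mult power_algebra)
  note r' = D_mpow_numeral(3,4)[OF r]
  define a3 where "a3 = r + \<xi> * D1 r"
  define b3 where "b3 = \<xi> * D2 r + 4 * \<kappa> \<gamma> * \<eta>^3"
  have eta3: "\<eta>^3 \<in> mpow 3" by (intro mpow_power coord_mpow)
  have a3: "a3 \<in> mpow 3" unfolding a3_def by (intro mpow_add r mpow_coord_numeral r')
  have b3: "b3 \<in> mpow 3"
    unfolding b3_def by (intro mpow_add mpow_scale eta3 mpow_coord_numeral r')
  note a' = a[folded a3_def] and b' = b[folded b3_def]
  note simps = \<kappa>.hom_mult power_algebra
  \<comment> \<open>One partial derivative has a multiple of \<xi>^2 as its quadratic part: b if
    \<beta> is nonzero, and a otherwise. The error is x times an element of m^3, whence the second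
    assumption on x.\<close>
  have sq: "x * \<xi>\<^sup>2 \<in> near a b (Suc k)" if x: "x \<in> mpow 1" "\<And>y. y \<in> mpow 3 \<Longrightarrow> x * y \<in> mpow (Suc k)" for x k
  proof (cases "\<beta> = 0")
    case False
    show ?thesis
    proof (rule near_solve[where c = \<beta> and u = 0 and v = x])
      show "\<kappa> \<beta> * (x * \<xi>\<^sup>2) = 0 * a + x * b + - (x * b3)" by (simp add: b' simps)
    qed (use False x b3 in \<open>auto intro: near_mpow mpow_uminus simp del: mpow.simps\<close>)
  next
    case True
    show ?thesis
    proof (rule near_solve[where c = "3 * \<alpha>" and u = x and v = 0])
      show "\<kappa> (3 * \<alpha>) * (x * \<xi>\<^sup>2) = x * a + 0 * b + - (x * a3)" using True by (simp add: a' simps)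
    qed (use nz True x a3 in \<open>auto intro: near_mpow mpow_uminus simp del: mpow.simps\<close>)
  qed
  have coord_mult: "\<xi> * y \<in> mpow (Suc 3)" "\<eta> * y \<in> mpow (Suc 3)"
    "\<xi>\<^sup>2 * y \<in> mpow (Suc 4)" "(\<xi> * \<eta>) * y \<in> mpow (Suc 4)" "\<eta>\<^sup>2 * y \<in> mpow (Suc 4)" if "y \<in> mpow 3" for y
    using mpow_coord_numeral(3,4)[OF that] mpow_coord_numeral(5,6)[of "\<xi> * y"]
      mpow_coord_numeral(6)[of "\<eta> * y"]
    by (simp_all add: power2_eq_square mult_ac del: mpow.simps)
  have quad: "\<xi>\<^sup>2 \<in> mpow 1" "\<xi> * \<eta> \<in> mpow 1" "\<eta>\<^sup>2 \<in> mpow 1"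
    by (simp_all only: power2_eq_square mpow_scale coord_mpow)
  have xi3: "\<xi> * \<xi>\<^sup>2 \<in> near a b 4" "\<eta> * \<xi>\<^sup>2 \<in> near a b 4"
    using sq[of \<xi> 3] sq[of \<eta> 3] coord_mult(1,2) by (simp_all del: mpow.simps)
  have sq4: "\<xi>\<^sup>2 * \<xi>\<^sup>2 \<in> near a b 5" "(\<xi> * \<eta>) * \<xi>\<^sup>2 \<in> near a b 5" "\<eta>\<^sup>2 * \<xi>\<^sup>2 \<in> near a b 5"
    using sq[of "\<xi>\<^sup>2" 4] sq[of "\<xi> * \<eta>" 4] sq[of "\<eta>\<^sup>2" 4] coord_mult(3-5) quad
    by (simp_all del: mpow.simps)
  have sq_mpow: "\<xi>\<^sup>2 * x \<in> near a b 5" if x2: "x \<in> mpow 2" for x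
  proof -
    obtain p q s where x: "x = p * \<xi>\<^sup>2 + q * (\<xi> * \<eta>) + s * \<eta>\<^sup>2" using x2 by (rule mpow2E)
    have "\<xi>\<^sup>2 * x = p * (\<xi>\<^sup>2 * \<xi>\<^sup>2) + q * ((\<xi> * \<eta>) * \<xi>\<^sup>2) + s * (\<eta>\<^sup>2 * \<xi>\<^sup>2)"
      by (simp add: x algebra_simps)
    also have "\<dots> \<in> near a b 5" by (intro near_add near_scale sq4)
    finally show ?thesis .
  qed
  have c13: "\<xi> * \<eta>^3 \<in> near a b 5"
  proof (cases "\<beta> = 0")
    case False
    show ?thesis
    proof (rule near_solve[where c = "2 * \<beta>" and u = "\<eta>\<^sup>2" and v = 0])
      show "\<kappa> (2 * \<beta>) * (\<xi> * \<eta>^3) = \<eta>\<^sup>2 * a + 0 * b + ((- 3 * \<kappa> \<alpha>) * (\<eta>\<^sup>2 * \<xi>\<^sup>2) - \<eta>\<^sup>2 * a3)"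
        by (simp add: a' simps)
      have "\<eta>\<^sup>2 * a3 \<in> mpow 5" using coord_mult(5)[OF a3] by (simp del: mpow.simps)
      then show "(- 3 * \<kappa> \<alpha>) * (\<eta>\<^sup>2 * \<xi>\<^sup>2) - \<eta>\<^sup>2 * a3 \<in> near a b 5"
        by (intro near_diff near_scale sq4 near_mpow)
    qed (use False in simp)
  next
    case True
    show ?thesis
    proof (rule near_solve[where c = "4 * \<gamma>" and u = 0 and v = \<xi>])
      show "\<kappa> (4 * \<gamma>) * (\<xi> * \<eta>^3) = 0 * a + \<xi> * b + (- 1) * (\<xi>\<^sup>2 * D2 r)"
        using True by (simp add: b simps)
      show "(- 1) * (\<xi>\<^sup>2 * D2 r) \<in> near a b 5" by (intro near_scale sq_mpow r')
    qed (use nz in simp)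
  qed
  have xi_mpow: "\<xi> * x \<in> near a b 5" if x3: "x \<in> mpow 3" for x
  proof -
    obtain p q s t where x: "x = p * \<xi>^3 + q * (\<xi>\<^sup>2 * \<eta>) + s * (\<xi> * \<eta>\<^sup>2) + t * \<eta>^3"
      using x3 by (rule mpow3E)
    have "\<xi> * x = p * (\<xi>\<^sup>2 * \<xi>\<^sup>2) + q * ((\<xi> * \<eta>) * \<xi>\<^sup>2) + s * (\<eta>\<^sup>2 * \<xi>\<^sup>2) + t * (\<xi> * \<eta>^3)"
      by (simp add: x power_algebra)
    also have "\<dots> \<in> near a b 5" by (intro near_add near_scale sq4 c13)
    finally show ?thesis .
  qed
  have c04: "\<eta>^4 \<in> near a b 5"
  proof (cases "\<beta> = 0")
    case False
    define e where "e = - \<kappa> \<beta> * a3 + 3 * \<kappa> \<alpha> * b3 + (2 * \<kappa> \<beta>) * (\<eta> * D2 r)"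
    show ?thesis
    \<comment> \<open>The quadratic parts \<xi> (3 \<alpha> \<xi> + 2 \<beta> \<eta>) of a and
      \<beta> \<xi>^2 of b share the factor \<xi>; this is their syzygy. It cancels all cubic terms,
      and 2 \<beta> \<eta> times 4 \<gamma> \<eta>^3 leaves 8 \<beta> \<gamma> \<eta>^4, the rest
      being a multiple of \<xi>.\<close>
    proof (rule near_solve[where c = "8 * \<beta> * \<gamma>" and u = "- \<kappa> \<beta> * \<xi>"
          and v = "3 * \<kappa> \<alpha> * \<xi> + 2 * \<kappa> \<beta> * \<eta>"])
      show "\<kappa> (8 * \<beta> * \<gamma>) * \<eta>^4 =
          - \<kappa> \<beta> * \<xi> * a + (3 * \<kappa> \<alpha> * \<xi> + 2 * \<kappa> \<beta> * \<eta>) * b + - 1 * (\<xi> * e)"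
        by (simp add: a b a3_def b3_def e_def simps)
      have "e \<in> mpow 3" unfolding e_def
        by (intro mpow_add mpow_scale[OF a3] mpow_scale[OF b3]
            mpow_scale[OF mpow_coord_numeral(2)[OF r'(2)]])
      then show "- 1 * (\<xi> * e) \<in> near a b 5" by (intro near_scale xi_mpow)
    qed (use False nz in simp)
  next
    case True
    show ?thesis
    proof (rule near_solve[where c = "4 * \<gamma>" and u = 0 and v = \<eta>])
      show "\<kappa> (4 * \<gamma>) * \<eta>^4 = 0 * a + \<eta> * b + (- 1) * (\<xi> * (\<eta> * D2 r))"
        using True by (simp add: b simps)
      show "(- 1) * (\<xi> * (\<eta> * D2 r)) \<in> near a b 5"
        by (intro near_scale xi_mpow mpow_coord_numeral r')
    qed (use nz in simp)
  qed
  have lift: "x \<in> near a b m" if "x \<in> mpow 4" for x m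
  proof (rule near_lift)
    show "x \<in> mpow 4" by (rule that)
    fix x assume "x \<in> mpow 4"
    then obtain y s where "x = \<xi> * y + s * \<eta>^4" "y \<in> mpow 3" by (rule mpow4E)
    then have "x \<in> near a b 5" by (auto intro!: near_add near_scale xi_mpow c04)
    then show "x \<in> near a b (Suc 4)" by simp
  qed
  \<comment> \<open>Since m^4 can be lifted, a membership with an error of order 4 improves to one
    of order n.\<close>
  have near4: "x \<in> near a b 4 \<Longrightarrow> x \<in> near a b n" for x
    using lift[of _ n] by (auto simp: near_def[of a b 4] intro!: near_add near_scale near_gens)
  have "\<eta>^4 \<in> mpow 4" by (intro mpow_power coord_mpow)
  then have 4: "\<xi> * r + \<kappa> \<gamma> * \<eta>^4 \<in> mpow 4" by (intro mpow_add mpow_scale mpow_coord_numeral r)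
  have "g = \<kappa> \<alpha> * (\<xi> * \<xi>\<^sup>2) + \<kappa> \<beta> * (\<eta> * \<xi>\<^sup>2) + (\<xi> * r + \<kappa> \<gamma> * \<eta>^4)"
    by (simp add: g power2_eq_square power3_eq_cube mult_ac)
  also have "\<dots> \<in> near a b n" by (intro near_add near_scale near4 xi3 lift 4)
  finally show ?thesis by (simp add: a_def b_def)
qed

section \<open>Forms in the local coordinates and normal forms of the tangent cone\<close>

primrec form :: "nat \<Rightarrow> 'a set" where
  "form 0 = range \<kappa>"
| "form (Suc n) = {\<xi> * p + \<eta> * q |p q. p \<in> form n \<and> q \<in> form n}"

lemma form_add: "x \<in> form n \<Longrightarrow> y \<in> form n \<Longrightarrow> x + y \<in> form n"
proof (induction n arbitrary: x y)
  case 0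
  then show ?case by (auto simp: \<kappa>.hom_add[symmetric])
next
  case (Suc n)
  then obtain p q p' q' where *: "x = \<xi> * p + \<eta> * q" "y = \<xi> * p' + \<eta> * q'"
    "p \<in> form n" "q \<in> form n" "p' \<in> form n" "q' \<in> form n" by auto
  have "x + y = \<xi> * (p + p') + \<eta> * (q + q')" by (simp add: * algebra_simps)
  then show ?case using Suc.IH * by auto
qed

lemma form_const: "x \<in> form n \<Longrightarrow> \<kappa> c * x \<in> form n"
proof (induction n arbitrary: x)
  case 0
  then show ?case by (auto simp: \<kappa>.hom_mult[symmetric])
next
  case (Suc n)
  then obtain p q where *: "x = \<xi> * p + \<eta> * q" "p \<in> form n" "q \<in> form n" by auto
  have "\<kappa> c * x = \<xi> * (\<kappa> c * p) + \<eta> * (\<kappa> c * q)" by (simp add: * algebra_simps)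
  then show ?case using Suc.IH * by auto
qed

lemma form_mpow: "p \<in> form n \<Longrightarrow> p \<in> mpow n"
  by (induction n arbitrary: p) auto

lemma form1E:
  assumes "p \<in> form 1" obtains c0 c1 where "p = \<kappa> c0 * \<xi> + \<kappa> c1 * \<eta>"
  using assms by (auto simp: mult.commute)

lemma form2E:
  assumes "p \<in> form 2"
  obtains c0 c1 c2 where "p = \<kappa> c0 * \<xi>\<^sup>2 + \<kappa> c1 * (\<xi> * \<eta>) + \<kappa> c2 * \<eta>\<^sup>2"
proof -
  obtain y z where p: "p = \<xi> * y + \<eta> * z" "y \<in> form 1" "z \<in> form 1"
    using form.simps(2)[of 1] assms unfolding Suc_1 by blast
  from p(2) obtain c0 c1 where y: "y = \<kappa> c0 * \<xi> + \<kappa> c1 * \<eta>" by (rule form1E)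
  from p(3) obtain d0 d1 where z: "z = \<kappa> d0 * \<xi> + \<kappa> d1 * \<eta>" by (rule form1E)
  show ?thesis
    by (rule that[of c0 "c1 + d0" d1])
      (simp add: p(1) y z \<kappa>.hom_add power_algebra)
qed

lemma form3E:
  assumes "p \<in> form 3"
  obtains c0 c1 c2 c3 where "p = \<kappa> c0 * \<xi>^3 + \<kappa> c1 * (\<xi>\<^sup>2 * \<eta>) + \<kappa> c2 * (\<xi> * \<eta>\<^sup>2) + \<kappa> c3 * \<eta>^3"
proof -
  have "p \<in> form (Suc 2)" using assms by simp
  then obtain y z where p: "p = \<xi> * y + \<eta> * z" "y \<in> form 2" "z \<in> form 2"
    unfolding form.simps(2)[of 2] by blast
  from p(2) obtain c0 c1 c2 where y: "y = \<kappa> c0 * \<xi>\<^sup>2 + \<kappa> c1 * (\<xi> * \<eta>) + \<kappa> c2 * \<eta>\<^sup>2" by (rule form2E)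
  from p(3) obtain d0 d1 d2 where z: "z = \<kappa> d0 * \<xi>\<^sup>2 + \<kappa> d1 * (\<xi> * \<eta>) + \<kappa> d2 * \<eta>\<^sup>2" by (rule form2E)
  show ?thesis
    by (rule that[of c0 "c1 + d0" "c2 + d1" d2])
      (simp add: p(1) y z \<kappa>.hom_add power_algebra)
qed

lemma form4E:
  assumes "p \<in> form 4"
  obtains c0 c1 c2 c3 c4 where "p = \<kappa> c0 * \<xi>^4 + \<kappa> c1 * (\<xi>^3 * \<eta>) + \<kappa> c2 * (\<xi>\<^sup>2 * \<eta>\<^sup>2) +
    \<kappa> c3 * (\<xi> * \<eta>^3) + \<kappa> c4 * \<eta>^4"
proof -
  have "p \<in> form (Suc 3)" using assms by simp
  then obtain y z where p: "p = \<xi> * y + \<eta> * z" "y \<in> form 3" "z \<in> form 3"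
    unfolding form.simps(2)[of 3] by blast
  from p(2) obtain c0 c1 c2 c3 where
    y: "y = \<kappa> c0 * \<xi>^3 + \<kappa> c1 * (\<xi>\<^sup>2 * \<eta>) + \<kappa> c2 * (\<xi> * \<eta>\<^sup>2) + \<kappa> c3 * \<eta>^3" by (rule form3E)
  from p(3) obtain d0 d1 d2 d3 where
    z: "z = \<kappa> d0 * \<xi>^3 + \<kappa> d1 * (\<xi>\<^sup>2 * \<eta>) + \<kappa> d2 * (\<xi> * \<eta>\<^sup>2) + \<kappa> d3 * \<eta>^3" by (rule form3E)
  show ?thesis
    by (rule that[of c0 "c1 + d0" "c2 + d1" "c3 + d2" d3])
      (simp add: p(1) y z \<kappa>.hom_add power_algebra)
qed

lemma form4_split:
  assumes "p \<in> form 4"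
  obtains r c where "p = \<xi> * r + \<kappa> c * \<eta>^4" "r \<in> mpow 3"
proof -
  from assms obtain c0 c1 c2 c3 c4 where p: "p = \<kappa> c0 * \<xi>^4 + \<kappa> c1 * (\<xi>^3 * \<eta>) +
    \<kappa> c2 * (\<xi>\<^sup>2 * \<eta>\<^sup>2) + \<kappa> c3 * (\<xi> * \<eta>^3) + \<kappa> c4 * \<eta>^4" by (rule form4E)
  show ?thesis
  proof (rule that)
    show "p = \<xi> * (\<kappa> c0 * \<xi>^3 + \<kappa> c1 * (\<xi> * (\<xi> * \<eta>)) + \<kappa> c2 * (\<xi> * \<eta>\<^sup>2) + \<kappa> c3 * \<eta>^3) + \<kappa> c4 * \<eta>^4"
      by (simp add: p power_algebra)
    show "\<kappa> c0 * \<xi>^3 + \<kappa> c1 * (\<xi> * (\<xi> * \<eta>)) + \<kappa> c2 * (\<xi> * \<eta>\<^sup>2) + \<kappa> c3 * \<eta>^3 \<in> mpow 3"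
      by (intro mpow_add mpow_scale[where r = "\<kappa> _"] mpow_power coord_mpow mpow_coord_numeral quad_mpow)
  qed
qed

text \<open>Only lines through the point are excluded. This is all that the local argument takes
  from the irreducibility of the curve.\<close>

definition line_free :: "'a \<Rightarrow> bool" where
  "line_free g \<longleftrightarrow> (\<forall>l m. l \<noteq> 0 \<or> m \<noteq> 0 \<longrightarrow> \<not> \<kappa> l * \<xi> + \<kappa> m * \<eta> dvd g)"

lemma line_freeD: "line_free g \<Longrightarrow> l \<noteq> 0 \<or> m \<noteq> 0 \<Longrightarrow> g = (\<kappa> l * \<xi> + \<kappa> m * \<eta>) * w \<Longrightarrow> False"
  unfolding line_free_def by (metis dvd_triv_left)

text \<open>For \<open>\<rho> = 0\<close> this exchanges the coordinates, and two such changes compose to a shear.\<close>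

lemma flip: "plane_point \<kappa> D2 (\<lambda>x. D1 x + \<kappa> \<rho> * D2 x) (\<eta> - \<kappa> \<rho> * \<xi>) \<xi>"
proof
  fix h
  obtain c p q where "h = \<kappa> c + \<xi> * p + \<eta> * q" using decompose by blast
  then have "h = \<kappa> c + (\<eta> - \<kappa> \<rho> * \<xi>) * q + \<xi> * (p + \<kappa> \<rho> * q)" by (simp add: algebra_simps)
  then show "\<exists>c p q. h = \<kappa> c + (\<eta> - \<kappa> \<rho> * \<xi>) * p + \<xi> * q" by blast
next
  fix c p q assume "\<kappa> c = (\<eta> - \<kappa> \<rho> * \<xi>) * p + \<xi> * q"
  then have "\<kappa> c = \<xi> * (q - \<kappa> \<rho> * p) + \<eta> * p" by (simp add: algebra_simps)
  then show "c = 0" by (rule proper)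
qed (simp_all add: D1.add D2.add D1.mult D2.mult D1.diff D2.diff algebra_simps)

context
  fixes \<rho> :: 'k
begin

interpretation F: plane_point \<kappa> D2 "\<lambda>x. D1 x + \<kappa> \<rho> * D2 x" "\<eta> - \<kappa> \<rho> * \<xi>" \<xi>
  by (rule flip)

lemma flip_mpow: "F.mpow n = mpow n"
proof (induction n)
  case (Suc n)
  have "x \<in> mpow (Suc n)" if "x \<in> F.mpow (Suc n)" for x
  proof -
    obtain p q where "x = (\<eta> - \<kappa> \<rho> * \<xi>) * p + \<xi> * q" "p \<in> mpow n" "q \<in> mpow n"
      using \<open>x \<in> F.mpow (Suc n)\<close> Suc by auto
    moreover from this have "q - \<kappa> \<rho> * p \<in> mpow n" by (intro mpow_diff mpow_scale)
    moreover have "(\<eta> - \<kappa> \<rho> * \<xi>) * p + \<xi> * q = \<xi> * (q - \<kappa> \<rho> * p) + \<eta> * p" by (simp add: algebra_simps)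
    ultimately show ?thesis by (simp only: mpow_SucI)
  qed
  moreover have "x \<in> F.mpow (Suc n)" if "x \<in> mpow (Suc n)" for x
  proof -
    obtain p q where "x = \<xi> * p + \<eta> * q" "p \<in> mpow n" "q \<in> mpow n"
      using \<open>x \<in> mpow (Suc n)\<close> by auto
    moreover from this have "p + \<kappa> \<rho> * q \<in> mpow n" by (intro mpow_add mpow_scale)
    moreover have "\<xi> * p + \<eta> * q = (\<eta> - \<kappa> \<rho> * \<xi>) * q + \<xi> * (p + \<kappa> \<rho> * q)" by (simp add: algebra_simps)
    ultimately show ?thesis using Suc by (metis F.mpow_SucI)
  qed
  ultimately show ?case by blast
qed simp

lemma flip_form: "x \<in> form n \<Longrightarrow> x \<in> F.form n"
proof (induction n arbitrary: x)
  case (Suc n)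
  obtain p q where x: "x = \<xi> * p + \<eta> * q" "p \<in> form n" "q \<in> form n" using Suc.prems by auto
  have "x = (\<eta> - \<kappa> \<rho> * \<xi>) * q + \<xi> * (p + \<kappa> \<rho> * q)" by (simp add: x algebra_simps)
  moreover have "q \<in> F.form n" "p + \<kappa> \<rho> * q \<in> F.form n"
    using x by (auto intro!: Suc.IH form_add form_const)
  ultimately show ?case unfolding F.form.simps by blast
qed simp

lemma flip_line_free: "line_free g \<Longrightarrow> F.line_free g"
  unfolding F.line_free_def
proof (intro allI impI notI)
  fix l m assume g: "line_free g" "\<kappa> l * (\<eta> - \<kappa> \<rho> * \<xi>) + \<kappa> m * \<xi> dvd g" and lm: "l \<noteq> 0 \<or> m \<noteq> 0"
  have "\<kappa> l * (\<eta> - \<kappa> \<rho> * \<xi>) + \<kappa> m * \<xi> = \<kappa> (m - l * \<rho>) * \<xi> + \<kappa> l * \<eta>"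
    by (simp add: \<kappa>.hom_minus \<kappa>.hom_mult algebra_simps)
  moreover have "m - l * \<rho> \<noteq> 0 \<or> l \<noteq> 0" using lm by auto
  ultimately show False using g unfolding line_free_def by metis
qed

lemma flip_near:
  assumes "g \<in> F.near (D2 g) (D1 g + \<kappa> \<rho> * D2 g) n"
  shows "g \<in> near (D1 g) (D2 g) n"
proof -
  obtain u v e where "g = u * D2 g + v * (D1 g + \<kappa> \<rho> * D2 g) + e" "e \<in> mpow n"
    using assms by (auto simp: F.near_def flip_mpow)
  moreover have "u * D2 g + v * (D1 g + \<kappa> \<rho> * D2 g) + e = v * D1 g + (u + v * \<kappa> \<rho>) * D2 g + e"
    by (simp add: algebra_simps)
  ultimately show ?thesis using nearI by metis
qed

end

text \<open>Over an algebraically closed field a binary form has a linear factor: \<xi> if the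
  coefficient of \<eta>^4 vanishes, and otherwise \<eta> - t \<xi> for a root t. This rules out
  points of multiplicity four.\<close>

lemma quartic_line_factor:
  assumes "g \<in> form 4" shows "\<not> line_free g"
proof
  assume free: "line_free g"
  from assms obtain c0 c1 c2 c3 c4 where g: "g = \<kappa> c0 * \<xi>^4 + \<kappa> c1 * (\<xi>^3 * \<eta>) +
    \<kappa> c2 * (\<xi>\<^sup>2 * \<eta>\<^sup>2) + \<kappa> c3 * (\<xi> * \<eta>^3) + \<kappa> c4 * \<eta>^4" by (rule form4E)
  show False
  proof (cases "c4 = 0")
    case True
    show ?thesis
      by (rule line_freeD[OF free, of 1 0 "\<kappa> c0 * \<xi>^3 + \<kappa> c1 * (\<xi>\<^sup>2 * \<eta>) + \<kappa> c2 * (\<xi> * \<eta>\<^sup>2) + \<kappa> c3 * \<eta>^3"])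
        (simp_all add: g True power_algebra)
  next
    case False
    then have "\<exists>t. poly [:c0, c1, c2, c3, c4:] t = 0"
      by (intro alg_closed_imp_poly_has_root) simp
    then obtain t where "poly [:c0, c1, c2, c3, c4:] t = 0" ..
    then have c0: "c0 = - (t * (c1 + t * (c2 + t * (c3 + t * c4))))"
      by (simp add: add_eq_0_iff2)
    show ?thesis
      \<comment> \<open>The cofactor is the quotient of synthetic division by \<eta> - t \<xi>,
        matching the Horner form of \<open>c0\<close>.\<close>
      by (rule line_freeD[OF free, of "- t" 1 "\<kappa> c4 * \<eta>^3 + \<kappa> (c3 + c4 * t) * (\<xi> * \<eta>\<^sup>2) +
          \<kappa> (c2 + c3 * t + c4 * t\<^sup>2) * (\<xi>\<^sup>2 * \<eta>) + \<kappa> (c1 + c2 * t + c3 * t\<^sup>2 + c4 * t^3) * \<xi>^3"])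
        (simp_all add: g c0 \<kappa>.hom_add \<kappa>.hom_mult \<kappa>.hom_uminus \<kappa>.hom_minus power_algebra)
  qed
qed

text \<open>The tangent cone has the factor \<xi>. If \<gamma> = 0 this factor is double. Otherwise
  the residual quadratic form has a factor \<eta> - t \<xi>, which the flip makes the first
  coordinate, with \<xi> as the second; both axes are now in the cone, and the third line is either
  different from them or equal to the new first axis. Whenever a double line appears, the pure
  fourth power must occur, or else that line would divide g.\<close>

lemma triple_point_xi:
  assumes nz: "\<alpha> \<noteq> 0 \<or> \<beta> \<noteq> 0 \<or> \<gamma> \<noteq> 0" and r: "r \<in> form 4" and free: "line_free g"
    and g: "g = \<kappa> \<alpha> * \<xi>^3 + \<kappa> \<beta> * (\<xi>\<^sup>2 * \<eta>) + \<kappa> \<gamma> * (\<xi> * \<eta>\<^sup>2) + r"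
  shows "g \<in> near (D1 g) (D2 g) n"
proof (cases "\<gamma> = 0")
  case True
  from r obtain s c where s: "r = \<xi> * s + \<kappa> c * \<eta>^4" "s \<in> mpow 3" by (rule form4_split)
  have "c \<noteq> 0"
  proof
    assume "c = 0"
    then have "g = (\<kappa> 1 * \<xi> + \<kappa> 0 * \<eta>) * (\<kappa> \<alpha> * \<xi>\<^sup>2 + \<kappa> \<beta> * (\<xi> * \<eta>) + s)"
      by (simp add: g s True power_algebra)
    from line_freeD[OF free _ this] show False by simp
  qed
  with nz True s show ?thesis
    by (intro triple_point_double_factor[of \<alpha> \<beta> c s]) (simp_all add: g algebra_simps)
next
  case False
  then have "\<exists>t. poly [:\<alpha>, \<beta>, \<gamma>:] t = 0"
    by (intro alg_closed_imp_poly_has_root) simp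
  then obtain t where "poly [:\<alpha>, \<beta>, \<gamma>:] t = 0" ..
  then have \<alpha>: "\<alpha> = - (t * (\<beta> + t * \<gamma>))" by (simp add: add_eq_0_iff2)
  interpret F: plane_point \<kappa> D2 "\<lambda>x. D1 x + \<kappa> t * D2 x" "\<eta> - \<kappa> t * \<xi>" \<xi> by (rule flip)
  define \<xi>' where "\<xi>' = \<eta> - \<kappa> t * \<xi>"
  have \<eta>: "\<eta> = \<xi>' + \<kappa> t * \<xi>" by (simp add: \<xi>'_def)
  have r': "r \<in> F.form 4" by (rule flip_form[OF r])
  have g': "g = \<kappa> \<gamma> * (\<xi>'\<^sup>2 * \<xi>) + \<kappa> (2 * \<gamma> * t + \<beta>) * (\<xi>' * \<xi>\<^sup>2) + r"
    unfolding g \<eta> by (simp add: \<alpha> \<kappa>.hom_add \<kappa>.hom_mult \<kappa>.hom_uminus \<kappa>.hom_minus power_algebra)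
  show ?thesis
  proof (rule flip_near[of _ t], cases "2 * \<gamma> * t + \<beta> = 0")
    case nz': False
    show "g \<in> F.near (D2 g) (D1 g + \<kappa> t * D2 g) n"
      by (rule F.triple_point_reduced[OF False nz']) (use r' F.form_mpow g' in \<open>auto simp: \<xi>'_def\<close>)
  next
    case True
    from r' obtain s c where s: "r = \<xi>' * s + \<kappa> c * \<xi>^4" "s \<in> F.mpow 3"
      unfolding \<xi>'_def by (rule F.form4_split)
    have g'': "g = \<kappa> 0 * \<xi>'^3 + \<kappa> \<gamma> * (\<xi>'\<^sup>2 * \<xi>) + \<xi>' * s + \<kappa> c * \<xi>^4"
      using g'[unfolded True] by (simp add: s algebra_simps)
    have "c \<noteq> 0"
    proof
      assume "c = 0"
      then have "g = (\<kappa> 1 * \<xi>' + \<kappa> 0 * \<xi>) * (\<kappa> \<gamma> * (\<xi>' * \<xi>) + s)"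
        by (simp add: g'' power_algebra)
      from F.line_freeD[OF flip_line_free[OF free] _ this[unfolded \<xi>'_def]] show False by simp
    qed
    with False s(2) g'' show "g \<in> F.near (D2 g) (D1 g + \<kappa> t * D2 g) n"
      unfolding \<xi>'_def by (intro F.triple_point_double_factor[of 0 \<gamma> c s]) auto
  qed
qed

text \<open>A nonzero quadratic part becomes a nonzero second derivative along the second
  coordinate, if necessary after a flip. A nonzero cubic part gets a line of its tangent cone as
  first coordinate. If both vanish, g is a binary form and has a linear factor.\<close>

theorem quartic_quasi_homogeneous:
  assumes g: "g = g2 + g3 + g4" "g2 \<in> form 2" "g3 \<in> form 3" "g4 \<in> form 4" and free: "line_free g"
  shows "g \<in> near (D1 g) (D2 g) n"
proof -
  from g(2) obtain c0 c1 c2 where g2: "g2 = \<kappa> c0 * \<xi>\<^sup>2 + \<kappa> c1 * (\<xi> * \<eta>) + \<kappa> c2 * \<eta>\<^sup>2"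
    by (rule form2E)
  from g(3) obtain d0 d1 d2 d3 where
    g3: "g3 = \<kappa> d0 * \<xi>^3 + \<kappa> d1 * (\<xi>\<^sup>2 * \<eta>) + \<kappa> d2 * (\<xi> * \<eta>\<^sup>2) + \<kappa> d3 * \<eta>^3"
    by (rule form3E)
  define h where "h = g3 + g4"
  have h: "h \<in> mpow 3"
    unfolding h_def using form_mpow[OF g(3)] form_mpow[OF g(4)] mpow_antimono[of 3 4 g4]
    by (intro mpow_add) simp_all
  have gh: "g = \<kappa> c0 * \<xi>\<^sup>2 + \<kappa> c1 * (\<xi> * \<eta>) + \<kappa> c2 * \<eta>\<^sup>2 + h"
    by (simp add: g(1) g2 h_def)
  have h': "D1 (D1 h) \<in> mpow 1" "D1 (D2 h) \<in> mpow 1" "D2 (D1 h) \<in> mpow 1" "D2 (D2 h) \<in> mpow 1"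
    using D_mpow_numeral(3,4)[OF h] D_mpow[of "D1 h" 1] D_mpow[of "D2 h" 1]
    by (simp_all only: Suc_1)
  have g_mpow: "g \<in> mpow 2"
    unfolding gh by (intro mpow_add mpow_scale[where r = "\<kappa> _"] quad_mpow) (rule mpow_antimono[OF _ h], simp)
  have D22: "D2 (D2 g) - \<kappa> (2 * c2) = D2 (D2 h)" and D11: "D1 (D1 g) - \<kappa> (2 * c0) = D1 (D1 h)"
    and D12: "D1 (D2 g) - \<kappa> c1 = D1 (D2 h)" and D21: "D2 (D1 g) - \<kappa> c1 = D2 (D1 h)"
    by (simp_all add: gh D1.add D2.add D1.mult D2.mult power2_eq_square \<kappa>.hom_mult algebra_simps)
  consider "c2 \<noteq> 0" | "c0 \<noteq> 0 \<or> c1 \<noteq> 0" "c2 = 0" | "c0 = 0" "c1 = 0" "c2 = 0" by blast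
  then show ?thesis
  proof cases
    case 1
    then show ?thesis using h' D22 by (intro double_point[OF g_mpow, of "2 * c2"]) simp_all
  next
    case 2
    \<comment> \<open>With \<open>c2\<close> = 0 the second derivative along the new second
      coordinate has the constant term 2 (c0 + t c1), which this choice of t makes nonzero.\<close>
    define t where "t = (if c0 = 0 then 1 else (0::'k))"
    interpret F: plane_point \<kappa> D2 "\<lambda>x. D1 x + \<kappa> t * D2 x" "\<eta> - \<kappa> t * \<xi>" \<xi> by (rule flip)
    let ?D = "\<lambda>x. D1 x + \<kappa> t * D2 x"
    show ?thesis
    proof (rule flip_near[of _ t], rule F.double_point)
      show "g \<in> F.mpow 2" using g_mpow by (simp add: flip_mpow)
      show "2 * (c0 + t * c1) \<noteq> 0" using 2 by (simp add: t_def)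
      have "?D (?D g) - \<kappa> (2 * (c0 + t * c1)) = (D1 (D1 g) - \<kappa> (2 * c0)) +
         \<kappa> t * (D1 (D2 g) - \<kappa> c1) + \<kappa> t * (D2 (D1 g) - \<kappa> c1) + \<kappa> t * \<kappa> t * (D2 (D2 g) - \<kappa> (2 * c2))"
        using 2 by (simp add: D1.add D2.add D1.mult D2.mult \<kappa>.hom_mult \<kappa>.hom_add algebra_simps)
      also have "\<dots> \<in> mpow 1"
        unfolding D11 D12 D21 D22 by (intro mpow_add mpow_scale h')
      finally show "?D (?D g) - \<kappa> (2 * (c0 + t * c1)) \<in> F.mpow 1" by (simp only: flip_mpow)
    qed
  next
    case 3
    then have gg: "g = g3 + g4" by (simp add: g(1) g2)
    have "d0 = 0 \<Longrightarrow> d1 = 0 \<Longrightarrow> d2 = 0 \<Longrightarrow> d3 = 0 \<Longrightarrow> g3 = 0" by (simp add: g3)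
    then consider "d3 = 0" "d0 \<noteq> 0 \<or> d1 \<noteq> 0 \<or> d2 \<noteq> 0" | "d3 \<noteq> 0" | "g3 = 0" by blast
    then show ?thesis
    proof cases
      case 1
      show ?thesis
        by (rule triple_point_xi[OF 1(2) g(4) free]) (simp add: gg g3 1)
    next
      case 2
      \<comment> \<open>A root of the cubic gives the line \<eta> - t \<xi> of the tangent cone; as
        first coordinate after the flip it makes \<open>triple_point_xi\<close> applicable.\<close>
      then have "\<exists>t. poly [:d0, d1, d2, d3:] t = 0"
        by (intro alg_closed_imp_poly_has_root) simp
      then obtain t where "poly [:d0, d1, d2, d3:] t = 0" ..
      then have d0: "d0 = - (t * (d1 + t * (d2 + t * d3)))" by (simp add: add_eq_0_iff2)
      interpret F: plane_point \<kappa> D2 "\<lambda>x. D1 x + \<kappa> t * D2 x" "\<eta> - \<kappa> t * \<xi>" \<xi> by (rule flip)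
      define \<xi>' where "\<xi>' = \<eta> - \<kappa> t * \<xi>"
      have \<eta>: "\<eta> = \<xi>' + \<kappa> t * \<xi>" by (simp add: \<xi>'_def)
      have "g = \<kappa> d3 * \<xi>'^3 + \<kappa> (3 * d3 * t + d2) * (\<xi>'\<^sup>2 * \<xi>) +
          \<kappa> (3 * d3 * t\<^sup>2 + 2 * d2 * t + d1) * (\<xi>' * \<xi>\<^sup>2) + g4"
        unfolding gg g3 \<eta>
        by (simp add: d0 \<kappa>.hom_add \<kappa>.hom_mult \<kappa>.hom_uminus \<kappa>.hom_minus power_algebra)
      then have "g \<in> F.near (D2 g) (D1 g + \<kappa> t * D2 g) n"
        unfolding \<xi>'_def using 2
        by (intro F.triple_point_xi[OF _ flip_form[OF g(4)] flip_line_free[OF free]]) auto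
      then show ?thesis by (rule flip_near)
    next
      case 3
      then show ?thesis using quartic_line_factor[OF g(4)] free gg by simp
    qed
  qed
qed

text \<open>Polynomials of degree at most n in \<xi> and \<eta>. This carries the degree bound on
  the curve to local coordinates at an arbitrary point, without computing any Taylor
  coefficients.\<close>

primrec filt :: "nat \<Rightarrow> 'a set" where
  "filt 0 = range \<kappa>"
| "filt (Suc n) = {\<kappa> c + \<xi> * p + \<eta> * q |c p q. p \<in> filt n \<and> q \<in> filt n}"

lemma filt_SucI: "p \<in> filt n \<Longrightarrow> q \<in> filt n \<Longrightarrow> \<kappa> c + \<xi> * p + \<eta> * q \<in> filt (Suc n)"
  by auto

lemma filt_const: "\<kappa> c \<in> filt n"
proof (induction n arbitrary: c)
  case (Suc n)
  from filt_SucI[OF Suc[of 0] Suc[of 0], of c] show ?case by simp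
qed simp

lemma filt_add: "x \<in> filt n \<Longrightarrow> y \<in> filt n \<Longrightarrow> x + y \<in> filt n"
proof (induction n arbitrary: x y)
  case 0
  then show ?case by (auto simp: \<kappa>.hom_add[symmetric])
next
  case (Suc n)
  then obtain c p q c' p' q' where *: "x = \<kappa> c + \<xi> * p + \<eta> * q" "y = \<kappa> c' + \<xi> * p' + \<eta> * q'"
    "p \<in> filt n" "q \<in> filt n" "p' \<in> filt n" "q' \<in> filt n" by auto
  have "x + y = \<kappa> (c + c') + \<xi> * (p + p') + \<eta> * (q + q')"
    by (simp add: * \<kappa>.hom_add algebra_simps)
  also have "\<dots> \<in> filt (Suc n)" using * by (intro filt_SucI Suc.IH)
  finally show ?case .
qed

lemma filt_scale: "x \<in> filt n \<Longrightarrow> \<kappa> c * x \<in> filt n"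
proof (induction n arbitrary: x)
  case 0
  then show ?case by (auto simp: \<kappa>.hom_mult[symmetric])
next
  case (Suc n)
  then obtain d p q where *: "x = \<kappa> d + \<xi> * p + \<eta> * q" "p \<in> filt n" "q \<in> filt n" by auto
  have "\<kappa> c * x = \<kappa> (c * d) + \<xi> * (\<kappa> c * p) + \<eta> * (\<kappa> c * q)"
    by (simp add: * \<kappa>.hom_mult algebra_simps)
  also have "\<dots> \<in> filt (Suc n)" using * by (intro filt_SucI Suc.IH)
  finally show ?case .
qed

lemma filt_Suc_subset: "x \<in> filt n \<Longrightarrow> x \<in> filt (Suc n)"
proof (induction n arbitrary: x)
  case 0
  then show ?case using filt_const[of _ 1] by auto
next
  case (Suc n)
  then obtain d p q where *: "x = \<kappa> d + \<xi> * p + \<eta> * q" "p \<in> filt n" "q \<in> filt n" by auto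
  show ?case unfolding *(1) by (intro filt_SucI Suc.IH *)
qed

lemma filt_mult: "x \<in> filt m \<Longrightarrow> y \<in> filt n \<Longrightarrow> x * y \<in> filt (m + n)"
proof (induction m arbitrary: x)
  case 0
  then show ?case by (auto intro: filt_scale)
next
  case (Suc m)
  then obtain d p q where *: "x = \<kappa> d + \<xi> * p + \<eta> * q" "p \<in> filt m" "q \<in> filt m" by auto
  have mono: "\<kappa> d * y \<in> filt (n + k)" for k
    by (induction k) (auto intro: filt_scale Suc.prems(2) filt_Suc_subset simp del: filt.simps)
  have "\<kappa> d * y + (\<kappa> 0 + \<xi> * (p * y) + \<eta> * (q * y)) \<in> filt (Suc (m + n))"
    using mono[of "Suc m"] * Suc.prems(2)
    by (intro filt_add filt_SucI Suc.IH) (simp_all add: add.commute del: filt.simps)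
  then show ?case by (simp add: * algebra_simps del: filt.simps)
qed

lemma filt_power: "x \<in> filt 1 \<Longrightarrow> x ^ n \<in> filt n"
proof (induction n)
  case 0
  then show ?case using filt_const[of 1 0] by simp
next
  case (Suc n)
  then show ?case using filt_mult[of x 1 "x ^ n" n] by simp
qed

lemma filt_forms: "x \<in> filt n \<Longrightarrow> \<exists>p. (\<forall>i. p i \<in> form i) \<and> x = (\<Sum>i\<le>n. p i)"
proof (induction n arbitrary: x)
  case 0
  then obtain c where "x = \<kappa> c" by auto
  moreover have "0 \<in> form i" for i
  proof (induction i)
    case 0
    have "\<kappa> 0 \<in> form 0" unfolding form.simps by blast
    then show ?case by simp
  next
    case (Suc i)
    have "\<xi> * 0 + \<eta> * 0 \<in> form (Suc i)" unfolding form.simps using Suc by blast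
    then show ?case by simp
  qed
  ultimately show ?case by (intro exI[of _ "\<lambda>i. if i = 0 then \<kappa> c else 0"]) auto
next
  case (Suc n)
  then obtain c p q where x: "x = \<kappa> c + \<xi> * p + \<eta> * q" "p \<in> filt n" "q \<in> filt n" by auto
  from Suc.IH[OF x(2)] Suc.IH[OF x(3)] obtain p' q' where
    p': "\<And>i. p' i \<in> form i" "p = (\<Sum>i\<le>n. p' i)" and q': "\<And>i. q' i \<in> form i" "q = (\<Sum>i\<le>n. q' i)"
    by blast
  define s where "s i = (case i of 0 \<Rightarrow> \<kappa> c | Suc j \<Rightarrow> \<xi> * p' j + \<eta> * q' j)" for i
  have "s i \<in> form i" for i using p' q' by (cases i) (auto simp: s_def)
  moreover have "x = (\<Sum>i\<le>Suc n. s i)"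
    by (simp only: sum.atMost_Suc_shift) (simp add: s_def x(1) p' q' sum.distrib sum_distrib_left add.assoc)
  ultimately show ?case by blast
qed

text \<open>At a singular point the constant and linear Taylor coefficients vanish, being the
  constant terms of g and of its two derivatives; what remains starts in degree two.\<close>

theorem quartic_near_gradient:
  assumes g: "g \<in> filt 4" and sing: "g \<in> mpow 1" "D1 g \<in> mpow 1" "D2 g \<in> mpow 1"
    and free: "line_free g"
  shows "g \<in> near (D1 g) (D2 g) n"
proof -
  from filt_forms[OF g] obtain p where p: "\<And>i. p i \<in> form i" "g = (\<Sum>i\<le>4. p i)" by blast
  have g': "g = p 0 + p 1 + (p 2 + p 3 + p 4)"
    by (simp add: p(2) eval_nat_numeral add.assoc)
  obtain c where c: "p 0 = \<kappa> c" using p(1)[of 0] by auto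
  obtain a b where ab: "p 1 = \<kappa> a * \<xi> + \<kappa> b * \<eta>" using p(1)[of 1] by (rule form1E)
  define h where "h = p 2 + p 3 + p 4"
  have "p 2 \<in> mpow 2" "p 3 \<in> mpow 2" "p 4 \<in> mpow 2"
    using p(1) form_mpow mpow_antimono[of 2 3 "p 3"] mpow_antimono[of 2 4 "p 4"] by simp_all
  then have h: "h \<in> mpow 2" unfolding h_def by (intro mpow_add)
  then have h1: "h \<in> mpow 1" using mpow_antimono[of 1 2 h] by simp
  have Dh: "D1 h \<in> mpow 1" "D2 h \<in> mpow 1" using h D_mpow[of h 1] by (simp_all only: Suc_1)
  note g'' = g'[folded h_def, unfolded c ab]
  have "\<kappa> c = g - (\<kappa> a * \<xi> + \<kappa> b * \<eta> + h)" by (simp add: g'')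
  also have "\<dots> \<in> mpow 1"
    by (rule mpow_diff[OF sing(1)]) (intro mpow_add h1 mpow_scale coord_mpow)
  finally have "c = 0" by (rule const_mpow)
  have "\<kappa> a = D1 g - D1 h" by (simp add: g'' D1.add D1.mult)
  also have "\<dots> \<in> mpow 1" by (intro mpow_diff sing Dh)
  finally have "a = 0" by (rule const_mpow)
  have "\<kappa> b = D2 g - D2 h" by (simp add: g'' D2.add D2.mult)
  also have "\<dots> \<in> mpow 1" by (intro mpow_diff sing Dh)
  finally have "b = 0" by (rule const_mpow)
  have "g = p 2 + p 3 + p 4"
    using \<open>c = 0\<close> \<open>a = 0\<close> \<open>b = 0\<close> by (simp add: g'' h_def)
  then show ?thesis using p(1) free by (intro quartic_quasi_homogeneous)
qed

text \<open>In a monomial of degree i + j either \<xi> has exponent at least i or \<eta> has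
  exponent at least j.\<close>

lemma mpow_coord_powers: "x \<in> mpow (i + j) \<Longrightarrow> \<exists>u v. x = u * \<xi> ^ i + v * \<eta> ^ j"
proof (induction "i + j" arbitrary: i j x)
  case 0
  then show ?case by (intro exI[of _ x] exI[of _ 0]) simp
next
  case (Suc n)
  show ?case
  proof (cases "i = 0 \<or> j = 0")
    case True
    then show ?thesis
      by (elim disjE) (intro exI[of _ x] exI[of _ 0]; simp)+
  next
    case False
    then obtain i' j' where ij: "i = Suc i'" "j = Suc j'" by (metis not0_implies_Suc)
    then have "x \<in> mpow (Suc (i' + j))" using Suc.prems by simp
    then obtain p q where x: "x = \<xi> * p + \<eta> * q" "p \<in> mpow (i' + j)" "q \<in> mpow (i' + j)" by auto
    obtain u v where "p = u * \<xi> ^ i' + v * \<eta> ^ j"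
      using Suc.hyps(1)[of i' j p] Suc.hyps(2) x ij by auto
    moreover obtain u' v' where "q = u' * \<xi> ^ i + v' * \<eta> ^ j'"
      using Suc.hyps(1)[of i j' q] Suc.hyps(2) x ij by auto
    ultimately have "x = (u + \<eta> * u') * \<xi> ^ i + (\<xi> * v + v') * \<eta> ^ j"
      by (simp add: x(1) ij algebra_simps)
    then show ?thesis by blast
  qed
qed

end

section \<open>Ideals of polynomial rings\<close>

lemma poly_prime_factor:
  fixes H :: "'a::ufd poly"
  assumes "degree H > 0"
  shows "\<exists>P. prime_elem P \<and> degree P > 0 \<and> P dvd H"
proof -
  have "H \<noteq> 0" using assms by auto
  moreover have "\<not> H dvd 1" using dvd_imp_degree_le[of H 1] assms by auto
  ultimately obtain M where M: "mset_factors M H" using mset_factors_exist by blast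
  then have prod: "prod_mset M = H" and irr: "\<And>f. f \<in># M \<Longrightarrow> Factorial_Ring.irreducible f" by auto
  have "\<exists>f. f \<in># M \<and> degree f > 0"
  proof (rule ccontr)
    assume "\<nexists>f. f \<in># M \<and> degree f > 0"
    then have "degree (prod_mset M) = 0"
    proof (induction M)
      case (add f M)
      then have "degree f = 0" "degree (prod_mset M) = 0" by auto
      then show ?case using degree_mult_le[of f "prod_mset M"] by simp
    qed simp
    with prod assms show False by simp
  qed
  then obtain f where f: "f \<in># M" "degree f > 0" by blast
  obtain M' where "M = add_mset f M'" using f(1) by (metis insert_DiffM)
  then have "f dvd H" using prod by auto
  moreover have "prime_elem f" using irr[OF f(1)] by (simp only: prime_elem_iff_irreducible)
  ultimately show ?thesis using f(2) by (intro exI[of _ f] conjI)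
qed

text \<open>A substitute for the resultant. Let H have least degree in the ideal (F, G). By
  pseudo-division H divides a nonzero constant multiple of every element, so a prime factor of
  positive degree in H would divide both F and G. Hence H is a constant.\<close>

lemma bezout_const:
  fixes F G :: "'a::ufd poly"
  assumes "F \<noteq> 0" and common: "\<And>P. P dvd F \<Longrightarrow> P dvd G \<Longrightarrow> degree P = 0"
  obtains r U V where "r \<noteq> 0" "[:r:] = U * F + V * G"
proof -
  define J where "J = {u * F + v * G |u v. True}"
  have JI: "u * F + v * G \<in> J" for u v by (auto simp: J_def)
  have "F \<in> J" "G \<in> J" using JI[of 1 0] JI[of 0 1] by simp_all
  have J_diff: "x - q * y \<in> J" if xy: "x \<in> J" "y \<in> J" for x y q
  proof -
    obtain u v u' v' where "x = u * F + v * G" "y = u' * F + v' * G" using xy by (auto simp: J_def)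
    then have "x - q * y = (u - q * u') * F + (v - q * v') * G" by (simp add: algebra_simps)
    then show ?thesis by (simp only: JI)
  qed
  obtain H where H: "H \<in> J" "H \<noteq> 0" "\<And>K. K \<in> J \<Longrightarrow> K \<noteq> 0 \<Longrightarrow> degree H \<le> degree K"
    using ex_has_least_nat[of "\<lambda>H. H \<in> J \<and> H \<noteq> 0" F degree] \<open>F \<in> J\<close> assms(1) by blast
  have div: "\<exists>c. c \<noteq> 0 \<and> H dvd smult c K" if "K \<in> J" for K
  proof -
    obtain q r where qr: "pseudo_divmod K H = (q, r)" by fastforce
    define c where "c = lead_coeff H ^ (Suc (degree K) - degree H)"
    have eq: "smult c K = H * q + r" and r: "r = 0 \<or> degree r < degree H"
      using pseudo_divmod[OF H(2) qr] by (simp_all add: c_def)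
    have "smult c K \<in> J"
      using J_diff[of 0 K "- [:c:]"] JI[of 0 0] \<open>K \<in> J\<close> by simp
    from J_diff[OF this H(1), of q] have "r \<in> J" by (simp add: eq mult.commute)
    then have "r = 0" using r H(3)[of r] by (meson not_less)
    moreover have "c \<noteq> 0" using H(2) by (simp add: c_def)
    ultimately show ?thesis using eq by (metis add.right_neutral dvd_triv_left)
  qed
  have "degree H = 0"
  proof (rule ccontr)
    assume "degree H \<noteq> 0"
    then obtain P where P: "prime_elem P" "degree P > 0" "P dvd H" using poly_prime_factor[of H] by auto
    have "P dvd K" if K: "K \<in> J" for K
    proof -
      obtain c where c: "c \<noteq> 0" "H dvd smult c K" using div[OF K] by blast
      then have "P dvd [:c:] * K" using P(3) dvd_trans by auto
      moreover have "\<not> P dvd [:c:]" using dvd_imp_degree_le[of P "[:c:]"] c P(2) by auto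
      ultimately show ?thesis using prime_elem_dvd_multD[OF P(1)] by blast
    qed
    then show False using common[of P] P(2) \<open>F \<in> J\<close> \<open>G \<in> J\<close> by auto
  qed
  then obtain r where r: "H = [:r:]" by (rule degree_eq_zeroE)
  obtain U V where "H = U * F + V * G" using H(1) by (auto simp: J_def)
  with r H(2) show ?thesis by (intro that[of r U V]) auto
qed

text \<open>Division by b is possible over the coefficient ring, so the quotient by b is a free
  module and nonzero constants act injectively on it; concretely, d times the remainder has too
  small a degree to be a nonzero multiple of b.\<close>

lemma unit_lead_coeff_dvd_cancel:
  fixes b u :: "'a::idom poly"
  assumes unit: "lead_coeff b dvd 1" and "d \<noteq> 0" and dvd: "b dvd [:d:] * u"
  shows "b dvd u"
proof -
  have "b \<noteq> 0" using unit by auto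
  obtain q r where qr: "pseudo_divmod u b = (q, r)" by fastforce
  define c where "c = lead_coeff b ^ (Suc (degree u) - degree b)"
  have eq: "smult c u = b * q + r" and r: "r = 0 \<or> degree r < degree b"
    using pseudo_divmod[OF \<open>b \<noteq> 0\<close> qr] by (simp_all add: c_def)
  have "c dvd 1" unfolding c_def using unit by (metis dvd_power_same power_one)
  then obtain c' where c': "1 = c * c'" by (auto simp: dvd_def)
  have "b dvd [:d:] * (smult c u - b * q)"
    using dvd dvd_mult[OF dvd, of "[:c:]"] by (simp add: algebra_simps dvd_diff dvd_smult)
  then have "b dvd smult d r" by (simp add: eq)
  have "r = 0"
  proof (rule ccontr)
    assume "r \<noteq> 0"
    then have "degree b \<le> degree (smult d r)"
      using \<open>b dvd smult d r\<close> \<open>d \<noteq> 0\<close> by (intro dvd_imp_degree_le) simp_all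
    with r \<open>r \<noteq> 0\<close> \<open>d \<noteq> 0\<close> show False by simp
  qed
  have "u = smult c' (smult c u)" using c' by (simp add: mult.commute)
  also have "\<dots> = b * smult c' q" using eq \<open>r = 0\<close> by simp
  finally show ?thesis by (rule dvdI)
qed

definition ring_ideal :: "'a::comm_ring_1 set \<Rightarrow> bool" where
  "ring_ideal Q \<longleftrightarrow> 0 \<in> Q \<and> (\<forall>x\<in>Q. \<forall>y\<in>Q. x + y \<in> Q) \<and> (\<forall>x\<in>Q. \<forall>r. r * x \<in> Q)"

lemma ring_idealD:
  assumes "ring_ideal Q"
  shows "0 \<in> Q" "x \<in> Q \<Longrightarrow> y \<in> Q \<Longrightarrow> x + y \<in> Q" "x \<in> Q \<Longrightarrow> r * x \<in> Q"
    "x \<in> Q \<Longrightarrow> y \<in> Q \<Longrightarrow> x - y \<in> Q"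
proof -
  show *: "0 \<in> Q" "x \<in> Q \<Longrightarrow> y \<in> Q \<Longrightarrow> x + y \<in> Q" "x \<in> Q \<Longrightarrow> r * x \<in> Q" for x y r
    using assms by (auto simp: ring_ideal_def)
  show "x \<in> Q \<Longrightarrow> y \<in> Q \<Longrightarrow> x - y \<in> Q" using *(2)[of x "- y"] *(3)[of y "- 1"] by simp
qed

lemma ring_ideal_insert:
  assumes "ring_ideal Q"
  shows "ring_ideal {w + d * s |w s. w \<in> Q}"
  unfolding ring_ideal_def
proof (intro conjI ballI allI)
  have "0 = 0 + d * 0" by simp
  then show "0 \<in> {w + d * s |w s. w \<in> Q}" using ring_idealD(1)[OF assms] by blast
  fix x assume "x \<in> {w + d * s |w s. w \<in> Q}"
  then obtain w s where x: "x = w + d * s" "w \<in> Q" by blast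
  show "r * x \<in> {w + d * s |w s. w \<in> Q}" for r
  proof -
    have "r * x = r * w + d * (r * s)" by (simp add: x algebra_simps)
    then show ?thesis using ring_idealD(3)[OF assms x(2)] by blast
  qed
  fix y assume "y \<in> {w + d * s |w s. w \<in> Q}"
  then obtain w' s' where y: "y = w' + d * s'" "w' \<in> Q" by blast
  have "x + y = (w + w') + d * (s + s')" by (simp add: x y algebra_simps)
  then show "x + y \<in> {w + d * s |w s. w \<in> Q}" using ring_idealD(2)[OF assms x(2) y(2)] by blast
qed

text \<open>One coordinate of the Nullstellensatz: if all linear factors t - \<rho> of P were
  invertible modulo Q, then so would be P, which is 0 there.\<close>

lemma proper_ideal_root:
  fixes \<kappa> :: "'k::alg_closed_field \<Rightarrow> 'a::comm_ring_1"
  assumes "comm_ring_hom \<kappa>" and Q: "ring_ideal Q" "1 \<notin> Q" and P: "poly_lift \<kappa> t P \<in> Q" "P \<noteq> 0"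
  shows "\<exists>\<rho>. 1 \<notin> {w + (t - \<kappa> \<rho>) * s |w s. w \<in> Q}"
  using P
proof (induction "degree P" arbitrary: P rule: less_induct)
  case less
  interpret \<kappa>: comm_ring_hom \<kappa> by fact
  interpret L: comm_ring_hom "poly_lift \<kappa> t" by (rule \<kappa>.comm_ring_hom_poly_lift)
  show ?case
  proof (cases "degree P = 0")
    case True
    then obtain c where c: "P = [:c:]" by (rule degree_eq_zeroE)
    then have "\<kappa> (inverse c) * \<kappa> c \<in> Q" using less.prems ring_idealD(3)[OF Q(1)] by simp
    moreover have "\<kappa> (inverse c) * \<kappa> c = 1" using c less.prems by (simp add: \<kappa>.hom_mult[symmetric])
    ultimately show ?thesis using Q(2) by simp
  next
    case False
    then obtain \<rho> where "poly P \<rho> = 0" using alg_closed_imp_poly_has_root[of P] by auto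
    then obtain P' where P': "P = [:- \<rho>, 1:] * P'" by (auto simp: poly_eq_0_iff_dvd)
    have lP: "poly_lift \<kappa> t P = (t - \<kappa> \<rho>) * poly_lift \<kappa> t P'"
      unfolding P' L.hom_mult by (simp add: \<kappa>.hom_uminus)
    show ?thesis
    proof (cases "1 \<in> {w + (t - \<kappa> \<rho>) * s |w s. w \<in> Q}")
      case True
      then obtain w s where ws: "1 = w + (t - \<kappa> \<rho>) * s" "w \<in> Q" by blast
      \<comment> \<open>When t - \<rho> is invertible modulo Q, that factor of P can be cancelled
        and the degree drops.\<close>
      have "poly_lift \<kappa> t P' = poly_lift \<kappa> t P' * (w + (t - \<kappa> \<rho>) * s)"
        by (simp add: ws(1)[symmetric])
      also have "\<dots> = poly_lift \<kappa> t P' * w + s * poly_lift \<kappa> t P"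
        by (simp add: lP algebra_simps)
      also have "\<dots> \<in> Q" using ws(2) less.prems(1) by (intro ring_idealD[OF Q(1)])
      finally have "poly_lift \<kappa> t P' \<in> Q" .
      moreover have "P' \<noteq> 0" "degree P' < degree P"
        using less.prems(2) unfolding P' by (auto simp: degree_mult_eq simp del: mult_pCons_left)
      ultimately show ?thesis by (intro less.hyps)
    qed blast
  qed
qed

section \<open>Affine curves with quasi-homogeneous singularities\<close>

lemma derivation_pderiv: "derivation (pderiv :: 'a::idom poly \<Rightarrow> 'a poly)"
  by unfold_locales (simp_all add: pderiv_add pderiv_mult mult.commute)

lemma (in derivation) map_poly_derivation: "derivation (map_poly D)"
proof
  fix p q :: "'a poly"
  have map_pCons: "map_poly D (pCons a q) = pCons (D a) (map_poly D q)" for a q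
    by (intro poly_eqI) (auto simp: coeff_map_poly coeff_pCons split: nat.splits)
  show add_map: "map_poly D (p + q) = map_poly D p + map_poly D q" for p q
    by (intro poly_eqI) (simp add: coeff_map_poly add)
  have sm: "map_poly D (smult a q) = smult (D a) q + smult a (map_poly D q)" for a q
    by (intro poly_eqI) (simp add: coeff_map_poly mult)
  show "map_poly D (p * q) = map_poly D p * q + p * map_poly D q"
  proof (induction p)
    case (pCons a p)
    then show ?case by (simp add: add_map sm map_pCons algebra_simps)
  qed simp
qed

abbreviation (input) "pp_eval w \<rho> \<sigma> \<equiv> poly (poly w [:\<sigma>:]) \<rho>"

lemma pp_decompose:
  "\<exists>p q. w = [:[:pp_eval w \<rho> \<sigma>:]:] + [:[:-\<rho>, 1:]:] * p + [:[:-\<sigma>:], 1:] * (q::'k::idom poly poly)"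
proof -
  have "poly (w - [:poly w [:\<sigma>:]:]) [:\<sigma>:] = 0" by simp
  then obtain q where q: "w - [:poly w [:\<sigma>:]:] = [:- [:\<sigma>:], 1:] * q" unfolding poly_eq_0_iff_dvd by blast
  define u where "u = poly w [:\<sigma>:]"
  have "poly (u - [:poly u \<rho>:]) \<rho> = 0" by simp
  then obtain p where p: "u - [:poly u \<rho>:] = [:- \<rho>, 1:] * p" unfolding poly_eq_0_iff_dvd by blast
  have "w = [:[:poly u \<rho>:]:] + [:u - [:poly u \<rho>:]:] + (w - [:u:])" by simp
  also have "[:u - [:poly u \<rho>:]:] = [:[:-\<rho>, 1:]:] * [:p:]" unfolding p by simp
  also have "w - [:u:] = [:[:-\<sigma>:], 1:] * q" using q by (simp add: u_def)
  finally show ?thesis unfolding u_def by blast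
qed

lemma plane_point_affine:
  "plane_point (\<lambda>c::'k::{alg_closed_field, field_char_0}. [:[:c:]:]) (map_poly pderiv) pderiv
     [:[:-\<rho>, 1:]:] [:[:-\<sigma>:], 1:]"
proof -
  interpret D: derivation "pderiv :: 'k poly \<Rightarrow> 'k poly" by (rule derivation_pderiv)
  interpret D1: derivation "map_poly (pderiv :: 'k poly \<Rightarrow> 'k poly)" by (rule D.map_poly_derivation)
  interpret D2: derivation "pderiv :: 'k poly poly \<Rightarrow> 'k poly poly" by (rule derivation_pderiv)
  show ?thesis
  proof
    show "\<exists>c p q. h = [:[:c:]:] + [:[:-\<rho>, 1:]:] * p + [:[:-\<sigma>:], 1:] * q" for h :: "'k poly poly"
      using pp_decompose by blast
    have map_pCons: "map_poly pderiv (pCons a q) = pCons (pderiv a) (map_poly pderiv q)"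
      for a and q :: "'k poly poly"
      by (intro poly_eqI) (auto simp: coeff_map_poly coeff_pCons split: nat.splits)
    show "map_poly pderiv [:[:c:]:] = 0" "map_poly pderiv [:[:-\<rho>, 1:]:] = 1"
      "map_poly pderiv [:[:-\<sigma>:], 1:] = 0" for c :: 'k
      by (simp_all add: map_pCons pderiv_pCons pCons_one)
  next
    fix c p q assume "[:[:c:]:] = [:[:-\<rho>, 1:]:] * p + [:[:-\<sigma>:], 1:] * q"
    then have "pp_eval [:[:c:]:] \<rho> \<sigma> = pp_eval ([:[:-\<rho>, 1:]:] * p + [:[:-\<sigma>:], 1:] * q) \<rho> \<sigma>" by simp
    then show "c = 0" by (simp del: mult_pCons_left)
  qed (simp_all add: pCons_one pderiv_pCons)
qed

text \<open>A proper ideal Q would have a zero; the eliminant p bounds its first coordinate to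
  finitely many values, and the unit leading coefficient does the same for the second. That zero is
  a singular point, where g lies in (gX, gY) + m^N. A polynomial T nonvanishing there multiplies m^N
  into (gX, gY), so T * g is in (gX, gY) and T is in Q, a contradiction.\<close>

theorem affine_quartic_gradient:
  fixes g :: "'k::{alg_closed_field, field_char_0} poly poly"
  assumes p: "p \<noteq> 0" "[:p:] = u0 * map_poly pderiv g + v0 * pderiv g"
    and lc: "lead_coeff (pderiv g) dvd 1"
    and filt: "\<And>\<rho> \<sigma>. g \<in> plane_point.filt (\<lambda>c. [:[:c:]:]) [:[:-\<rho>, 1:]:] [:[:-\<sigma>:], 1:] 4"
    and line: "\<And>l m n. l \<noteq> 0 \<or> m \<noteq> 0 \<Longrightarrow> \<not> [:[:n, l:], [:m:]:] dvd g"
  shows "\<exists>r u v. g - r * g\<^sup>2 = u * map_poly pderiv g + v * pderiv g"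
proof -
  define gX where "gX = map_poly pderiv g"
  define gY where "gY = pderiv g"
  \<comment> \<open>The sum of the colon ideal (gX, gY) : g and of (g). From 1 = s + r g with s in
    the colon ideal, multiplication by g gives the claim.\<close>
  define Q where "Q = {s + r * g |s r. \<exists>u v. s * g = u * gX + v * gY}"
  have QI: "s + r * g \<in> Q" if "s * g = u * gX + v * gY" for s r u v
    using that unfolding Q_def by blast
  have Q: "ring_ideal Q"
    unfolding ring_ideal_def
  proof (intro conjI ballI allI)
    show "0 \<in> Q" using QI[of 0 0 0 0] by simp
    fix x assume "x \<in> Q"
    then obtain s r u v where x: "x = s + r * g" "s * g = u * gX + v * gY" by (auto simp: Q_def)
    show "t * x \<in> Q" for t
    proof -
      have "(t * s) * g = (t * u) * gX + (t * v) * gY"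
        using x(2) by (simp add: mult.assoc distrib_left)
      from QI[OF this, of "t * r"] show ?thesis by (simp add: x(1) algebra_simps)
    qed
    fix y assume "y \<in> Q"
    then obtain s' r' u' v' where y: "y = s' + r' * g" "s' * g = u' * gX + v' * gY" by (auto simp: Q_def)
    have "(s + s') * g = (u + u') * gX + (v + v') * gY"
      using x(2) y(2) by (simp add: algebra_simps)
    from QI[OF this, of "r + r'"] show "x + y \<in> Q" by (simp add: x(1) y(1) algebra_simps)
  qed
  have g_Q: "g \<in> Q" using QI[of 0 0 0 1] by simp
  have gX_Q: "gX \<in> Q" using QI[of gX g 0 0] by (simp add: mult.commute)
  have gY_Q: "gY \<in> Q" using QI[of gY 0 g 0] by (simp add: mult.commute)
  have "1 \<in> Q"
  proof (rule ccontr)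
    assume proper: "1 \<notin> Q"
    define \<kappa> where "\<kappa> c = [:[:c:]:]" for c :: 'k
    interpret \<kappa>: comm_ring_hom \<kappa> by unfold_locales (simp_all add: \<kappa>_def pCons_one)
    have lift_X: "poly_lift \<kappa> [:[:0, 1:]:] r = [:r:]" for r
    proof (induction r)
      case (pCons c r)
      have "poly_lift \<kappa> [:[:0, 1:]:] (pCons c r) = \<kappa> c + [:[:0, 1:]:] * [:r:]"
        by (simp only: \<kappa>.poly_lift_pCons pCons.IH)
      also have "\<dots> = [:pCons c r:]" by (simp add: \<kappa>_def)
      finally show ?case .
    qed simp
    have "[:p:] \<in> Q"
      unfolding p(2) gX_def[symmetric] gY_def[symmetric]
      by (intro ring_idealD[OF Q] gX_Q gY_Q)
    then obtain \<rho> where \<rho>: "1 \<notin> {w + ([:[:0, 1:]:] - \<kappa> \<rho>) * s |w s. w \<in> Q}"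
      using proper_ideal_root[OF \<kappa>.comm_ring_hom_axioms Q proper, of "[:[:0, 1:]:]" p] p(1)
      unfolding lift_X by blast
    define \<xi> where "\<xi> = [:[:- \<rho>, 1:]:]"
    define Q1 where "Q1 = {w + \<xi> * s |w s. w \<in> Q}"
    have \<xi>': "[:[:0, 1:]:] - \<kappa> \<rho> = \<xi>" by (simp add: \<kappa>_def \<xi>_def)
    have Q1: "ring_ideal Q1" "1 \<notin> Q1"
      unfolding Q1_def \<xi>'[symmetric] by (rule ring_ideal_insert[OF Q]) (rule \<rho>)
    \<comment> \<open>The restriction of gY to the line X = \<rho>. It is nonzero because the
      leading coefficient of gY, a unit, does not vanish at \<rho>.\<close>
    define m where "m = map_poly (\<lambda>q. poly q \<rho>) gY"
    have lift_Y: "poly_lift \<kappa> [:0, 1:] r = map_poly (\<lambda>c. [:c:]) r" for r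
    proof (induction r)
      case (pCons c r)
      have "poly_lift \<kappa> [:0, 1:] (pCons c r) = \<kappa> c + [:0, 1:] * map_poly (\<lambda>c. [:c:]) r"
        by (simp only: \<kappa>.poly_lift_pCons pCons.IH)
      also have "\<dots> = map_poly (\<lambda>c. [:c:]) (pCons c r)"
        using pCons.hyps by (auto simp: \<kappa>_def map_poly_pCons)
      finally show ?case .
    qed simp
    have "[:- \<rho>, 1:] dvd q - [:poly q \<rho>:]" for q
      unfolding poly_eq_0_iff_dvd[symmetric] by simp
    moreover have "poly.coeff (gY - map_poly (\<lambda>c. [:c:]) m) n =
        poly.coeff gY n - [:poly (poly.coeff gY n) \<rho>:]" for n
      by (simp add: coeff_map_poly m_def)
    ultimately have "\<xi> dvd gY - map_poly (\<lambda>c. [:c:]) m"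
      unfolding \<xi>_def const_poly_dvd_iff by metis
    then obtain t where t: "gY = map_poly (\<lambda>c. [:c:]) m + \<xi> * t" by (auto simp: dvd_def algebra_simps)
    have "gY + \<xi> * (- t) \<in> Q1" unfolding Q1_def using gY_Q by blast
    then have m_Q1: "poly_lift \<kappa> [:0, 1:] m \<in> Q1" unfolding lift_Y using t by simp
    have "m \<noteq> 0"
    proof -
      obtain c where "1 = lead_coeff gY * c" using lc by (auto simp: dvd_def gY_def)
      then have "poly (lead_coeff gY) \<rho> * poly c \<rho> = 1" by (metis poly_1 poly_mult)
      then have "poly.coeff m (degree gY) \<noteq> 0" by (auto simp: m_def coeff_map_poly)
      then show ?thesis by auto
    qed
    obtain \<sigma> where \<sigma>: "1 \<notin> {w + ([:0, 1:] - \<kappa> \<sigma>) * s |w s. w \<in> Q1}"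
      using proper_ideal_root[OF \<kappa>.comm_ring_hom_axioms Q1 m_Q1 \<open>m \<noteq> 0\<close>] by blast
    define \<eta> where "\<eta> = [:[:- \<sigma>:], 1:]"
    define Q2 where "Q2 = {w + \<eta> * s |w s. w \<in> Q1}"
    have \<eta>': "[:0, 1:] - \<kappa> \<sigma> = \<eta>" by (simp add: \<kappa>_def \<eta>_def)
    have Q2: "ring_ideal Q2" "1 \<notin> Q2"
      unfolding Q2_def \<eta>'[symmetric] by (rule ring_ideal_insert[OF Q1(1)]) (rule \<sigma>)
    have vanish: "pp_eval w \<rho> \<sigma> = 0" if "w \<in> Q" for w
    proof (rule ccontr)
      assume nz: "pp_eval w \<rho> \<sigma> \<noteq> 0"
      obtain p q where w: "w = \<kappa> (pp_eval w \<rho> \<sigma>) + \<xi> * p + \<eta> * q"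
        using pp_decompose[of w \<sigma> \<rho>] unfolding \<kappa>_def \<xi>_def \<eta>_def by blast
      have "w + \<xi> * (- p) \<in> Q1" unfolding Q1_def using that by blast
      then have "(w + \<xi> * (- p)) + \<eta> * (- q) \<in> Q2" unfolding Q2_def by blast
      also have "(w + \<xi> * (- p)) + \<eta> * (- q) = \<kappa> (pp_eval w \<rho> \<sigma>)"
        using w by (simp add: algebra_simps)
      finally have "\<kappa> (inverse (pp_eval w \<rho> \<sigma>)) * \<kappa> (pp_eval w \<rho> \<sigma>) \<in> Q2"
        by (rule ring_idealD(3)[OF Q2(1)])
      then show False using nz Q2(2) by (simp add: \<kappa>.hom_mult[symmetric])
    qed
    interpret P: plane_point "\<lambda>c. [:[:c:]:]" "map_poly pderiv" pderiv \<xi> \<eta>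
      unfolding \<xi>_def \<eta>_def by (rule plane_point_affine)
    have mpow_1: "w \<in> P.mpow 1" if "w \<in> Q" for w
    proof -
      obtain p q where "w = \<kappa> (pp_eval w \<rho> \<sigma>) + \<xi> * p + \<eta> * q"
        using pp_decompose[of w \<sigma> \<rho>] unfolding \<kappa>_def \<xi>_def \<eta>_def by blast
      then have "w = \<xi> * p + \<eta> * q" using vanish[OF that] by (simp add: \<kappa>.hom_zero)
      then show ?thesis unfolding P.mpow_1_iff by blast
    qed
    have free: "P.line_free g"
      unfolding P.line_free_def
    proof (intro allI impI)
      fix l k :: 'k assume "l \<noteq> 0 \<or> k \<noteq> 0"
      moreover have "[:[:l:]:] * \<xi> + [:[:k:]:] * \<eta> = [:[:- (l * \<rho> + k * \<sigma>), l:], [:k:]:]"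
        by (simp add: \<xi>_def \<eta>_def)
      ultimately show "\<not> [:[:l:]:] * \<xi> + [:[:k:]:] * \<eta> dvd g"
        by (simp only: line) simp
    qed
    obtain p1 i where p1: "p = [:- \<rho>, 1:] ^ i * p1" "poly p1 \<rho> \<noteq> 0"
      using order_decomp[OF p(1), of \<rho>] by (auto simp: poly_eq_0_iff_dvd)
    obtain m1 j where m1: "m = [:- \<sigma>, 1:] ^ j * m1" "poly m1 \<sigma> \<noteq> 0"
      using order_decomp[OF \<open>m \<noteq> 0\<close>, of \<sigma>] by (auto simp: poly_eq_0_iff_dvd)
    interpret cl: comm_ring_hom "\<lambda>c::'k. [:c:]" by unfold_locales (simp_all add: pCons_one)
    interpret mc: map_poly_comm_ring_hom "\<lambda>c::'k. [:c:]" ..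
    have const_mult: "[:x * y:] = [:x:] * [:y:]" for x y :: "'k poly" by simp
    have const_power: "[:x ^ n:] = [:x:] ^ n" for x :: "'k poly" and n
      by (induction n) (simp add: pCons_one, simp only: power_Suc const_mult)
    define m2 where "m2 = map_poly (\<lambda>c. [:c:]) m1"
    have mm: "map_poly (\<lambda>c. [:c:]) m = \<eta> ^ j * m2"
      unfolding m1(1) mc.hom_mult mc.hom_power m2_def by (simp add: map_poly_pCons \<eta>_def pCons_one)
    have pp: "[:p:] = \<xi> ^ i * [:p1:]"
      unfolding p1(1) const_mult const_power \<xi>_def by (rule refl)
    \<comment> \<open>T collects the parts of p and m that do not vanish at the point. By
      construction T \<xi>^i lies in (gX, gY), and T \<eta>^(j i) does by the i-th power of a
      congruence for \<eta>^j; N is the sum of these exponents, as \<open>mpow_coord_powers\<close>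
      requires.\<close>
    define T where "T = [:p1:] * m2 ^ i"
    define N where "N = i + j * i"
    have T_xi: "\<exists>u v. T * \<xi> ^ i = u * gX + v * gY"
    proof -
      have "T * \<xi> ^ i = m2 ^ i * [:p:]" unfolding pp by (simp add: T_def mult_ac del: mult_pCons_left mult_pCons_right)
      also have "\<dots> = (m2 ^ i * u0) * gX + (m2 ^ i * v0) * gY"
        unfolding p(2) gX_def gY_def by (simp add: algebra_simps)
      finally show ?thesis by blast
    qed
    have T_eta: "\<exists>u v. T * \<eta> ^ (j * i) = u * gX + v * gY"
    proof -
      \<comment> \<open>Modulo gY the product of \<eta>^j and \<open>m2\<close> equals - \<xi> t.
        Its i-th power thus contains \<xi>^i, which \<open>p1\<close> completes to p.\<close>
      have "\<eta> ^ j * m2 - (- (\<xi> * t)) dvd (\<eta> ^ j * m2) ^ i - (- (\<xi> * t)) ^ i"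
        by (metis power_diff_sumr2 dvd_triv_left)
      then obtain w where w: "(\<eta> ^ j * m2) ^ i - (- (\<xi> * t)) ^ i = gY * w"
        using t mm by (auto simp: dvd_def)
      have "T * \<eta> ^ (j * i) = [:p1:] * (\<eta> ^ j * m2) ^ i"
        by (simp only: T_def power_mult[of \<eta> j i] power_mult_distrib mult.assoc mult.commute[of "m2 ^ i"])
      also have "\<dots> = [:p1:] * (gY * w + (- t) ^ i * \<xi> ^ i)"
        by (simp add: w[symmetric] power_mult_distrib[symmetric] mult.commute
            del: mult_pCons_left mult_pCons_right)
      also have "\<dots> = [:p1:] * w * gY + (- t) ^ i * [:p:]"
        unfolding pp by (simp add: algebra_simps del: mult_pCons_left mult_pCons_right)
      also have "\<dots> = ((- t) ^ i * u0) * gX + ([:p1:] * w + (- t) ^ i * v0) * gY"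
        unfolding p(2) gX_def gY_def by (simp add: algebra_simps del: mult_pCons_left mult_pCons_right)
      finally show ?thesis by blast
    qed
    have "g \<in> P.near gX gY N"
      unfolding gX_def gY_def
      using mpow_1[OF g_Q] mpow_1[OF gX_Q] mpow_1[OF gY_Q] free
        filt[of \<rho> \<sigma>, folded \<xi>_def \<eta>_def]
      by (intro P.quartic_near_gradient) (simp_all only: gX_def gY_def)
    then obtain u v e where e: "g = u * gX + v * gY + e" "e \<in> P.mpow N" by (auto simp: P.near_def)
    obtain x y where xy: "e = x * \<xi> ^ i + y * \<eta> ^ (j * i)"
      using P.mpow_coord_powers[of e i "j * i"] e(2) by (auto simp: N_def)
    obtain u1 v1 where u1: "T * \<xi> ^ i = u1 * gX + v1 * gY" using T_xi by blast
    obtain u2 v2 where u2: "T * \<eta> ^ (j * i) = u2 * gX + v2 * gY" using T_eta by blast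
    have "T * g = (T * u) * gX + (T * v) * gY + x * (T * \<xi> ^ i) + y * (T * \<eta> ^ (j * i))"
      by (subst e(1)) (simp add: xy algebra_simps)
    also have "\<dots> = (T * u + x * u1 + y * u2) * gX + (T * v + x * v1 + y * v2) * gY"
      unfolding u1 u2 by (simp add: algebra_simps)
    finally have "T + 0 * g \<in> Q" by (rule QI)
    then have "pp_eval T \<rho> \<sigma> = 0" using vanish by simp
    moreover have "poly m2 [:\<sigma>:] = [:poly m1 \<sigma>:]"
      unfolding m2_def by (induction m1) (simp_all add: map_poly_pCons)
    then have "pp_eval T \<rho> \<sigma> = poly p1 \<rho> * poly m1 \<sigma> ^ i"
      by (simp add: T_def del: mult_pCons_left)
    ultimately show False using p1(2) m1(2) by simp
  qed
  then obtain s r u v where "1 = s + r * g" "s * g = u * gX + v * gY" by (auto simp: Q_def)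
  then have "s = 1 - r * g" by (simp add: eq_diff_eq)
  with \<open>s * g = _\<close> have "(1 - r * g) * g = u * gX + v * gY" by simp
  moreover have "(1 - r * g) * g = g - r * g\<^sup>2" by (simp add: algebra_simps power2_eq_square)
  ultimately have "g - r * g\<^sup>2 = u * gX + v * gY" by simp
  then show ?thesis unfolding gX_def gY_def by blast
qed

section \<open>Derivatives and homogeneous polynomials\<close>

lemma mpderiv_superset:
  assumes "finite K" "keys p \<subseteq> K"
  shows "mpderiv v p = (\<Sum>\<mu>\<in>K. Poly_Mapping.single (\<mu> - Poly_Mapping.single v 1)
    (of_nat (lookup \<mu> v) * lookup p \<mu>))"
  unfolding mpderiv_def using assms by (intro sum.mono_neutral_left) (auto simp: in_keys_iff)

lemma mpderiv_add: "mpderiv v (p + q) = mpderiv v p + mpderiv v q"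
proof -
  let ?K = "keys p \<union> keys q"
  have "keys (p + q) \<subseteq> ?K" by (rule keys_add)
  then show ?thesis
    by (simp add: mpderiv_superset[of ?K] lookup_add distrib_left single_add sum.distrib)
qed

lemma mpderiv_single:
  "mpderiv v (Poly_Mapping.single \<mu> c) =
    Poly_Mapping.single (\<mu> - Poly_Mapping.single v 1) (of_nat (lookup \<mu> v) * c)"
  by (cases "c = 0") (simp_all add: mpderiv_def)

lemma derivation_mpderiv: "derivation (mpderiv v)"
proof
  fix p q :: "('a, 'b) mpoly"
  show "mpderiv v (p + q) = mpderiv v p + mpderiv v q" for p q by (rule mpderiv_add)
  \<comment> \<open>Subtraction of exponents is truncated, so the identity needs v to occur in
    \<mu>; otherwise the coefficient of the derivative is 0 anyway.\<close>
  have shift: "\<mu> - Poly_Mapping.single v 1 + \<nu> = \<mu> + \<nu> - Poly_Mapping.single v (1::nat)"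
    if "lookup \<mu> v \<noteq> 0" for \<mu> \<nu> :: "'a \<Rightarrow>\<^sub>0 nat"
    using that by (intro poly_mapping_eqI) (auto simp: lookup_add lookup_minus lookup_single when_def)
  show "mpderiv v (p * q) = mpderiv v p * q + p * mpderiv v q"
  proof (induction p rule: mpoly_single_induct)
    case p: (single \<mu> c)
    show ?case
    proof (induction q rule: mpoly_single_induct)
      case (single \<nu> d)
      have "Poly_Mapping.single (\<mu> - Poly_Mapping.single v 1 + \<nu>) (of_nat (lookup \<mu> v) * c * d) =
          Poly_Mapping.single (\<mu> + \<nu> - Poly_Mapping.single v 1) (of_nat (lookup \<mu> v) * c * d)"
        using shift[of \<mu> \<nu>] by (cases "lookup \<mu> v = 0") simp_all
      moreover have "Poly_Mapping.single (\<mu> + (\<nu> - Poly_Mapping.single v 1)) (c * (of_nat (lookup \<nu> v) * d)) =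
          Poly_Mapping.single (\<mu> + \<nu> - Poly_Mapping.single v 1) (c * (of_nat (lookup \<nu> v) * d))"
        using shift[of \<nu> \<mu>] by (cases "lookup \<nu> v = 0") (simp_all add: add.commute)
      ultimately show ?case
        by (simp add: mult_single mpderiv_single lookup_add single_add[symmetric] algebra_simps)
    qed (simp add: mpderiv_add distrib_left)
  qed (simp add: mpderiv_add distrib_right)
qed

lemma mpderiv_mconst [simp]: "mpderiv v (mconst c) = 0"
  by (simp add: mconst_def mpderiv_single)

lemma mpderiv_mvar: "mpderiv v (mvar w) = (if v = w then 1 else 0)"
  by (auto simp: mvar_def mpderiv_single lookup_single)

lemma UNIV_3: "(UNIV :: 3 set) = {0, 1, 2}"
proof -
  have "x = 0 \<or> x = 1 \<or> x = 2" for x :: 3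
  proof (induct x)
    case (of_int z)
    then have "0 \<le> z" "z < 3" by simp_all
    then have "z = 0 \<or> z = 1 \<or> z = 2" by arith
    then show ?case by auto
  qed
  then show ?thesis by blast
qed

lemma sum_UNIV_3: "(\<Sum>i\<in>UNIV. f i) = f (0::3) + f 1 + f 2"
proof -
  have "(0::3) \<noteq> 1" "(0::3) \<noteq> 2" "(1::3) \<noteq> 2" by simp_all
  then show ?thesis unfolding UNIV_3 by (subst sum.insert; simp add: add.assoc)+
qed

lemma mpoly_eval_chain_rule:
  fixes \<kappa> :: "'a::comm_ring_1 \<Rightarrow> 'b::comm_ring_1" and L :: "'v::finite \<Rightarrow> 'b"
  assumes "comm_ring_hom \<kappa>" "derivation D" "\<And>c. D (\<kappa> c) = 0"
  shows "D (mpoly_eval \<kappa> L w) = (\<Sum>i\<in>UNIV. D (L i) * mpoly_eval \<kappa> L (mpderiv i w))"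
proof -
  interpret \<kappa>: comm_ring_hom \<kappa> by fact
  interpret h: comm_ring_hom "mpoly_eval \<kappa> L" by (rule \<kappa>.comm_ring_hom_mpoly_eval)
  interpret D: derivation D by fact
  interpret md: derivation "mpderiv i :: ('v, 'a) mpoly \<Rightarrow> ('v, 'a) mpoly" for i by (rule derivation_mpderiv)
  show ?thesis
  proof (induction w rule: mpoly_induct)
    case (var v)
    have "mpoly_eval \<kappa> L (mpderiv i (mvar v)) = (if i = v then 1 else 0)" for i
      by (simp add: mpderiv_mvar)
    then show ?case by (simp add: if_distrib[of "(*) _"] cong: if_cong)
  next
    case (mult p q)
    then show ?case
      by (simp add: D.mult md.mult h.hom_add h.hom_mult distrib_left sum.distrib sum_distrib_left
          sum_distrib_right mult_ac)
  qed (simp_all add: assms(3) D.add md.add h.hom_add distrib_left sum.distrib)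
qed

lemma hom_mpoly_eval:
  assumes "comm_ring_hom \<sigma>" "comm_ring_hom h"
  shows "\<sigma> (mpoly_eval h x w) = mpoly_eval (\<lambda>c. \<sigma> (h c)) (\<lambda>i. \<sigma> (x i)) w"
proof -
  interpret \<sigma>: comm_ring_hom \<sigma> by fact
  show ?thesis by (simp add: mpoly_eval_def \<sigma>.hom_sum \<sigma>.hom_mult \<sigma>.hom_prod \<sigma>.hom_power)
qed

lemma mpoly_eval_homogeneous:
  fixes x :: "'v::finite \<Rightarrow> 'b::comm_ring_1"
  assumes "homogeneous d w"
  shows "mpoly_eval \<kappa> (\<lambda>i. t * x i) w = t ^ d * mpoly_eval \<kappa> x w"
proof -
  have "mon_eval (\<lambda>i. t * x i) \<mu> = t ^ d * mon_eval x \<mu>" if "\<mu> \<in> keys w" for \<mu>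
    using assms that
    by (auto simp: mon_eval_superset[of UNIV] power_mult_distrib prod.distrib power_sum[symmetric] homogeneous_def)
  then show ?thesis
    by (simp add: mpoly_eval_def mon_eval_def[symmetric] sum_distrib_left mult_ac)
qed

lemma homogeneous_mpderiv:
  assumes "homogeneous (Suc d) w"
  shows "homogeneous d (mpderiv v w)"
  unfolding homogeneous_def
proof
  fix \<nu> assume "\<nu> \<in> keys (mpderiv v w)"
  then have "lookup (mpderiv v w) \<nu> \<noteq> 0" by (simp add: in_keys_iff)
  then obtain \<mu> where \<mu>: "\<mu> \<in> keys w"
    "lookup (Poly_Mapping.single (\<mu> - Poly_Mapping.single v 1)
      (of_nat (lookup \<mu> v) * lookup w \<mu>)) \<nu> \<noteq> 0"
    unfolding mpderiv_def lookup_sum by (metis (mono_tags, lifting) sum.neutral)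
  then have \<nu>: "\<nu> = \<mu> - Poly_Mapping.single v 1"
    and "of_nat (lookup \<mu> v) * lookup w \<mu> \<noteq> 0"
    by (auto simp: lookup_single when_def split: if_splits)
  then have nz: "lookup \<mu> v \<noteq> 0" by (metis mult_zero_left of_nat_0)
  have "\<mu> = \<nu> + Poly_Mapping.single v 1"
    using nz by (intro poly_mapping_eqI) (auto simp: \<nu> lookup_add lookup_minus lookup_single when_def)
  then have "(\<Sum>u\<in>UNIV. lookup \<mu> u) = (\<Sum>u\<in>UNIV. lookup \<nu> u) + 1"
    by (simp add: lookup_add sum.distrib lookup_single when_def)
  then show "(\<Sum>u\<in>UNIV. lookup \<nu> u) = d"
    using assms \<mu>(1) by (simp add: homogeneous_def)
qed

lemma euler_identity:
  assumes "homogeneous d (w :: ('v::finite, 'a::comm_ring_1) mpoly)"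
  shows "(\<Sum>i\<in>UNIV. mvar i * mpderiv i w) = of_nat d * w"
proof -
  have single: "(\<Sum>i\<in>UNIV. mvar i * mpderiv i (Poly_Mapping.single \<mu> c)) = of_nat d * Poly_Mapping.single \<mu> c"
    if "(\<Sum>v\<in>UNIV. lookup \<mu> v) = d" for \<mu> :: "'v \<Rightarrow>\<^sub>0 nat" and c :: 'a
  proof -
    have "mvar i * mpderiv i (Poly_Mapping.single \<mu> c) = of_nat (lookup \<mu> i) * Poly_Mapping.single \<mu> c" for i
    proof (cases "lookup \<mu> i = 0")
      case False
      then have "Poly_Mapping.single i 1 + (\<mu> - Poly_Mapping.single i 1) = \<mu>"
        by (intro poly_mapping_eqI) (auto simp: lookup_add lookup_minus lookup_single when_def)
      moreover have "of_nat n * Poly_Mapping.single \<mu> c = Poly_Mapping.single \<mu> (of_nat n * c)" for n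
        by (induction n) (simp_all add: distrib_right single_add)
      ultimately show ?thesis by (simp add: mvar_def mpderiv_single mult_single)
    qed (simp add: mpderiv_single)
    then show ?thesis using that by (simp add: sum_distrib_right[symmetric] flip: of_nat_sum)
  qed
  interpret D: derivation "mpderiv i :: ('v, 'a) mpoly \<Rightarrow> ('v, 'a) mpoly" for i by (rule derivation_mpderiv)
  have D_sum: "mpderiv i (sum g K) = (\<Sum>x\<in>K. mpderiv i (g x))"
    for i and g :: "('v \<Rightarrow>\<^sub>0 nat) \<Rightarrow> ('v, 'a) mpoly" and K
    by (induction K rule: infinite_finite_induct) (simp_all add: D.add)
  let ?s = "\<lambda>\<mu>. Poly_Mapping.single \<mu> (lookup w \<mu>)"
  have "(\<Sum>i\<in>UNIV. mvar i * mpderiv i w) = (\<Sum>i\<in>UNIV. mvar i * mpderiv i (\<Sum>\<mu>\<in>keys w. ?s \<mu>))"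
    by (simp add: sum_singles[symmetric])
  also have "\<dots> = (\<Sum>\<mu>\<in>keys w. \<Sum>i\<in>UNIV. mvar i * mpderiv i (?s \<mu>))"
    by (subst sum.swap) (simp add: D_sum sum_distrib_left)
  also have "\<dots> = (\<Sum>\<mu>\<in>keys w. of_nat d * ?s \<mu>)"
    using assms by (intro sum.cong refl single) (simp add: homogeneous_def)
  also have "\<dots> = of_nat d * w" by (simp add: sum_distrib_left[symmetric] sum_singles[symmetric])
  finally show ?thesis .
qed

section \<open>Linear coordinates on the projective plane\<close>

text \<open>The ring \<open>'k poly poly poly\<close> is $k[X][Z][Y]$, with \<open>Y\<close> the outermost variable, and
  \<open>'k poly poly\<close> is either $k[X][Z]$ or $k[X][Y]$.\<close>

abbreviation (input) kS :: "'k::comm_ring_1 \<Rightarrow> 'k poly poly poly" where "kS c \<equiv> [:[:[:c:]:]:]"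
abbreviation (input) XS :: "'k::comm_ring_1 poly poly poly" where "XS \<equiv> [:[:[:0, 1:]:]:]"
abbreviation (input) ZS :: "'k::comm_ring_1 poly poly poly" where "ZS \<equiv> [:[:0, 1:]:]"
abbreviation (input) YS :: "'k::comm_ring_1 poly poly poly" where "YS \<equiv> [:0, 1:]"
abbreviation (input) kA :: "'k::comm_ring_1 \<Rightarrow> 'k poly poly" where "kA c \<equiv> [:[:c:]:]"
abbreviation (input) XA :: "'k::comm_ring_1 poly poly" where "XA \<equiv> [:[:0, 1:]:]"
abbreviation (input) YA :: "'k::comm_ring_1 poly poly" where "YA \<equiv> [:0, 1:]"

text \<open>A linear change of coordinates that sends (0 : 1 : 0) to (\<alpha> : 1 : \<gamma>) for
  every \<zeta>. The parameter \<zeta> moves the line z = 0 in the pencil of lines through that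
  point.\<close>

definition coords :: "('k \<Rightarrow> 'b::comm_ring_1) \<Rightarrow> 'k \<Rightarrow> 'k \<Rightarrow> 'k \<Rightarrow> 'b \<Rightarrow> 'b \<Rightarrow> 'b \<Rightarrow> 3 \<Rightarrow> 'b" where
  "coords \<kappa> \<alpha> \<gamma> \<zeta> x y z i =
     (if i = 0 then x + \<kappa> \<alpha> * y else if i = 1 then y else \<kappa> \<zeta> * x + \<kappa> \<gamma> * y + z)"

lemma coords_simps [simp]:
  "coords \<kappa> \<alpha> \<gamma> \<zeta> x y z 0 = x + \<kappa> \<alpha> * y"
  "coords \<kappa> \<alpha> \<gamma> \<zeta> x y z 1 = y"
  "coords \<kappa> \<alpha> \<gamma> \<zeta> x y z 2 = \<kappa> \<zeta> * x + \<kappa> \<gamma> * y + z"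
  by (simp_all add: coords_def)

lemma comm_ring_hom_comp: "comm_ring_hom g \<Longrightarrow> comm_ring_hom h \<Longrightarrow> comm_ring_hom (\<lambda>x. g (h x))"
proof -
  assume "comm_ring_hom g" "comm_ring_hom h"
  then interpret g: comm_ring_hom g + h: comm_ring_hom h .
  show ?thesis by unfold_locales (simp_all add: g.hom_add h.hom_add g.hom_mult h.hom_mult)
qed

lemma comm_ring_hom_pCons: "comm_ring_hom (\<lambda>c::'a::comm_ring_1. [:c:])"
  by unfold_locales (simp_all add: pCons_one)

lemma comm_ring_hom_kA: "comm_ring_hom (\<lambda>c::'a::comm_ring_1. kA c)"
  by unfold_locales (simp_all add: pCons_one)

lemma comm_ring_hom_kS: "comm_ring_hom (\<lambda>c::'a::comm_ring_1. kS c)"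
  by unfold_locales (simp_all add: pCons_one)

text \<open>The variable Y is outermost because the quartic will be monic in it up to a scalar, so
  division in Y is possible and elimination of Y takes place over the factorial ring
  k[X][Z].\<close>

definition \<Theta> :: "'k::comm_ring_1 \<Rightarrow> 'k \<Rightarrow> 'k \<Rightarrow> (3, 'k) mpoly \<Rightarrow> 'k poly poly poly" where
  "\<Theta> \<alpha> \<gamma> \<zeta> = mpoly_eval (\<lambda>c. kS c) (coords (\<lambda>c. kS c) \<alpha> \<gamma> \<zeta> XS YS ZS)"

lemma comm_ring_hom_\<Theta>: "comm_ring_hom (\<Theta> \<alpha> \<gamma> \<zeta>)"
  unfolding \<Theta>_def by (rule comm_ring_hom.comm_ring_hom_mpoly_eval[OF comm_ring_hom_kS])

text \<open>Reduces every comparison of specialisations to evaluations of the same form at two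
  coordinate triples, to which \<open>coords_scale\<close> applies.\<close>

lemma hom_\<Theta>:
  assumes "comm_ring_hom \<sigma>"
  shows "\<sigma> (\<Theta> \<alpha> \<gamma> \<zeta> w) = mpoly_eval (\<lambda>c. \<sigma> (kS c)) (coords (\<lambda>c. \<sigma> (kS c)) \<alpha> \<gamma> \<zeta> (\<sigma> XS) (\<sigma> YS) (\<sigma> ZS)) w"
proof -
  interpret \<sigma>: comm_ring_hom \<sigma> by fact
  have "\<sigma> (coords (\<lambda>c. kS c) \<alpha> \<gamma> \<zeta> XS YS ZS i) = coords (\<lambda>c. \<sigma> (kS c)) \<alpha> \<gamma> \<zeta> (\<sigma> XS) (\<sigma> YS) (\<sigma> ZS) i" for i
    unfolding coords_def by (simp only: \<sigma>.hom_add \<sigma>.hom_mult split: if_split) simp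
  then show ?thesis unfolding \<Theta>_def hom_mpoly_eval[OF assms comm_ring_hom_kS] by simp
qed

lemma S_hom_eqI:
  assumes h: "comm_ring_hom h" "comm_ring_hom h'"
    and "\<And>c. h (kS c) = h' (kS c)" "h XS = h' XS" "h ZS = h' ZS" "h YS = h' YS"
  shows "h p = h' (p :: 'k::comm_ring_1 poly poly poly)"
proof (rule poly_hom_eqI[OF h])
  fix q
  note h1 = comm_ring_hom_comp[OF _ comm_ring_hom_pCons]
  have "h [:q:] = h' [:q:]"
  proof (rule poly_hom_eqI[OF h1[OF h(1)] h1[OF h(2)]])
    fix r
    show "h [:[:r:]:] = h' [:[:r:]:]"
      by (rule poly_hom_eqI[OF h1[OF h1[OF h(1)]] h1[OF h1[OF h(2)]]]) (use assms in simp_all)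
  qed (use assms in simp)
  then show "h [:q:] = h' [:q:]" .
qed (use assms in simp)

definition \<Theta>_inv :: "'k::comm_ring_1 \<Rightarrow> 'k \<Rightarrow> 'k \<Rightarrow> 'k poly poly poly \<Rightarrow> (3, 'k) mpoly" where
  "\<Theta>_inv \<alpha> \<gamma> \<zeta> = (let x = mvar 0 - mconst \<alpha> * mvar 1; y = mvar 1;
     z = mvar 2 - mconst \<zeta> * x - mconst \<gamma> * y
   in poly_lift (poly_lift (poly_lift mconst x) z) y)"

lemma comm_ring_hom_\<Theta>_inv: "comm_ring_hom (\<Theta>_inv \<alpha> \<gamma> \<zeta>)"
  unfolding \<Theta>_inv_def Let_def
  by (intro comm_ring_hom.comm_ring_hom_poly_lift comm_ring_hom_mconst)

lemma \<Theta>_inv_gens: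
  "\<Theta>_inv \<alpha> \<gamma> \<zeta> (kS c) = mconst c"
  "\<Theta>_inv \<alpha> \<gamma> \<zeta> XS = mvar 0 - mconst \<alpha> * mvar 1"
  "\<Theta>_inv \<alpha> \<gamma> \<zeta> YS = mvar 1"
  "\<Theta>_inv \<alpha> \<gamma> \<zeta> ZS = mvar 2 - mconst \<zeta> * (mvar 0 - mconst \<alpha> * mvar 1) - mconst \<gamma> * mvar 1"
proof -
  note h1 = comm_ring_hom.comm_ring_hom_poly_lift
  note l1 = comm_ring_hom.poly_lift_pCons comm_ring_hom.poly_lift_0
  note m = comm_ring_hom_mconst
  show "\<Theta>_inv \<alpha> \<gamma> \<zeta> (kS c) = mconst c" "\<Theta>_inv \<alpha> \<gamma> \<zeta> XS = mvar 0 - mconst \<alpha> * mvar 1"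
    "\<Theta>_inv \<alpha> \<gamma> \<zeta> YS = mvar 1"
    "\<Theta>_inv \<alpha> \<gamma> \<zeta> ZS = mvar 2 - mconst \<zeta> * (mvar 0 - mconst \<alpha> * mvar 1) - mconst \<gamma> * mvar 1"
    unfolding \<Theta>_inv_def Let_def pCons_one[symmetric]
    by (simp_all add: l1[OF m] l1[OF h1[OF m]] l1[OF h1[OF h1[OF m]]] del: pCons_one One_nat_def)
qed

lemma \<Theta>_inv_\<Theta>: "\<Theta>_inv \<alpha> \<gamma> \<zeta> (\<Theta> \<alpha> \<gamma> \<zeta> w) = w"
proof -
  have "coords mconst \<alpha> \<gamma> \<zeta> (mvar 0 - mconst \<alpha> * mvar 1) (mvar 1)
      (mvar 2 - mconst \<zeta> * (mvar 0 - mconst \<alpha> * mvar 1) - mconst \<gamma> * mvar 1) i = mvar i" for i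
  proof -
    have "i \<in> {0, 1, 2}" using UNIV_3 by blast
    then show ?thesis by (auto simp: algebra_simps)
  qed
  then have "coords mconst \<alpha> \<gamma> \<zeta> (mvar 0 - mconst \<alpha> * mvar 1) (mvar 1)
      (mvar 2 - mconst \<zeta> * (mvar 0 - mconst \<alpha> * mvar 1) - mconst \<gamma> * mvar 1) = mvar" by (rule ext)
  then show ?thesis
    unfolding hom_\<Theta>[OF comm_ring_hom_\<Theta>_inv] \<Theta>_inv_gens by (simp add: mpoly_eval_mconst_mvar)
qed

lemma \<Theta>_gens:
  "\<Theta> \<alpha> \<gamma> \<zeta> (mconst c) = kS c" "\<Theta> \<alpha> \<gamma> \<zeta> (mvar i) = coords (\<lambda>c. kS c) \<alpha> \<gamma> \<zeta> XS YS ZS i"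
  unfolding \<Theta>_def using comm_ring_hom.mpoly_eval_mconst[OF comm_ring_hom_kS]
    comm_ring_hom.mpoly_eval_mvar[OF comm_ring_hom_kS] by metis+

lemma add_add_diff_diff_cancel: "x + y + z - x - y = (z :: 'a::ab_group_add)"
  by simp

lemma \<Theta>_\<Theta>_inv: "\<Theta> \<alpha> \<gamma> \<zeta> (\<Theta>_inv \<alpha> \<gamma> \<zeta> p) = p"
proof -
  interpret T: comm_ring_hom "\<Theta> \<alpha> \<gamma> \<zeta>" by (rule comm_ring_hom_\<Theta>)
  have "comm_ring_hom (\<lambda>p :: 'a poly poly poly. p)" by unfold_locales simp_all
  then show ?thesis
    by (rule S_hom_eqI[OF comm_ring_hom_comp[OF comm_ring_hom_\<Theta> comm_ring_hom_\<Theta>_inv]])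
      (simp_all only: \<Theta>_inv_gens T.hom_minus T.hom_mult \<Theta>_gens coords_simps add_diff_cancel_right'
        add_add_diff_diff_cancel)
qed

lemma \<Theta>_irreducible:
  fixes w :: "(3, 'k::field) mpoly"
  assumes "Factorial_Ring.irreducible w"
  shows "Factorial_Ring.irreducible (\<Theta> \<alpha> \<gamma> \<zeta> w)"
proof -
  interpret T: comm_ring_hom "\<Theta> \<alpha> \<gamma> \<zeta>" by (rule comm_ring_hom_\<Theta>)
  interpret I: comm_ring_hom "\<Theta>_inv \<alpha> \<gamma> \<zeta>" by (rule comm_ring_hom_\<Theta>_inv)
  have unit: "\<Theta>_inv \<alpha> \<gamma> \<zeta> p dvd 1 \<Longrightarrow> p dvd 1" for p
    using T.hom_dvd[of "\<Theta>_inv \<alpha> \<gamma> \<zeta> p" 1] by (simp add: \<Theta>_\<Theta>_inv)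
  show ?thesis
  proof (rule Factorial_Ring.irreducibleI)
    show "\<Theta> \<alpha> \<gamma> \<zeta> w \<noteq> 0"
      using \<Theta>_inv_\<Theta>[of \<alpha> \<gamma> \<zeta> w] assms by (metis I.hom_zero not_irreducible_zero)
    show "\<not> \<Theta> \<alpha> \<gamma> \<zeta> w dvd 1"
      using I.hom_dvd[of "\<Theta> \<alpha> \<gamma> \<zeta> w" 1] assms by (auto simp: \<Theta>_inv_\<Theta> irreducible_not_unit)
    fix p q assume "\<Theta> \<alpha> \<gamma> \<zeta> w = p * q"
    then have "w = \<Theta>_inv \<alpha> \<gamma> \<zeta> p * \<Theta>_inv \<alpha> \<gamma> \<zeta> q" by (metis I.hom_mult \<Theta>_inv_\<Theta>)
    then show "p dvd 1 \<or> q dvd 1" using assms unit by (metis irreducibleD)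
  qed
qed

text \<open>A degree bound instead of a degree: c may be 0, so the notion survives sums and is
  multiplicative.\<close>

definition top_coeff :: "'k::idom poly poly poly \<Rightarrow> nat \<Rightarrow> 'k \<Rightarrow> bool" where
  "top_coeff P n c \<longleftrightarrow> degree P \<le> n \<and> poly.coeff P n = [:[:c:]:]"

lemma top_coeff_mult: "top_coeff P m c \<Longrightarrow> top_coeff Q n d \<Longrightarrow> top_coeff (P * Q) (m + n) (c * d)"
proof -
  assume P: "top_coeff P m c" and Q: "top_coeff Q n d"
  have "poly.coeff P i * poly.coeff Q (m + n - i) = (if i = m then poly.coeff P m * poly.coeff Q n else 0)"
    if "i \<le> m + n" for i
  proof (cases i m rule: linorder_cases)
    case less
    then have "degree Q < m + n - i" using Q by (auto simp: top_coeff_def)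
    with less show ?thesis by (simp add: coeff_eq_0)
  next
    case greater
    then have "degree P < i" using P by (auto simp: top_coeff_def)
    with greater show ?thesis by (simp add: coeff_eq_0)
  qed simp
  then have "poly.coeff (P * Q) (m + n) = poly.coeff P m * poly.coeff Q n"
    by (simp add: coeff_mult)
  moreover have "degree (P * Q) \<le> m + n"
    using P Q degree_mult_le[of P Q] by (auto simp: top_coeff_def)
  ultimately show ?thesis using P Q by (simp add: top_coeff_def)
qed

lemma top_coeff_power: "top_coeff P m c \<Longrightarrow> top_coeff (P ^ n) (n * m) (c ^ n)"
proof (induction n)
  case 0
  then show ?case by (simp add: top_coeff_def pCons_one)
next
  case (Suc n)
  then show ?case using top_coeff_mult[of P m c "P ^ n" "n * m" "c ^ n"] by simp
qed

lemma top_coeff_add: "top_coeff P n c \<Longrightarrow> top_coeff Q n d \<Longrightarrow> top_coeff (P + Q) n (c + d)"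
  by (simp add: top_coeff_def degree_add_le)

text \<open>The coefficient of Y^d in a form of degree d is its value at (0 : 1 : 0), as one sees on
  linear forms and then on products of them.\<close>

lemma top_coeff_\<Theta>:
  fixes w :: "(3, 'k::idom) mpoly"
  assumes "homogeneous d w"
  shows "top_coeff (\<Theta> \<alpha> \<gamma> \<zeta> w) d (mpoly_eval id (coords id \<alpha> \<gamma> \<zeta> 0 1 0) w)"
proof -
  define L where "L = coords (\<lambda>c. kS c) \<alpha> \<gamma> \<zeta> XS YS ZS"
  define l where "l = coords id \<alpha> \<gamma> \<zeta> 0 1 (0::'k)"
  have lin: "top_coeff (L i) 1 (l i)" for i
  proof -
    have "i \<in> {0, 1, 2}" using UNIV_3 by blast
    then show ?thesis by (auto simp: top_coeff_def pCons_one L_def l_def)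
  qed
  have mon: "top_coeff (mon_eval L \<mu>) d (mon_eval l \<mu>)" if "(\<Sum>v\<in>UNIV. lookup \<mu> v) = d" for \<mu>
  proof -
    have "top_coeff (\<Prod>v\<in>K. L v ^ lookup \<mu> v) (\<Sum>v\<in>K. lookup \<mu> v)
        (\<Prod>v\<in>K. l v ^ lookup \<mu> v)" for K
    proof (induction K rule: infinite_finite_induct)
      case (insert v K)
      show ?case
        using top_coeff_mult[OF top_coeff_power[OF lin, of v "lookup \<mu> v"] insert.IH]
        by (simp only: prod.insert[OF insert.hyps] sum.insert[OF insert.hyps] mult_1_right)
    qed (simp_all add: top_coeff_def pCons_one)
    from this[of UNIV] show ?thesis using that by (simp add: mon_eval_superset[of UNIV])
  qed
  have "top_coeff (\<Sum>\<mu>\<in>K. kS (lookup w \<mu>) * mon_eval L \<mu>) d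
      (\<Sum>\<mu>\<in>K. lookup w \<mu> * mon_eval l \<mu>)" if "K \<subseteq> keys w" for K
    using that
  proof (induction K rule: infinite_finite_induct)
    case (insert \<mu> K)
    then have "top_coeff (mon_eval L \<mu>) d (mon_eval l \<mu>)" using assms by (intro mon) (auto simp: homogeneous_def)
    then have "top_coeff (kS (lookup w \<mu>) * mon_eval L \<mu>) d (lookup w \<mu> * mon_eval l \<mu>)"
      using top_coeff_mult[of "kS (lookup w \<mu>)" 0 "lookup w \<mu>" "mon_eval L \<mu>" d]
      by (simp add: top_coeff_def)
    then show ?case using insert by (simp add: top_coeff_add)
  qed (simp_all add: top_coeff_def)
  from this[OF subset_refl] show ?thesis
    by (simp only: \<Theta>_def mpoly_eval_def mon_eval_def[symmetric] L_def[symmetric] l_def[symmetric] id_apply)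
qed

lemma poly_nonroot:
  fixes P :: "'b::idom poly" and \<kappa> :: "'k::field_char_0 \<Rightarrow> 'b"
  assumes "P \<noteq> 0" "inj \<kappa>" "finite A"
  obtains c where "c \<notin> A" "poly P (\<kappa> c) \<noteq> 0"
proof -
  have "finite {c. poly P (\<kappa> c) = 0}"
    using finite_vimageI[OF poly_roots_finite[OF assms(1)] assms(2)] by (simp add: vimage_def)
  then have "finite (A \<union> {c. poly P (\<kappa> c) = 0})" using assms(3) by simp
  then have "A \<union> {c. poly P (\<kappa> c) = 0} \<noteq> UNIV" using infinite_UNIV_char_0[where 'a = 'k] by metis
  then show ?thesis using that by blast
qed

lemma homogeneous_add: "homogeneous d p \<Longrightarrow> homogeneous d q \<Longrightarrow> homogeneous d (p + q)"
  using keys_add[of p q] by (auto simp: homogeneous_def)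

lemma homogeneous_mconst_mult: "homogeneous d p \<Longrightarrow> homogeneous d (mconst c * p)"
proof -
  have "keys (mconst c * p) \<subseteq> keys p"
    using keys_mult[of "mconst c" p] by (auto simp: mconst_def split: if_splits)
  then show "homogeneous d p \<Longrightarrow> ?thesis" by (auto simp: homogeneous_def)
qed

text \<open>The derivatives along the new coordinates X and Y; along Z the derivative is
  \<open>mpderiv 2\<close>.\<close>

definition dX :: "'k::comm_ring_1 \<Rightarrow> (3, 'k) mpoly \<Rightarrow> (3, 'k) mpoly" where
  "dX \<zeta> w = mpderiv 0 w + mconst \<zeta> * mpderiv 2 w"

definition dY :: "'k::comm_ring_1 \<Rightarrow> 'k \<Rightarrow> (3, 'k) mpoly \<Rightarrow> (3, 'k) mpoly" where
  "dY \<alpha> \<gamma> w = mconst \<alpha> * mpderiv 0 w + mpderiv 1 w + mconst \<gamma> * mpderiv 2 w"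

lemma homogeneous_dX: "homogeneous (Suc d) w \<Longrightarrow> homogeneous d (dX \<zeta> w)"
  and homogeneous_dY: "homogeneous (Suc d) w \<Longrightarrow> homogeneous d (dY \<alpha> \<gamma> w)"
  unfolding dX_def dY_def by (intro homogeneous_add homogeneous_mconst_mult homogeneous_mpderiv; assumption)+

lemma coords_chain_rule:
  fixes \<kappa> :: "'k::comm_ring_1 \<Rightarrow> 'b::comm_ring_1" and x y z :: 'b and \<alpha> \<gamma> \<zeta> :: 'k
  assumes \<kappa>: "comm_ring_hom \<kappa>" and D: "derivation D" "\<And>c. D (\<kappa> c) = 0"
  defines "ev \<equiv> mpoly_eval \<kappa> (coords \<kappa> \<alpha> \<gamma> \<zeta> x y z)"
  shows "D (ev w) = D x * ev (dX \<zeta> w) + D y * ev (dY \<alpha> \<gamma> w) + D z * ev (mpderiv 2 w)"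
proof -
  interpret \<kappa>: comm_ring_hom \<kappa> by fact
  interpret D: derivation D by fact
  interpret ev: comm_ring_hom ev unfolding ev_def by (rule \<kappa>.comm_ring_hom_mpoly_eval)
  have "ev (mconst c) = \<kappa> c" for c by (simp add: ev_def)
  then show ?thesis
    unfolding dX_def dY_def ev.hom_add ev.hom_mult
    using mpoly_eval_chain_rule[OF \<kappa> D, of "coords \<kappa> \<alpha> \<gamma> \<zeta> x y z" w, folded ev_def]
    by (simp add: sum_UNIV_3 D.add D.mult D(2) algebra_simps)
qed

lemma coords_euler:
  fixes \<kappa> :: "'k::comm_ring_1 \<Rightarrow> 'b::comm_ring_1" and x y z :: 'b and \<alpha> \<gamma> \<zeta> :: 'k
  assumes \<kappa>: "comm_ring_hom \<kappa>" and w: "homogeneous d w"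
  defines "ev \<equiv> mpoly_eval \<kappa> (coords \<kappa> \<alpha> \<gamma> \<zeta> x y z)"
  shows "of_nat d * ev w = x * ev (dX \<zeta> w) + y * ev (dY \<alpha> \<gamma> w) + z * ev (mpderiv 2 w)"
proof -
  interpret \<kappa>: comm_ring_hom \<kappa> by fact
  interpret ev: comm_ring_hom ev unfolding ev_def by (rule \<kappa>.comm_ring_hom_mpoly_eval)
  have ev: "ev (mconst c) = \<kappa> c" "ev (mvar i) = coords \<kappa> \<alpha> \<gamma> \<zeta> x y z i" for c i
    by (simp_all add: ev_def)
  have of_nat: "ev (of_nat n) = of_nat n" for n
    by (induction n) (simp_all add: ev.hom_add)
  have "of_nat d * ev w = ev (\<Sum>i\<in>UNIV. mvar i * mpderiv i w)"
    by (simp add: euler_identity[OF w] ev.hom_mult of_nat)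
  also have "\<dots> = x * ev (dX \<zeta> w) + y * ev (dY \<alpha> \<gamma> w) + z * ev (mpderiv 2 w)"
    by (simp add: sum_UNIV_3 dX_def dY_def ev.hom_add ev.hom_mult ev algebra_simps)
  finally show ?thesis .
qed

text \<open>Besides homogeneity this uses that \<zeta> and z enter only through \<zeta> x + z. Hence
  \<zeta> may change along with z, which moves the line Z = 0 to another line of the pencil.\<close>

lemma coords_scale:
  assumes "homogeneous d w" "x' = t * x" "y' = t * y" "\<kappa> \<zeta>' * x' + z' = t * (\<kappa> \<zeta> * x + z)"
  shows "mpoly_eval \<kappa> (coords \<kappa> \<alpha> \<gamma> \<zeta>' x' y' z') w = t ^ d * mpoly_eval \<kappa> (coords \<kappa> \<alpha> \<gamma> \<zeta> x y z) w"
proof -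
  have "\<kappa> \<zeta>' * x' + \<kappa> \<gamma> * y' + z' = t * (\<kappa> \<zeta> * x + \<kappa> \<gamma> * y + z)"
    using assms(4) by (simp add: assms(3) algebra_simps)
  then have "coords \<kappa> \<alpha> \<gamma> \<zeta>' x' y' z' = (\<lambda>i. t * coords \<kappa> \<alpha> \<gamma> \<zeta> x y z i)"
    by (intro ext) (simp add: coords_def assms(2,3) algebra_simps)
  then show ?thesis using mpoly_eval_homogeneous[OF assms(1)] by simp
qed

lemma (in plane_point) mpoly_eval_filt:
  fixes L :: "'v::finite \<Rightarrow> 'a"
  assumes w: "homogeneous d w" and L: "\<And>i. L i \<in> filt 1"
  shows "mpoly_eval \<kappa> L w \<in> filt d"
proof -
  have "mon_eval L \<mu> \<in> filt d" if "(\<Sum>v\<in>UNIV. lookup \<mu> v) = d" for \<mu>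
  proof -
    have "(\<Prod>v\<in>K. L v ^ lookup \<mu> v) \<in> filt (\<Sum>v\<in>K. lookup \<mu> v)" for K
    proof (induction K rule: infinite_finite_induct)
      case (insert v K)
      show ?case
        unfolding prod.insert[OF insert.hyps] sum.insert[OF insert.hyps]
        by (intro filt_mult filt_power L insert.IH)
    qed (use filt_const[of 1 0] in simp_all)
    from this[of UNIV] show ?thesis using that by (simp add: mon_eval_superset[of UNIV])
  qed
  then have mon: "\<kappa> (lookup w \<mu>) * mon_eval L \<mu> \<in> filt d" if "\<mu> \<in> keys w" for \<mu>
    using w that by (intro filt_scale) (auto simp: homogeneous_def)
  have "(\<Sum>\<mu>\<in>K. \<kappa> (lookup w \<mu>) * mon_eval L \<mu>) \<in> filt d" if "K \<subseteq> keys w" for K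
    using that
  proof (induction K rule: infinite_finite_induct)
    case (insert \<mu> K)
    then show ?case using mon by (simp add: filt_add)
  qed (use filt_const[of 0 d] in simp_all)
  from this[OF subset_refl] show ?thesis by (simp add: mpoly_eval_def mon_eval_def)
qed

section \<open>Specialisation to the affine chart and to lines\<close>

definition subst2 :: "'k::comm_ring_1 poly \<Rightarrow> 'k poly \<Rightarrow> 'k poly poly \<Rightarrow> 'k poly" where
  "subst2 u v = poly_lift (poly_lift (\<lambda>c. [:c:]) u) v"

lemma comm_ring_hom_subst2: "comm_ring_hom (subst2 u v)"
  unfolding subst2_def by (intro comm_ring_hom.comm_ring_hom_poly_lift comm_ring_hom_pCons)

lemma subst2_gens:
  "subst2 u v [:[:c:]:] = [:c:]" "subst2 u v [:[:0, 1:]:] = u" "subst2 u v [:0, 1:] = v"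
proof -
  note h1 = comm_ring_hom.comm_ring_hom_poly_lift
  note l1 = comm_ring_hom.poly_lift_pCons comm_ring_hom.poly_lift_0
  note m = comm_ring_hom_pCons
  show "subst2 u v [:[:c:]:] = [:c:]" "subst2 u v [:[:0, 1:]:] = u" "subst2 u v [:0, 1:] = v"
    unfolding subst2_def pCons_one[symmetric]
    by (simp_all add: l1[OF m] l1[OF h1[OF m]] del: pCons_one)
qed

lemma comm_ring_hom_poly: "comm_ring_hom (\<lambda>p. poly p (x::'a::comm_ring_1))"
  by unfold_locales simp_all

lemma pp_hom_eqI:
  assumes h: "comm_ring_hom h" "comm_ring_hom h'"
    and "\<And>c. h [:[:c:]:] = h' [:[:c:]:]" "h [:[:0, 1:]:] = h' [:[:0, 1:]:]" "h [:0, 1:] = h' [:0, 1:]"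
  shows "h p = h' (p :: 'k::comm_ring_1 poly poly)"
proof (rule poly_hom_eqI[OF h])
  fix q
  note h1 = comm_ring_hom_comp[OF _ comm_ring_hom_pCons]
  show "h [:q:] = h' [:q:]"
    by (rule poly_hom_eqI[OF h1[OF h(1)] h1[OF h(2)]]) (use assms in simp_all)
qed (use assms in simp)

lemma poly_subst2: "poly (subst2 u v D) x = poly (poly D [:poly v x:]) (poly u x)"
  by (rule pp_hom_eqI[OF comm_ring_hom_comp[OF comm_ring_hom_poly comm_ring_hom_subst2]
        comm_ring_hom_comp[OF comm_ring_hom_poly comm_ring_hom_poly]]; simp only: subst2_gens; simp)

text \<open>X goes to u, Z to v and Y to t Y. The two uses are t (X, Y, 1), which dehomogenises, and
  (x0 X, x0 Y, z0 X), which restricts to the line Z = (z0 / x0) X; both rescale Y so that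
  homogeneity applies.\<close>

definition substA :: "'k::comm_ring_1 poly \<Rightarrow> 'k poly \<Rightarrow> 'k \<Rightarrow> 'k poly poly poly \<Rightarrow> 'k poly poly" where
  "substA u v t = poly_lift (\<lambda>q. [:subst2 u v q:]) (kA t * YA)"

lemma comm_ring_hom_substA: "comm_ring_hom (substA u v t)"
  unfolding substA_def
  by (intro comm_ring_hom.comm_ring_hom_poly_lift comm_ring_hom_comp[OF comm_ring_hom_pCons] comm_ring_hom_subst2)

lemma substA_gens:
  "substA u v t [:q:] = [:subst2 u v q:]" "substA u v t YS = kA t * YA"
proof -
  have h: "comm_ring_hom (\<lambda>q. [:subst2 u v q:])"
    by (intro comm_ring_hom_comp[OF comm_ring_hom_pCons] comm_ring_hom_subst2)
  interpret h: comm_ring_hom "\<lambda>q. [:subst2 u v q:]" by fact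
  show "substA u v t [:q:] = [:subst2 u v q:]" "substA u v t YS = kA t * YA"
    unfolding substA_def h.poly_lift_pCons h.poly_lift_0 using h.hom_zero h.hom_one by simp_all
qed

lemma substA_\<Theta>:
  "substA u v t (\<Theta> \<alpha> \<gamma> \<zeta> w) = mpoly_eval (\<lambda>c. kA c) (coords (\<lambda>c. kA c) \<alpha> \<gamma> \<zeta> [:u:] (kA t * YA) [:v:]) w"
  unfolding hom_\<Theta>[OF comm_ring_hom_substA] substA_gens subst2_gens ..

text \<open>The value 1 gives the affine chart and 0 the line at infinity Z = 0.\<close>

definition evZ :: "'k::comm_ring_1 \<Rightarrow> 'k poly poly poly \<Rightarrow> 'k poly poly" where
  "evZ c = map_poly (\<lambda>q. poly q [:c:])"

lemma comm_ring_hom_evZ: "comm_ring_hom (evZ c)"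
proof -
  interpret h: comm_ring_hom "\<lambda>q. poly q [:c:]" by (rule comm_ring_hom_poly)
  interpret mp: map_poly_comm_ring_hom "\<lambda>q. poly q [:c:]" ..
  show ?thesis unfolding evZ_def by (rule mp.comm_ring_hom_axioms)
qed

lemma coeff_evZ [simp]: "poly.coeff (evZ c P) n = poly (poly.coeff P n) [:c:]"
  by (simp add: evZ_def coeff_map_poly)

lemma evZ_const: "evZ c [:q:] = [:poly q [:c:]:]" and evZ_Y: "evZ c YS = YA"
  by (intro poly_eqI; simp add: coeff_pCons split: nat.splits)+

lemma evZ_\<Theta>: "evZ c (\<Theta> \<alpha> \<gamma> \<zeta> w) = mpoly_eval (\<lambda>c. kA c) (coords (\<lambda>c. kA c) \<alpha> \<gamma> \<zeta> XA YA (kA c)) w"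
proof -
  have "evZ c (kS x) = kA x" "evZ c XS = XA" "evZ c ZS = kA c" for x
    unfolding evZ_const by simp_all
  then show ?thesis unfolding hom_\<Theta>[OF comm_ring_hom_evZ] evZ_Y by simp
qed

lemma degree_evZ_le: "degree (evZ c P) \<le> degree P"
  unfolding evZ_def by (rule degree_map_poly_le)

text \<open>The point (\<alpha> : 1 : \<gamma>) is off the curve, so the coefficient \<omega> of Y^4
  is a nonzero scalar. The condition is independent of \<zeta>, which stays free for the choice of
  the line Z = 0.\<close>

locale quartic_chart =
  fixes f :: "(3, 'k::{alg_closed_field, field_char_0}) mpoly" and \<alpha> \<gamma> \<zeta> :: 'k
  assumes hom4: "homogeneous 4 f" and irr: "Factorial_Ring.irreducible f"
    and nonzero: "mpoly_eval id (coords id \<alpha> \<gamma> \<zeta> 0 1 0) f \<noteq> 0"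
begin

definition \<omega> :: 'k where "\<omega> = mpoly_eval id (coords id \<alpha> \<gamma> \<zeta> 0 1 0) f"
definition F where "F = \<Theta> \<alpha> \<gamma> \<zeta> f"
definition a where "a = \<Theta> \<alpha> \<gamma> \<zeta> (dX \<zeta> f)"
definition b where "b = \<Theta> \<alpha> \<gamma> \<zeta> (dY \<alpha> \<gamma> f)"
definition c where "c = \<Theta> \<alpha> \<gamma> \<zeta> (mpderiv 2 f)"

lemma hom3: "homogeneous 3 (dX \<zeta> f)" "homogeneous 3 (dY \<alpha> \<gamma> f)" "homogeneous 3 (mpderiv 2 f)"
  using hom4 by (auto intro!: homogeneous_dX homogeneous_dY homogeneous_mpderiv simp: eval_nat_numeral)

lemma \<omega>_nz: "\<omega> \<noteq> 0"
  using nonzero by (simp add: \<omega>_def)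

lemma degree_F: "degree F = 4" and coeff_F: "poly.coeff F 4 = [:[:\<omega>:]:]"
proof -
  have *: "top_coeff F 4 \<omega>" unfolding F_def \<omega>_def by (rule top_coeff_\<Theta>[OF hom4])
  then show "poly.coeff F 4 = [:[:\<omega>:]:]" by (simp add: top_coeff_def)
  then have "poly.coeff F 4 \<noteq> 0" using \<omega>_nz by simp
  then show "degree F = 4" using * le_degree[of F 4] by (simp add: top_coeff_def)
qed

lemma degree_b: "degree b = 3" and coeff_b: "poly.coeff b 3 = [:[:4 * \<omega>:]:]"
proof -
  \<comment> \<open>At (0 : 1 : 0) only the Y-term of Euler's identity survives.\<close>
  have "of_nat 4 * \<omega> = mpoly_eval id (coords id \<alpha> \<gamma> \<zeta> 0 1 0) (dY \<alpha> \<gamma> f)"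
    using coords_euler[OF comm_ring_hom_id hom4, of \<alpha> \<gamma> \<zeta> 0 1 0] by (simp add: \<omega>_def)
  then have *: "top_coeff b 3 (4 * \<omega>)"
    using top_coeff_\<Theta>[OF hom3(2), of \<alpha> \<gamma> \<zeta>] by (simp add: b_def)
  then show "poly.coeff b 3 = [:[:4 * \<omega>:]:]" by (simp add: top_coeff_def)
  then have "poly.coeff b 3 \<noteq> 0" using \<omega>_nz by simp
  then show "degree b = 3" using * le_degree[of b 3] by (simp add: top_coeff_def)
qed

lemma const_dvd_1: "x \<noteq> 0 \<Longrightarrow> [:[:x::'k:]:] dvd 1" "x \<noteq> 0 \<Longrightarrow> [:x:] dvd 1"
  by (rule dvdI[of _ _ "[:[:inverse x:]:]"], simp add: pCons_one)
     (rule dvdI[of _ _ "[:inverse x:]"], simp add: pCons_one)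

lemma lead_coeff_b: "lead_coeff b dvd 1"
  using \<omega>_nz by (simp add: degree_b coeff_b const_dvd_1)

lemma evZ_b: "degree (evZ x b) = 3" "lead_coeff (evZ x b) dvd 1"
proof -
  have *: "poly.coeff (evZ x b) 3 = [:4 * \<omega>:]" by (simp add: coeff_b)
  then have "poly.coeff (evZ x b) 3 \<noteq> 0" using \<omega>_nz by simp
  then show "degree (evZ x b) = 3"
    using degree_evZ_le[of x b] le_degree[of "evZ x b" 3] by (simp add: degree_b)
  then show "lead_coeff (evZ x b) dvd 1" using * \<omega>_nz by (simp add: const_dvd_1)
qed

lemma irreducible_F: "Factorial_Ring.irreducible F"
  unfolding F_def by (rule \<Theta>_irreducible[OF irr])

lemma pderiv_F: "pderiv F = b"
proof -
  have "pderiv (\<Theta> \<alpha> \<gamma> \<zeta> f) =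
     pderiv XS * \<Theta> \<alpha> \<gamma> \<zeta> (dX \<zeta> f) + pderiv YS * \<Theta> \<alpha> \<gamma> \<zeta> (dY \<alpha> \<gamma> f) + pderiv ZS * \<Theta> \<alpha> \<gamma> \<zeta> (mpderiv 2 f)"
    unfolding \<Theta>_def by (rule coords_chain_rule[OF comm_ring_hom_kS derivation_pderiv]) (simp add: pderiv_pCons)
  then show ?thesis by (simp add: F_def b_def pderiv_pCons)
qed

lemma evZ_1_derivs: "map_poly pderiv (evZ 1 F) = evZ 1 a" "pderiv (evZ 1 F) = evZ 1 b"
proof -
  interpret P: plane_point "\<lambda>c::'k. [:[:c:]:]" "map_poly pderiv" pderiv "[:[:-0, 1:]:]" "[:[:-0:], 1:]"
    by (rule plane_point_affine)
  have 1: "map_poly pderiv XA = (1 :: 'k poly poly)" "map_poly pderiv YA = (0 :: 'k poly poly)"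
    "map_poly pderiv (kA 1) = (0 :: 'k poly poly)"
    "pderiv XA = (0 :: 'k poly poly)" "pderiv YA = (1 :: 'k poly poly)" "pderiv (kA 1) = (0 :: 'k poly poly)"
    using P.D_coord P.D_const[of 1] by simp_all
  show "map_poly pderiv (evZ 1 F) = evZ 1 a" "pderiv (evZ 1 F) = evZ 1 b"
    unfolding F_def a_def b_def evZ_\<Theta>
      coords_chain_rule[OF comm_ring_hom_kA P.D1.derivation_axioms P.D_const(1)]
      coords_chain_rule[OF comm_ring_hom_kA P.D2.derivation_axioms P.D_const(2)] 1
    by simp_all
qed

lemma evZ_euler: "4 * evZ x F = XA * evZ x a + YA * evZ x b + kA x * evZ x c"
  using coords_euler[OF comm_ring_hom_kA hom4, of \<alpha> \<gamma> \<zeta> XA YA "kA x"]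
  by (simp only: F_def a_def b_def c_def evZ_\<Theta> of_nat_numeral)

text \<open>A vertical line would divide the constant coefficient of Y^4. Any other line is the
  graph of some \<beta>(X); homogenised, it becomes a linear factor of F in Y, against
  irreducibility and degree 4.\<close>

lemma no_line:
  assumes "l \<noteq> 0 \<or> m \<noteq> 0"
  shows "\<not> [:[:n, l:], [:m:]:] dvd evZ 1 F"
proof
  assume dvd: "[:[:n, l:], [:m:]:] dvd evZ 1 F"
  show False
  proof (cases "m = 0")
    case True
    then have "[:[:n, l:]:] dvd evZ 1 F" using dvd by simp
    then have "[:n, l:] dvd poly.coeff (evZ 1 F) 4" unfolding const_poly_dvd_iff by blast
    then have "[:n, l:] dvd [:\<omega>:]" by (simp add: coeff_F)
    then have "degree [:n, l:] \<le> degree [:\<omega>:]" using \<omega>_nz by (intro dvd_imp_degree_le) simp_all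
    then show False using assms True by simp
  next
    case False
    define \<beta> where "\<beta> = [:- n / m, - l / m:]"
    have "poly [:[:n, l:], [:m:]:] \<beta> = 0" using False by (simp add: \<beta>_def)
    then have root: "poly (evZ 1 F) \<beta> = 0"
      using dvd by (elim dvdE) (simp only: poly_mult mult_zero_left)
    \<comment> \<open>The homogenisation of \<beta> with respect to Z.\<close>
    define y where "y = [:[:0, - l / m:], [:- n / m:]:]"
    have "poly F y = 0"
    proof (rule ccontr)
      assume "poly F y \<noteq> 0"
      have "inj (\<lambda>c::'k. [:c:])" by (rule injI) simp
      \<comment> \<open>If F(y) is not zero, it has a nonzero value at some (x, t) with t nonzero.
        The maps T and \<open>T'\<close> below evaluate at that point and at its multiple with last
        coordinate 1, where F vanishes by assumption.\<close>
      with \<open>poly F y \<noteq> 0\<close> obtain t where t: "t \<noteq> 0" "poly (poly F y) [:t:] \<noteq> 0"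
        using poly_nonroot[of "poly F y" "\<lambda>c. [:c:]" "{0}"] by auto
      obtain x where x: "poly (poly (poly F y) [:t:]) x \<noteq> 0"
        using poly_nonroot[OF t(2), of id "{}"] by auto
      define T where "T p = poly (poly (poly p y) [:t:]) x" for p
      have T: "comm_ring_hom T"
        unfolding T_def
        by (rule comm_ring_hom_comp[OF comm_ring_hom_poly comm_ring_hom_comp[OF comm_ring_hom_poly comm_ring_hom_poly]])
      have T_gens: "T (kS s) = s" "T XS = x" "T ZS = t" "T YS = - (l / m) * x - n / m * t" for s
        by (simp_all add: T_def y_def)
      define T' where "T' p = poly (poly (evZ 1 p) \<beta>) (x / t)" for p
      have T': "comm_ring_hom T'"
        unfolding T'_def
        by (rule comm_ring_hom_comp[OF comm_ring_hom_poly comm_ring_hom_comp[OF comm_ring_hom_poly comm_ring_hom_evZ]])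
      have T'_gens: "T' (kS s) = s" "T' XS = x / t" "T' ZS = 1" "T' YS = - (l / m) * (x / t) - n / m" for s
        by (simp_all add: T'_def \<beta>_def evZ_const evZ_Y[unfolded pCons_one] mult_ac)
      have "T F = t ^ 4 * T' F"
        unfolding F_def hom_\<Theta>[OF T] hom_\<Theta>[OF T'] T_gens T'_gens
        by (rule coords_scale[OF hom4]) (use t(1) in \<open>simp_all add: field_simps\<close>)
      also have "T' F = 0" using root by (simp add: T'_def)
      finally show False using x by (simp add: T_def)
    qed
    then obtain W where W: "F = [:- y, 1:] * W" unfolding poly_eq_0_iff_dvd by (auto elim: dvdE)
    moreover have "\<not> [:- y, 1:] dvd 1" using dvd_imp_degree_le[of "[:- y, 1:]" 1] by auto
    ultimately have "W dvd 1" using irreducibleD[OF irreducible_F W] by blast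
    then have "degree W = 0" using dvd_imp_degree_le[of W 1] by auto
    moreover have "W \<noteq> 0" using W degree_F by auto
    then have "degree F = degree [:- y, 1:] + degree W" unfolding W by (intro degree_mult_eq) simp_all
    ultimately show False using degree_F by simp
  qed
qed

lemma filt_F: "evZ 1 F \<in> plane_point.filt (\<lambda>c. [:[:c:]:]) [:[:-\<rho>, 1:]:] [:[:-\<sigma>:], 1:] 4"
proof -
  define \<xi> where "\<xi> = [:[:-\<rho>, 1:]:]"
  define \<eta> where "\<eta> = [:[:-\<sigma>:], 1:]"
  interpret P: plane_point "\<lambda>c::'k. [:[:c:]:]" "map_poly pderiv" pderiv \<xi> \<eta>
    unfolding \<xi>_def \<eta>_def by (rule plane_point_affine)
  have X: "XA = kA \<rho> + \<xi> * kA 1 + \<eta> * kA 0" and Y: "YA = kA \<sigma> + \<xi> * kA 0 + \<eta> * kA 1"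
    by (simp_all add: \<xi>_def \<eta>_def pCons_one)
  have k: "kA x \<in> P.filt n" for x n by (rule P.filt_const)
  have XY: "XA \<in> P.filt 1" "YA \<in> P.filt 1"
    unfolding One_nat_def by (subst X, intro P.filt_SucI k) (subst Y, intro P.filt_SucI k)
  have "coords (\<lambda>c. kA c) \<alpha> \<gamma> \<zeta> XA YA (kA 1) i \<in> P.filt 1" for i
  proof -
    have "i \<in> {0, 1, 2}" using UNIV_3 by blast
    then show ?thesis
      by (elim insertE emptyE; simp only: coords_simps; intro P.filt_add P.filt_scale XY k)
  qed
  then show ?thesis
    unfolding F_def evZ_\<Theta> \<xi>_def[symmetric] \<eta>_def[symmetric] by (intro P.mpoly_eval_filt[OF hom4])
qed

end

section \<open>A line in general position\<close>

text \<open>The lines through a fixed point off the curve are parametrized by \<open>\<zeta>'\<close>; an eliminant of \<open>f\<close> and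
  its derivative towards that point has a non-root, and the line belonging to it is transversal.\<close>

lemma (in quartic_chart) exists_chart_change:
  assumes \<zeta>: "\<zeta> = 0"
  obtains \<zeta>' r U V where "r \<noteq> 0"
    "[:r:] = U * evZ 0 (\<Theta> \<alpha> \<gamma> \<zeta>' (dX \<zeta>' f)) + V * evZ 0 (\<Theta> \<alpha> \<gamma> \<zeta>' (dY \<alpha> \<gamma> f))"
proof -
  \<comment> \<open>An irreducible F could share a factor of positive degree in Y with its
    derivative only by dividing it, which the degrees 4 and 3 forbid.\<close>
  have "degree P = 0" if P: "P dvd F" "P dvd pderiv F" for P
  proof -
    obtain W where W: "F = P * W" using P(1) by (auto elim: dvdE)
    then have "P dvd 1 \<or> W dvd 1" using irreducibleD[OF irreducible_F] by blast
    then show ?thesis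
    proof
      assume "P dvd 1"
      then show ?thesis using dvd_imp_degree_le[of P 1] by auto
    next
      assume "W dvd 1"
      then obtain W' where W': "1 = W * W'" by (auto elim: dvdE)
      then have "P = F * W'" using W by (metis mult.assoc mult.right_neutral)
      then have "F dvd b" using P(2) by (metis dvd_mult_left pderiv_F)
      then have "degree F \<le> degree b" using degree_b by (intro dvd_imp_degree_le) auto
      then show ?thesis by (simp add: degree_F degree_b)
    qed
  qed
  then obtain D U V where D: "D \<noteq> 0" "[:D:] = U * F + V * b"
    using bezout_const[of F "pderiv F"] degree_F pderiv_F by (metis degree_0 zero_neq_numeral)
  have "inj (\<lambda>c::'k. [:c:])" by (rule injI) simp
  with D(1) obtain z0 where z0: "poly D [:z0:] \<noteq> 0"
    using poly_nonroot[of D "\<lambda>c. [:c:]" "{}"] by auto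
  obtain x0 where x0: "x0 \<noteq> 0" "poly (poly D [:z0:]) x0 \<noteq> 0"
    using poly_nonroot[OF z0, of id "{0}"] by auto
  \<comment> \<open>The slope of the line Z = (z0 / x0) X. On it the eliminant D restricts to r,
    which is nonzero since its value at X = 1 is the nonzero value of D at (x0, z0).\<close>
  define \<zeta>' where "\<zeta>' = z0 / x0"
  define r where "r = subst2 [:0, x0:] [:0, z0:] D"
  define \<psi> where "\<psi> = substA [:0, x0:] [:0, z0:] x0"
  interpret \<psi>: comm_ring_hom \<psi> unfolding \<psi>_def by (rule comm_ring_hom_substA)
  interpret Z: comm_ring_hom "evZ 0 :: _ \<Rightarrow> 'k poly poly" by (rule comm_ring_hom_evZ)
  have "poly r 1 \<noteq> 0" using x0(2) by (simp add: r_def poly_subst2)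
  then have "r \<noteq> 0" by auto
  have \<psi>: "\<psi> (\<Theta> \<alpha> \<gamma> \<zeta> w) = kA x0 ^ d * evZ 0 (\<Theta> \<alpha> \<gamma> \<zeta>' w)" if "homogeneous d w" for d w
    unfolding \<psi>_def substA_\<Theta> evZ_\<Theta>
    by (rule coords_scale[OF that]) (use x0(1) in \<open>simp_all add: \<zeta> \<zeta>'_def\<close>)
  define a' where "a' = evZ 0 (\<Theta> \<alpha> \<gamma> \<zeta>' (dX \<zeta>' f))"
  define b' where "b' = evZ 0 (\<Theta> \<alpha> \<gamma> \<zeta>' (dY \<alpha> \<gamma> f))"
  \<comment> \<open>On Z = 0 the derivative along Z drops out of Euler's identity, so F itself lies
    in the ideal of the other two.\<close>
  have "of_nat 4 * evZ 0 (\<Theta> \<alpha> \<gamma> \<zeta>' f) = XA * a' + YA * b'"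
    unfolding a'_def b'_def evZ_\<Theta> coords_euler[OF comm_ring_hom_kA hom4] by simp
  then have "kA (1 / 4) * (4 * evZ 0 (\<Theta> \<alpha> \<gamma> \<zeta>' f)) = kA (1 / 4) * (XA * a' + YA * b')" by simp
  moreover have "kA (1 / 4) * (4 * x) = x" for x :: "'k poly poly"
  proof -
    have "kA (1 / 4) * (4 :: 'k poly poly) = 1" by (simp add: numeral_poly pCons_one)
    then show ?thesis by (metis mult.assoc mult.left_neutral)
  qed
  ultimately have F': "evZ 0 (\<Theta> \<alpha> \<gamma> \<zeta>' f) = kA (1 / 4) * (XA * a' + YA * b')" by simp
  have "[:r:] = \<psi> [:D:]" by (simp add: \<psi>_def r_def substA_gens)
  also have "\<dots> = \<psi> U * (kA x0 ^ 4 * evZ 0 (\<Theta> \<alpha> \<gamma> \<zeta>' f)) + \<psi> V * (kA x0 ^ 3 * b')"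
    unfolding D(2) \<psi>.hom_add \<psi>.hom_mult F_def b_def b'_def \<psi>[OF hom4] \<psi>[OF hom3(2)] ..
  also have "\<dots> = (\<psi> U * kA x0 ^ 4 * kA (1 / 4) * XA) * a' +
      (\<psi> U * kA x0 ^ 4 * kA (1 / 4) * YA + \<psi> V * kA x0 ^ 3) * b'"
    unfolding F' by (simp only: distrib_left distrib_right mult.assoc add.assoc)
  finally show thesis using that[OF \<open>r \<noteq> 0\<close>] unfolding a'_def b'_def by blast
qed

text \<open>Transversality of the line Z = 0 in the form in which it is used: restricted to this
  line, a and b generate an ideal that contains a nonzero polynomial in X alone.\<close>

locale transversal_chart = quartic_chart f \<alpha> \<gamma> \<zeta>
  for f :: "(3, 'k::{alg_closed_field, field_char_0}) mpoly" and \<alpha> \<gamma> \<zeta> +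
  fixes r U\<^sub>0 V\<^sub>0
  assumes r_nz: "r \<noteq> 0" and r_eq: "[:r:] = U\<^sub>0 * evZ 0 a + V\<^sub>0 * evZ 0 b"
begin

text \<open>A common factor of a and b inherits a unit leading coefficient from b, so its degree in
  Y survives the substitution Z = 0; there it divides r, which does not involve Y.\<close>

lemma eliminant:
  obtains D U V where "D \<noteq> 0" "[:D:] = U * a + V * b"
proof -
  interpret Z: comm_ring_hom "evZ 0 :: _ \<Rightarrow> 'k poly poly" by (rule comm_ring_hom_evZ)
  have "b \<noteq> 0" using degree_b by auto
  have "degree P = 0" if P: "P dvd b" "P dvd a" for P
  proof -
    obtain W where W: "b = P * W" using P(1) by (auto elim: dvdE)
    have "lead_coeff b = lead_coeff P * lead_coeff W" unfolding W by (rule lead_coeff_mult)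
    then have "lead_coeff P dvd 1" using lead_coeff_b dvd_mult_left by metis
    then have "degree (lead_coeff P) = 0" using dvd_imp_degree_le[of "lead_coeff P" 1] by auto
    then obtain t where t: "lead_coeff P = [:t:]" by (rule degree_eq_zeroE)
    have "P \<noteq> 0" using W \<open>b \<noteq> 0\<close> by auto
    then have "t \<noteq> 0" using t by auto
    then have "poly.coeff (evZ 0 P) (degree P) \<noteq> 0" using t by simp
    then have "degree P \<le> degree (evZ 0 P)" by (rule le_degree)
    also have "evZ 0 P dvd [:r:]"
      unfolding r_eq by (intro dvd_add dvd_mult Z.hom_dvd P)
    then have "degree (evZ 0 P) \<le> degree [:r:]" using r_nz by (intro dvd_imp_degree_le) simp_all
    finally show ?thesis by simp
  qed
  then obtain D U V where "D \<noteq> 0" "[:D:] = U * b + V * a"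
    using bezout_const[OF \<open>b \<noteq> 0\<close>, of a] by metis
  then show ?thesis using that[of D V U] by (simp add: add.commute)
qed

text \<open>Multiplication by the eliminant replaces a by a nonzero constant in Y, and such
  constants cancel modulo b.\<close>

lemma regular: "b dvd a * u \<Longrightarrow> b dvd u"
proof -
  assume dvd: "b dvd a * u"
  obtain D U V where D: "D \<noteq> 0" "[:D:] = U * a + V * b" by (rule eliminant)
  have "[:D:] * u = U * (a * u) + b * (V * u)" unfolding D(2) by (simp add: algebra_simps)
  also have "b dvd \<dots>" using dvd by simp
  finally show ?thesis using unit_lead_coeff_dvd_cancel[OF lead_coeff_b D(1)] by blast
qed

text \<open>On Z = 0 the relation becomes a syzygy of a and b. There b, a is again a regular
  sequence, by means of r, so the syzygy is a multiple t of the Koszul one. Subtracting a lift of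
  that multiple makes both coefficients divisible by Z.\<close>

lemma Z_cancel:
  assumes "ZS * w = x * a + y * b"
  shows "\<exists>x y. w = x * a + y * b"
proof -
  interpret Z: comm_ring_hom "evZ 0 :: _ \<Rightarrow> 'k poly poly" by (rule comm_ring_hom_evZ)
  have "evZ 0 ZS = (0 :: 'k poly poly)" by (simp add: evZ_const)
  then have 0: "evZ 0 x * evZ 0 a + evZ 0 y * evZ 0 b = 0"
    using arg_cong[OF assms, of "evZ 0"] by (simp only: Z.hom_add Z.hom_mult mult_zero_left)
  have "[:r:] * evZ 0 x = U\<^sub>0 * (evZ 0 x * evZ 0 a) + V\<^sub>0 * evZ 0 b * evZ 0 x"
    unfolding r_eq by (simp add: algebra_simps)
  also have "evZ 0 x * evZ 0 a = - (evZ 0 y * evZ 0 b)" using 0 by (simp add: add_eq_0_iff2)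
  also have "U\<^sub>0 * - (evZ 0 y * evZ 0 b) + V\<^sub>0 * evZ 0 b * evZ 0 x =
      evZ 0 b * (V\<^sub>0 * evZ 0 x - U\<^sub>0 * evZ 0 y)" by (simp add: algebra_simps)
  finally have "evZ 0 b dvd [:r:] * evZ 0 x" by simp
  then have "evZ 0 b dvd evZ 0 x" by (rule unit_lead_coeff_dvd_cancel[OF evZ_b(2) r_nz])
  then obtain t where t: "evZ 0 x = evZ 0 b * t" by (auto elim: dvdE)
  have "evZ 0 b \<noteq> 0" using evZ_b(1)[of 0] by auto
  moreover have "evZ 0 b * (t * evZ 0 a + evZ 0 y) = 0" using 0 by (simp add: t algebra_simps)
  ultimately have y: "evZ 0 y = - (t * evZ 0 a)" by (simp add: add_eq_0_iff)
  \<comment> \<open>The lift of t that does not involve Z.\<close>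
  define T where "T = map_poly (\<lambda>q. [:q:]) t"
  have T: "evZ 0 T = t" by (intro poly_eqI) (simp add: T_def coeff_map_poly)
  have ker: "ZS dvd P" if "evZ 0 P = 0" for P :: "'k poly poly poly"
  proof -
    have "[:- 0, 1:] dvd poly.coeff P n" for n
      unfolding poly_eq_0_iff_dvd[symmetric]
      using arg_cong[OF that, of "\<lambda>p. poly.coeff p n"] by simp
    then show ?thesis unfolding const_poly_dvd_iff by simp
  qed
  have "evZ 0 (x - T * b) = 0" "evZ 0 (y + T * a) = 0"
    by (simp_all add: Z.hom_minus Z.hom_add Z.hom_mult T t y mult.commute)
  then obtain x' y' where x': "x - T * b = ZS * x'" and y': "y + T * a = ZS * y'"
    using ker by (metis dvdE)
  have "ZS * w = (x - T * b) * a + (y + T * a) * b"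
    unfolding assms by (simp add: algebra_simps)
  also have "\<dots> = ZS * (x' * a + y' * b)" unfolding x' y' by (simp only: distrib_left mult.assoc)
  finally have "w = x' * a + y' * b" by (simp only: mult_cancel_left) simp
  then show ?thesis by blast
qed

lemma Z_power_cancel:
  assumes "ZS ^ n * w = x * a + y * b"
  shows "\<exists>x y. w = x * a + y * b"
  using assms
proof (induction n arbitrary: x y)
  case 0
  then show ?case by (simp only: power_0 mult_1_left) blast
next
  case (Suc n)
  then have "ZS * (ZS ^ n * w) = x * a + y * b" by (simp only: power_Suc mult.assoc)
  from Z_cancel[OF this] Suc.IH show ?case by blast
qed

text \<open>The eliminant D(X, Z) becomes D(t X, t), a polynomial in X alone; it is nonzero because
  D does not vanish at (x, t).\<close>

lemma affine_eliminant:
  obtains p U V where "p \<noteq> 0" "[:p:] = U * evZ 1 a + V * evZ 1 b"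
proof -
  obtain D U V where D: "D \<noteq> 0" "[:D:] = U * a + V * b" by (rule eliminant)
  have "inj (\<lambda>c::'k. [:c:])" by (rule injI) simp
  with D(1) obtain t where t: "t \<noteq> 0" "poly D [:t:] \<noteq> 0"
    using poly_nonroot[of D "\<lambda>c. [:c:]" "{0}"] by auto
  obtain x where x: "poly (poly D [:t:]) x \<noteq> 0"
    using poly_nonroot[OF t(2), of id "{}"] by auto
  define p where "p = subst2 [:0, t:] [:t:] D"
  define \<psi> where "\<psi> = substA [:0, t:] [:t:] t"
  interpret \<psi>: comm_ring_hom \<psi> unfolding \<psi>_def by (rule comm_ring_hom_substA)
  have "poly p (x / t) \<noteq> 0" using x t(1) by (simp add: p_def poly_subst2)
  then have "p \<noteq> 0" by auto
  have \<psi>: "\<psi> (\<Theta> \<alpha> \<gamma> \<zeta> w) = kA t ^ d * evZ 1 (\<Theta> \<alpha> \<gamma> \<zeta> w)" if "homogeneous d w" for d w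
    unfolding \<psi>_def substA_\<Theta> evZ_\<Theta>
    by (rule coords_scale[OF that]) (simp_all add: distrib_left mult.commute)
  have "[:p:] = \<psi> [:D:]" by (simp add: \<psi>_def p_def substA_gens)
  also have "\<dots> = \<psi> U * (kA t ^ 3 * evZ 1 a) + \<psi> V * (kA t ^ 3 * evZ 1 b)"
    unfolding D(2) \<psi>.hom_add \<psi>.hom_mult a_def b_def \<psi>[OF hom3(1)] \<psi>[OF hom3(2)] ..
  also have "\<dots> = (\<psi> U * kA t ^ 3) * evZ 1 a + (\<psi> V * kA t ^ 3) * evZ 1 b"
    by (simp only: mult.assoc)
  finally show thesis using that[OF \<open>p \<noteq> 0\<close>] by blast
qed

text \<open>On Z = 1 Euler's identity writes c as 4 g - j with j in (a, b), which transfers the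
  relation for g to c.\<close>

lemma affine_relation:
  obtains s u v where "evZ 1 c - s * (evZ 1 c)\<^sup>2 = u * evZ 1 a + v * evZ 1 b"
proof -
  obtain p U V where p: "p \<noteq> 0" "[:p:] = U * evZ 1 a + V * evZ 1 b" by (rule affine_eliminant)
  obtain s u v where s: "evZ 1 F - s * (evZ 1 F)\<^sup>2 = u * evZ 1 a + v * evZ 1 b"
    using affine_quartic_gradient[of p U "evZ 1 F" V] p evZ_b(2) filt_F no_line
    unfolding evZ_1_derivs by blast
  define g where "g = evZ 1 F"
  define j where "j = XA * evZ 1 a + YA * evZ 1 b"
  \<comment> \<open>The factor 1/4 compensates for c^2 being 16 g^2 while c is 4 g modulo (a,
    b).\<close>
  define s' where "s' = kA (1 / 4) * s"
  have "kA (1 / 4) * (4 :: 'k poly poly) = 1" by (simp add: numeral_poly pCons_one)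
  then have s4: "4 * s' = s" unfolding s'_def by (metis mult.assoc mult.commute mult.left_neutral)
  have c: "evZ 1 c = 4 * g - j"
  proof -
    have "4 * g = j + evZ 1 c"
      using evZ_euler[of 1] unfolding g_def j_def by (simp only: pCons_one mult_1_left)
    then show ?thesis by simp
  qed
  have "evZ 1 c - s' * (evZ 1 c)\<^sup>2 = 4 * (g - (4 * s') * g\<^sup>2) + j * (8 * s' * g - 1 - s' * j)"
    unfolding c power2_eq_square by (simp only: algebra_simps) simp
  also have "\<dots> = 4 * (u * evZ 1 a + v * evZ 1 b) + j * (8 * s' * g - 1 - s' * j)"
    unfolding s4 using s by (simp only: g_def)
  also have "\<dots> = (4 * u + XA * (8 * s' * g - 1 - s' * j)) * evZ 1 a +
      (4 * v + YA * (8 * s' * g - 1 - s' * j)) * evZ 1 b"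
  proof -
    have "4 * (u * a' + v * b') + (x * a' + y * b') * t = (4 * u + x * t) * a' + (4 * v + y * t) * b'"
      for a' b' x y t :: "'k poly poly" by (simp add: algebra_simps)
    then show ?thesis unfolding j_def .
  qed
  finally show thesis by (rule that)
qed

end

context transversal_chart
begin

text \<open>Homogenisation carried out in the fraction field: H sends X and Y to X/Z and Y/Z, and a
  power of Z clears all denominators.\<close>

lemma projective_relation:
  obtains n s u v where "ZS ^ n * c - s * c\<^sup>2 = u * a + v * b"
proof -
  define z where "z = to_fract (ZS :: 'k poly poly poly)"
  have z: "z \<noteq> 0" unfolding z_def by (simp add: to_fract_eq_0_iff)
  define xz where "xz = to_fract XS / z"
  define yz where "yz = to_fract YS / z"
  have xz: "to_fract XS = z * xz" and yz: "to_fract YS = z * yz"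
    using z unfolding xz_def yz_def by (metis nonzero_mult_div_cancel_left times_divide_eq_right)+
  define \<kappa> where "\<kappa> x = to_fract (kS x)" for x :: 'k
  define H where "H = poly_lift (poly_lift \<kappa> (xz)) (yz)"
  have \<kappa>: "comm_ring_hom \<kappa>"
    unfolding \<kappa>_def by (rule comm_ring_hom_comp[OF to_fract_hom.comm_ring_hom_axioms comm_ring_hom_kS])
  interpret \<kappa>: comm_ring_hom \<kappa> by (rule \<kappa>)
  interpret h: comm_ring_hom "poly_lift \<kappa> (xz)" by (rule \<kappa>.comm_ring_hom_poly_lift)
  interpret H: comm_ring_hom H unfolding H_def by (rule h.comm_ring_hom_poly_lift)
  have H_pCons: "H (pCons q P) = poly_lift \<kappa> (xz) q + yz * H P" for q P
    unfolding H_def by (rule h.poly_lift_pCons)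
  have H_const: "H [:q:] = poly_lift \<kappa> (xz) q" for q
    by (simp add: H_pCons)
  have H_evZ: "z ^ d * H (evZ 1 (\<Theta> \<alpha> \<gamma> \<zeta> w)) = to_fract (\<Theta> \<alpha> \<gamma> \<zeta> w)" if "homogeneous d w" for d w
  proof -
    have 1: "evZ 1 (kS x) = kA x" "evZ 1 XS = XA" "evZ 1 ZS = kA 1" for x :: 'k
      unfolding evZ_const by simp_all
    have 2: "H (kA x) = \<kappa> x" "H XA = xz" "H YA = yz" for x
      unfolding H_const H_pCons by (simp_all add: h.hom_one \<kappa>.hom_zero)
    show ?thesis
      unfolding hom_\<Theta>[OF comm_ring_hom_comp[OF H.comm_ring_hom_axioms comm_ring_hom_evZ]]
        hom_\<Theta>[OF to_fract_hom.comm_ring_hom_axioms] 1 2 evZ_Y \<kappa>_def[symmetric] z_def[symmetric]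
      by (rule coords_scale[OF that, symmetric]) (simp_all only: xz yz \<kappa>.hom_one distrib_left mult_1_right mult.left_commute)
  qed
  \<comment> \<open>The localisation at the powers of Z, seen inside the fraction field; it contains
    the image of H.\<close>
  define Cl where "Cl = {x. \<exists>n w. z ^ n * x = to_fract w}"
  have ClI: "z ^ n * x = to_fract w \<Longrightarrow> x \<in> Cl" for n x w by (auto simp: Cl_def)
  have Cl_add: "x + y \<in> Cl" and Cl_mult: "x * y \<in> Cl" if xy: "x \<in> Cl" "y \<in> Cl" for x y
  proof -
    obtain n w where x: "z ^ n * x = to_fract w" using xy by (auto simp: Cl_def)
    obtain m v where y: "z ^ m * y = to_fract v" using xy by (auto simp: Cl_def)
    have "z ^ (n + m) * (x + y) = z ^ m * (z ^ n * x) + z ^ n * (z ^ m * y)"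
      by (simp add: power_add algebra_simps)
    also have "\<dots> = to_fract (ZS ^ m * w + ZS ^ n * v)"
      unfolding x y
      by (simp only: z_def to_fract_hom.hom_add to_fract_hom.hom_mult to_fract_hom.hom_power)
    finally show "x + y \<in> Cl" by (rule ClI)
    have "z ^ (n + m) * (x * y) = (z ^ n * x) * (z ^ m * y)"
      by (simp add: power_add algebra_simps)
    also have "\<dots> = to_fract (w * v)" unfolding x y by (simp only: to_fract_hom.hom_mult)
    finally show "x * y \<in> Cl" by (rule ClI)
  qed
  have Cl_gens: "\<kappa> x \<in> Cl" "xz \<in> Cl" "yz \<in> Cl" "0 \<in> Cl" for x
    using ClI[of 0 "\<kappa> x" "kS x"] ClI[of 1 "xz" XS] ClI[of 1 "yz" YS] ClI[of 0 0 0]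
    by (simp_all only: power_0 power_one_right mult_1_left xz yz \<kappa>_def to_fract_hom.hom_zero)
  have "poly_lift \<kappa> (xz) q \<in> Cl" for q
    by (induction q) (simp_all only: \<kappa>.poly_lift_0 \<kappa>.poly_lift_pCons Cl_gens Cl_add Cl_mult)
  then have H_Cl: "H P \<in> Cl" for P
    by (induction P) (simp_all only: H.hom_zero H_pCons Cl_gens Cl_add Cl_mult)
  obtain s u v where rel: "evZ 1 c - s * (evZ 1 c)\<^sup>2 = u * evZ 1 a + v * evZ 1 b"
    by (rule affine_relation)
  obtain i s1 where s1: "z ^ i * H s = to_fract s1" using H_Cl[of s] by (auto simp: Cl_def)
  obtain j u1 where u1: "z ^ j * H u = to_fract u1" using H_Cl[of u] by (auto simp: Cl_def)
  obtain k v1 where v1: "z ^ k * H v = to_fract v1" using H_Cl[of v] by (auto simp: Cl_def)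
  define \<gamma>' where "\<gamma>' = H (evZ 1 c)"
  define \<alpha>' where "\<alpha>' = H (evZ 1 a)"
  define \<beta>' where "\<beta>' = H (evZ 1 b)"
  have fr: "to_fract c = z ^ 3 * \<gamma>'" "to_fract a = z ^ 3 * \<alpha>'" "to_fract b = z ^ 3 * \<beta>'"
    unfolding \<gamma>'_def \<alpha>'_def \<beta>'_def a_def b_def c_def by (simp_all only: H_evZ hom3)
  have relH: "\<gamma>' = H s * \<gamma>'\<^sup>2 + (H u * \<alpha>' + H v * \<beta>')"
  proof -
    have "\<gamma>' - H s * \<gamma>'\<^sup>2 = H u * \<alpha>' + H v * \<beta>'"
      using arg_cong[OF rel, of H]
      by (simp only: \<gamma>'_def \<alpha>'_def \<beta>'_def H.hom_minus H.hom_mult H.hom_add H.hom_power)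
    then show ?thesis by (simp add: diff_eq_eq add.commute)
  qed
  \<comment> \<open>The exponents i, j, k clear the denominators of s, u, v. The additional 3 is the
    difference between the degree 6 of c^2 and the degree 3 of c.\<close>
  have "to_fract (ZS ^ (i + j + k + 3) * c - (ZS ^ (j + k) * s1) * c\<^sup>2) =
      z ^ (i + j + k + 3) * (z ^ 3 * \<gamma>') - (z ^ (j + k) * (z ^ i * H s)) * (z ^ 3 * \<gamma>')\<^sup>2"
    unfolding to_fract_hom.hom_minus to_fract_hom.hom_mult to_fract_hom.hom_power fr s1 z_def[symmetric] ..
  also have "\<dots> = z ^ (i + j + k + 6) * (\<gamma>' - H s * \<gamma>'\<^sup>2)"
    by (simp add: power_add algebra_simps eval_nat_numeral)
  also have "\<gamma>' - H s * \<gamma>'\<^sup>2 = H u * \<alpha>' + H v * \<beta>'" by (subst (1) relH) simp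
  also have "z ^ (i + j + k + 6) * (H u * \<alpha>' + H v * \<beta>') =
      z ^ (i + k + 3) * (z ^ j * H u) * (z ^ 3 * \<alpha>') + z ^ (i + j + 3) * (z ^ k * H v) * (z ^ 3 * \<beta>')"
    by (simp add: power_add algebra_simps eval_nat_numeral)
  also have "\<dots> = to_fract (ZS ^ (i + k + 3) * u1 * a + ZS ^ (i + j + 3) * v1 * b)"
    unfolding to_fract_hom.hom_add to_fract_hom.hom_mult to_fract_hom.hom_power fr u1 v1 z_def[symmetric] ..
  finally show thesis by (intro that) (simp only: to_fract_eq_iff)
qed

text \<open>If u c^2 is in (a, b), the projective relation times u puts Z^n u c into (a, b), and Z
  cancels there.\<close>

theorem d_sequence_chart: "d_sequence (dX \<zeta> f) (dY \<alpha> \<gamma> f) (mpderiv 2 f)"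
proof
  interpret T: comm_ring_hom "\<Theta> \<alpha> \<gamma> \<zeta>" by (rule comm_ring_hom_\<Theta>)
  interpret I: comm_ring_hom "\<Theta>_inv \<alpha> \<gamma> \<zeta>" by (rule comm_ring_hom_\<Theta>_inv)
  show "dY \<alpha> \<gamma> f \<noteq> 0"
    using degree_b T.hom_zero by (auto simp: b_def)
  fix u
  show "dY \<alpha> \<gamma> f dvd u" if "dY \<alpha> \<gamma> f dvd dX \<zeta> f * u"
  proof -
    have "b dvd a * \<Theta> \<alpha> \<gamma> \<zeta> u"
      using T.hom_dvd[OF that] by (simp only: a_def b_def T.hom_mult)
    from I.hom_dvd[OF regular[OF this]] show ?thesis by (simp only: b_def \<Theta>_inv_\<Theta>)
  qed
  fix x y
  assume "u * (mpderiv 2 f)\<^sup>2 = x * dX \<zeta> f + y * dY \<alpha> \<gamma> f"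
  from arg_cong[OF this, of "\<Theta> \<alpha> \<gamma> \<zeta>"]
  have eq: "\<Theta> \<alpha> \<gamma> \<zeta> u * c\<^sup>2 = \<Theta> \<alpha> \<gamma> \<zeta> x * a + \<Theta> \<alpha> \<gamma> \<zeta> y * b"
    by (simp only: T.hom_mult T.hom_add T.hom_power a_def b_def c_def)
  obtain n s v w where rel: "ZS ^ n * c - s * c\<^sup>2 = v * a + w * b" by (rule projective_relation)
  define t where "t = \<Theta> \<alpha> \<gamma> \<zeta> u"
  have "ZS ^ n * (t * c) = t * (ZS ^ n * c - s * c\<^sup>2) + s * (t * c\<^sup>2)"
    by (simp only: right_diff_distrib mult.left_commute[of t] diff_add_cancel)
  also have "\<dots> = (t * v + s * \<Theta> \<alpha> \<gamma> \<zeta> x) * a + (t * w + s * \<Theta> \<alpha> \<gamma> \<zeta> y) * b"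
    unfolding rel eq[folded t_def] by (simp only: distrib_left distrib_right mult.assoc ac_simps)
  finally obtain x' y' where "t * c = x' * a + y' * b" using Z_power_cancel by blast
  from arg_cong[OF this, of "\<Theta>_inv \<alpha> \<gamma> \<zeta>"]
  have "u * mpderiv 2 f = \<Theta>_inv \<alpha> \<gamma> \<zeta> x' * dX \<zeta> f + \<Theta>_inv \<alpha> \<gamma> \<zeta> y' * dY \<alpha> \<gamma> f"
    by (simp only: I.hom_mult I.hom_add t_def a_def b_def c_def \<Theta>_inv_\<Theta>)
  then show "\<exists>x y. u * mpderiv 2 f = x * dX \<zeta> f + y * dY \<alpha> \<gamma> f" by blast
qed

end

section \<open>The gradient ideal in new coordinates and the conclusion\<close>

lemma ideal3_subset:
  assumes "a \<in> ideal3 a' b' c'" "b \<in> ideal3 a' b' c'" "c \<in> ideal3 a' b' c'"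
  shows "ideal3 a b c \<subseteq> ideal3 a' b' c'"
proof
  fix x assume "x \<in> ideal3 a b c"
  then obtain u v w where x: "x = u * a + v * b + w * c" by (auto simp: ideal3_def)
  obtain a1 a2 a3 b1 b2 b3 c1 c2 c3 where
    "a = a1 * a' + a2 * b' + a3 * c'" "b = b1 * a' + b2 * b' + b3 * c'" "c = c1 * a' + c2 * b' + c3 * c'"
    using assms by (auto simp: ideal3_def)
  then have "x = (u * a1 + v * b1 + w * c1) * a' + (u * a2 + v * b2 + w * c2) * b' +
      (u * a3 + v * b3 + w * c3) * c'"
    by (simp add: x algebra_simps)
  then show "x \<in> ideal3 a' b' c'" by (simp only: ideal3I)
qed

lemma gradient_ideal_coords:
  "gradient_ideal f = ideal3 (dX \<zeta> f) (dY \<alpha> \<gamma> f) (mpderiv 2 f)"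
proof -
  let ?a = "mpderiv 0 f" and ?b = "mpderiv 1 f" and ?c = "mpderiv 2 f"
  let ?I = "ideal3 (dX \<zeta> f) (dY \<alpha> \<gamma> f) ?c"
  have "dX \<zeta> f = 1 * ?a + 0 * ?b + mconst \<zeta> * ?c"
    "dY \<alpha> \<gamma> f = mconst \<alpha> * ?a + 1 * ?b + mconst \<gamma> * ?c" "?c = 0 * ?a + 0 * ?b + 1 * ?c"
    by (simp_all add: dX_def dY_def)
  then have "dX \<zeta> f \<in> ideal3 ?a ?b ?c" "dY \<alpha> \<gamma> f \<in> ideal3 ?a ?b ?c" "?c \<in> ideal3 ?a ?b ?c"
    by (metis ideal3I)+
  then have "?I \<subseteq> ideal3 ?a ?b ?c" by (rule ideal3_subset)
  moreover have "?a = 1 * dX \<zeta> f + 0 * dY \<alpha> \<gamma> f + (- mconst \<zeta>) * ?c"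
    "?b = (- mconst \<alpha>) * dX \<zeta> f + 1 * dY \<alpha> \<gamma> f + (mconst \<alpha> * mconst \<zeta> - mconst \<gamma>) * ?c"
    "?c = 0 * dX \<zeta> f + 0 * dY \<alpha> \<gamma> f + 1 * ?c"
    by (simp_all add: dX_def dY_def algebra_simps)
  then have "?a \<in> ?I" "?b \<in> ?I" "?c \<in> ?I" by (metis ideal3I)+
  then have "ideal3 ?a ?b ?c \<subseteq> ?I" by (rule ideal3_subset)
  ultimately show ?thesis by (simp add: gradient_ideal_def genideal_triple)
qed

text \<open>A nonzero form does not vanish identically over an infinite field, even on points with y
  nonzero; dividing by y brings such a point off the curve into the shape (\<alpha> : 1 :
  \<gamma>).\<close>

lemma exists_quartic_chart:
  fixes f :: "(3, 'k::{alg_closed_field, field_char_0}) mpoly"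
  assumes "homogeneous 4 f" "Factorial_Ring.irreducible f"
  shows "\<exists>\<alpha> \<gamma>. \<forall>\<zeta>. quartic_chart f \<alpha> \<gamma> \<zeta>"
proof -
  define P where "P = \<Theta> 0 0 0 f"
  have "P \<noteq> 0" using \<Theta>_irreducible[OF assms(2), of 0 0 0] by (auto simp: P_def)
  have inj: "inj (\<lambda>c::'k. [:[:c:]:])" "inj (\<lambda>c::'k. [:c:])" by (auto intro: injI)
  obtain y where y: "y \<noteq> 0" "poly P [:[:y:]:] \<noteq> 0"
    using poly_nonroot[OF \<open>P \<noteq> 0\<close> inj(1), of "{0}"] by auto
  obtain z where z: "poly (poly P [:[:y:]:]) [:z:] \<noteq> 0"
    using poly_nonroot[OF y(2) inj(2), of "{}"] by auto
  obtain x where x: "poly (poly (poly P [:[:y:]:]) [:z:]) x \<noteq> 0"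
    using poly_nonroot[OF z, of id "{}"] by auto
  define T where "T p = poly (poly (poly p [:[:y:]:]) [:z:]) x" for p
  have T: "comm_ring_hom T"
    unfolding T_def
    by (rule comm_ring_hom_comp[OF comm_ring_hom_poly comm_ring_hom_comp[OF comm_ring_hom_poly comm_ring_hom_poly]])
  have T_gens: "(\<lambda>s. T (kS s)) = id" "T XS = x" "T ZS = z" "T YS = y"
    by (simp_all add: T_def fun_eq_iff)
  have "quartic_chart f (x / y) (z / y) \<zeta>" for \<zeta>
  proof
    have "coords id 0 0 0 x y z = (\<lambda>i. y * coords id (x / y) (z / y) \<zeta> 0 1 0 i)"
      using y(1) by (intro ext) (simp add: coords_def)
    then have "T P = y ^ 4 * mpoly_eval id (coords id (x / y) (z / y) \<zeta> 0 1 0) f"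
      unfolding P_def hom_\<Theta>[OF T] T_gens by (simp only: mpoly_eval_homogeneous[OF assms(1)])
    then show "mpoly_eval id (coords id (x / y) (z / y) \<zeta> 0 1 0) f \<noteq> 0"
      using x by (auto simp: T_def)
  qed (rule assms)+
  then show ?thesis by blast
qed

theorem linear_type_irreducible_quartic:
  fixes f :: "(3, 'k::{alg_closed_field, field_char_0}) mpoly"
  assumes "homogeneous 4 f" "Factorial_Ring.irreducible f"
  shows "linear_type (gradient_ideal f)"
proof -
  obtain \<alpha> \<gamma> where chart: "\<And>\<zeta>. quartic_chart f \<alpha> \<gamma> \<zeta>" using exists_quartic_chart[OF assms] by auto
  obtain \<zeta> r U V where r: "r \<noteq> 0"
    "[:r:] = U * evZ 0 (\<Theta> \<alpha> \<gamma> \<zeta> (dX \<zeta> f)) + V * evZ 0 (\<Theta> \<alpha> \<gamma> \<zeta> (dY \<alpha> \<gamma> f))"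
    by (rule quartic_chart.exists_chart_change[OF chart refl])
  interpret quartic_chart f \<alpha> \<gamma> \<zeta> by (rule chart)
  interpret transversal_chart f \<alpha> \<gamma> \<zeta> r U V
    by unfold_locales (use r in \<open>simp_all only: a_def b_def not_False_eq_True\<close>)
  interpret d_sequence "dX \<zeta> f" "dY \<alpha> \<gamma> f" "mpderiv 2 f" by (rule d_sequence_chart)
  show ?thesis unfolding gradient_ideal_coords[of f \<zeta> \<alpha> \<gamma>] by (rule linear_type_I)
qed

lemma homogeneous_family_member: "homogeneous d F \<Longrightarrow> homogeneous d (family_member F \<alpha>)"
  by (auto simp: homogeneous_def family_member_def in_keys_iff Poly_Mapping.map.rep_eq when_def)

theorem theorem3p12:
  fixes F :: "(3, (nat, 'k::{alg_closed_field, field_char_0}) mpoly) mpoly"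
    and m :: nat
  assumes "plane_curve_family 4 m F"
    and "\<exists>S \<tau>. for_general m (\<lambda>\<alpha>.
           Factorial_Ring.irreducible (family_member F \<alpha>) \<and>
           rational_curve (family_member F \<alpha>) \<and>
           singular_points (family_member F \<alpha>) = S \<and>
           (\<forall>p\<in>S. singularity_type (family_member F \<alpha>) p = \<tau> p))"
  shows "for_general m (\<lambda>\<alpha>. linear_type (gradient_ideal (family_member F \<alpha>)))"
proof -
  have "homogeneous 4 F" using assms(1) by (simp add: plane_curve_family_def)
  then have "linear_type (gradient_ideal (family_member F \<alpha>))"
    if "Factorial_Ring.irreducible (family_member F \<alpha>)" for \<alpha>
    using that by (intro linear_type_irreducible_quartic homogeneous_family_member)
  \<comment> \<open>The proper closed set outside of which the members are irreducible serves again
    for the conclusion.\<close>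
  with assms(2) show ?thesis unfolding for_general_def by blast
qed

end
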